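(* Assume (A1). Let $D_n$ be the depth of the last inserted ball in the split tree $T^n$, let $D_k$ ($1\le k\le n$) be the depth of the $k$-th inserted ball after all $n$ balls have been inserted, and let $D_n^*=\frac1n\sum_{k=1}^n D_k$. Then, as $n\to\infty$, $$\frac{\mathbf E(D_n)-\mu^{-1}\ln n}{\sqrt{\ln n}}\to 0,\qquad \frac{\mathbf E(D_n^* )-\mu^{-1}\ln n}{\sqrt{\ln n}}\to 0,$$ and for every choice of $k=k(n)$ with $\frac{n}{\ln n}\le k\le n$, $$\frac{\mathbf{Var}(D_k)}{\ln n}\to \sigma^2\mu^{-3}.$$
   Context: Split trees. Fix integers $b\ge 2$, $s\ge 1$, $s_0,s_1\ge 0$ with $s_0\le s$ and $bs_1\le s+1-s_0$, and a random vector $\mathcal V=(V_1,\dots,V_b)$ with $V_i\ge 0$, $\sum_i V_i=1$, whose components are identically distributed; let $V$ be a random variable with this common law. Let $S_b$ be the infinite rooted tree in which every vertex has $b$ children labelled $1,\dots,b$, and attach to each vertex $v$ an independent copy $\mathcal V_v$ of $\mathcal V$. Balls are inserted one at a time at the root. For a vertex $v$, $n_v$ is the number of balls in the subtree of $S_b$ rooted at $v$ and $C_v$ the number held by $v$ itself; $v$ is a leaf if $C_v=n_v>0$. A ball arriving at $v$ is handled as follows: if $n_v=0$, or $v$ is a leaf with $C_v<s$, the ball is placed at $v$; if $n_v>0$ and $v$ is not a leaf, the ball moves to the $i$-th child with probability equal to the $i$-th component of $\mathcal V_v$ and is handled there by the same rules; if $v$ is a leaf with $C_v=s$, then of the $s+1$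 balls, $s_0$ uniformly chosen balls stay at $v$, $s_1$ uniformly chosen balls are sent to each of the $b$ children, and each of the remaining $s+1-s_0-bs_1$ balls is sent to a child chosen independently according to $\mathcal V_v$; balls sent to a child are handled there by the same rules (so balls may move down during the process). After $n$ balls have been inserted, the split tree $T^n$ consists of all vertices $v$ of $S_b$ with $n_v>0$. The depth of a ball is the distance from the root to the vertex holding it. Set $\mu:=b\,\mathbf E(-V\ln V)$ and $\sigma^2:=b\,\mathbf E(V\ln^2 V)-\mu^2$. Assumption (A1): $\mathbf P(V=0)=\mathbf P(V=1)=0$ and $-\ln V$ has a non-lattice distribution. *)

theory Defs
  imports "HOL-Probability.Probability" "HOL-Library.Sublist"
begin

text \<open>Vertices of the infinite b-ary tree are lists of child labels; labels are 0..b-1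
 (the paper uses 1..b). A configuration maps a ball index (0-based: ball k of the paper
 is index k-1) to the vertex holding it (None = not (yet / currently) placed).\<close>

type_synonym config = "nat \<Rightarrow> nat list option"

definition balls_in :: "config \<Rightarrow> nat list \<Rightarrow> nat set" where
  "balls_in cfg v = {k. \<exists>u. cfg k = Some u \<and> prefix v u}"

definition balls_at :: "config \<Rightarrow> nat list \<Rightarrow> nat set" where
  "balls_at cfg v = {k. cfg k = Some v}"

definition n_v :: "config \<Rightarrow> nat list \<Rightarrow> nat" where
  "n_v cfg v = card (balls_in cfg v)"

definition C_v :: "config \<Rightarrow> nat list \<Rightarrow> nat" where
  "C_v cfg v = card (balls_at cfg v)"

definition is_leaf :: "config \<Rightarrow> nat list \<Rightarrow> bool" where
  "is_leaf cfg v \<longleftrightarrow> C_v cfg v = n_v cfg v \<and> n_v cfg v > 0"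

definition child_pmf :: "nat \<Rightarrow> (nat \<Rightarrow> real) \<Rightarrow> nat pmf" where
  "child_pmf b w = (if (\<forall>i<b. 0 \<le> w i) \<and> (\<Sum>i<b. w i) = 1
     then embed_pmf (\<lambda>i. if i < b then w i else 0) else return_pmf 0)"

text \<open>Handling of a list of pending tasks (ball, vertex, route). route = False: the ball
 arrives at the vertex and is handled by the rules; route = True: the ball is at the
 (non-leaf / splitting) vertex and is sent to a child chosen according to the split vector
 of that vertex. The vector field \<omega> assigns to every vertex its split vector.\<close>

partial_function (spmf) handle ::
  "nat \<Rightarrow> nat \<Rightarrow> nat \<Rightarrow> nat \<Rightarrow> (nat list \<Rightarrow> nat \<Rightarrow> real) \<Rightarrow> (nat \<times> nat list \<times> bool) list
    \<Rightarrow> config \<Rightarrow> config spmf" where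
  "handle b s s0 s1 \<omega> ts cfg =
    (case ts of
       [] \<Rightarrow> return_spmf cfg
     | (k, v, r) # ts' \<Rightarrow>
         (if r then
            bind_spmf (spmf_of_pmf (child_pmf b (\<omega> v)))
              (\<lambda>i. handle b s s0 s1 \<omega> ((k, v @ [i], False) # ts') cfg)
          else if n_v cfg v = 0 \<or> (is_leaf cfg v \<and> C_v cfg v < s) then
            handle b s s0 s1 \<omega> ts' (cfg(k \<mapsto> v))
          else if \<not> is_leaf cfg v then
            handle b s s0 s1 \<omega> ((k, v, True) # ts') cfg
          else
            bind_spmf (spmf_of_set {xs. distinct xs \<and> set xs = insert k (balls_at cfg v)})
              (\<lambda>xs.
                 let stay = take s0 xs;
                     cfg' = (\<lambda>j. if j \<in> set xs then (if j \<in> set stay then Some v else None)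
                                 else cfg j);
                     fixedT = concat (map (\<lambda>i. map (\<lambda>j. (j, v @ [i], False))
                                   (take s1 (drop (s0 + i * s1) xs))) [0..<b]);
                     randT = map (\<lambda>j. (j, v, True)) (drop (s0 + b * s1) xs)
                 in handle b s s0 s1 \<omega> (fixedT @ randT @ ts') cfg')))"

primrec insert_balls ::
  "nat \<Rightarrow> nat \<Rightarrow> nat \<Rightarrow> nat \<Rightarrow> (nat list \<Rightarrow> nat \<Rightarrow> real) \<Rightarrow> nat \<Rightarrow> config spmf" where
  "insert_balls b s s0 s1 \<omega> 0 = return_spmf Map.empty"
| "insert_balls b s s0 s1 \<omega> (Suc n) =
     bind_spmf (insert_balls b s s0 s1 \<omega> n) (handle b s s0 s1 \<omega> [(n, [], False)])"

definition split_law ::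
  "nat \<Rightarrow> nat \<Rightarrow> nat \<Rightarrow> nat \<Rightarrow> (nat \<Rightarrow> real) measure \<Rightarrow> nat \<Rightarrow> config measure" where
  "split_law b s s0 s1 Vlaw n =
     PiM UNIV (\<lambda>_::nat list. Vlaw) \<bind> (\<lambda>\<omega>. measure_spmf (insert_balls b s s0 s1 \<omega> n))"

definition depth :: "config \<Rightarrow> nat \<Rightarrow> real" where
  "depth cfg k = (case cfg k of Some u \<Rightarrow> real (length u) | None \<Rightarrow> 0)"

text \<open>E(D_k) and Var(D_k) in T^n (k is 1-based as in the paper).\<close>
definition ED :: "nat \<Rightarrow> nat \<Rightarrow> nat \<Rightarrow> nat \<Rightarrow> (nat \<Rightarrow> real) measure \<Rightarrow> nat \<Rightarrow> nat \<Rightarrow> real" where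
  "ED b s s0 s1 Vlaw n k = (\<integral>cfg. depth cfg (k - 1) \<partial>split_law b s s0 s1 Vlaw n)"

definition VarD :: "nat \<Rightarrow> nat \<Rightarrow> nat \<Rightarrow> nat \<Rightarrow> (nat \<Rightarrow> real) measure \<Rightarrow> nat \<Rightarrow> nat \<Rightarrow> real" where
  "VarD b s s0 s1 Vlaw n k =
     (\<integral>cfg. (depth cfg (k - 1) - ED b s s0 s1 Vlaw n k)\<^sup>2 \<partial>split_law b s s0 s1 Vlaw n)"

text \<open>Non-lattice (Feller's convention): not concentrated on d*Z for any d > 0.\<close>
definition non_lattice :: "'a measure \<Rightarrow> ('a \<Rightarrow> real) \<Rightarrow> bool" where
  "non_lattice M X \<longleftrightarrow> \<not> (\<exists>d>0. AE x in M. \<exists>z::int. X x = d * real_of_int z)"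

end

theory Submission
  imports Defs "HOL-Real_Asymp.Real_Asymp"
begin

text \<open>
  Follow one ball down the tree. If it has rank \<open>k\<close> among the \<open>n\<close> balls of the current subtree and
  \<open>k > s + 1\<close>, then the child it enters is reached with a size-biased split proportion \<open>p\<close>, its rank there is
  \<open>1 + s1 + Bin(k - 1 - s0 - b s1, p)\<close>, and its depth drops by one. Hence \<open>ln k\<close> decreases at each step by
  \<open>\<mu>\<close> on average with variance \<open>\<sigma>2\<close>, up to errors of order \<open>1 / k\<close>. Running the chain until the rank is at
  most \<open>H\<close> writes \<open>\<mu> D - ln k\<close> as an almost-martingale, with second moment close to \<open>\<sigma>2 / \<mu> ln k\<close>, plus a
  residual. The residual is controlled by a crude exponential moment of the depth together with a bound on how
  the ratio \<open>n / k\<close> can grow on the way down; for \<open>k \<ge> n / ln n\<close> its second moment is small compared with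
  \<open>ln n\<close> as \<open>H\<close> grows.
\<close>

section \<open>The insertion procedure\<close>

text \<open>\<open>handle\<close> may diverge: with \<open>s0 = s1 = 0\<close> an exceptional
  environment can route the balls of an overfull leaf together for ever. Lost mass is therefore
  carried through every inequality until the expected number of ordered pairs of balls sharing a
  subtree, which each level shrinks by \<open>rho < 1\<close>, shows that almost every environment
  is lossless. The same contraction gives the exponential moments. Only ranks above
  \<open>s + 1\<close> are followed, because those balls choose their child by one draw from the
  split vector, while the balls of the splitting leaf are shuffled. Subtree size is tracked along
  with rank since later balls push earlier ones down: a ball of bounded rank in a subtree of size m
  may still have depth of order ln m. What is asked is an error o(sqrt (ln n)) for means and o(ln n)
  for variances, so it suffices to know second moments of \<open>mu\<close> D - ln k up to o(ln n).
  The drift of n / k contributes up to a multiple of (ln n) / H, which is why the accuracy is chosen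
  first, then H, and only then n.\<close>

definition stay_config :: "nat \<Rightarrow> nat list \<Rightarrow> nat list \<Rightarrow> config \<Rightarrow> config" where
  "stay_config s0 v xs cfg =
     (\<lambda>j. if j \<in> set xs then (if j \<in> set (take s0 xs) then Some v else None) else cfg j)"

definition fixed_balls :: "nat \<Rightarrow> nat \<Rightarrow> nat \<Rightarrow> nat list \<Rightarrow> (nat \<times> nat) list" where
  "fixed_balls b s0 s1 xs =
     concat (map (\<lambda>i. map (\<lambda>j. (j, i)) (take s1 (drop (s0 + i * s1) xs))) [0..<b])"

definition split_tasks :: "nat \<Rightarrow> nat \<Rightarrow> nat \<Rightarrow> nat list \<Rightarrow> nat list \<Rightarrow> (nat \<times> nat list \<times> bool) list" where
  "split_tasks b s0 s1 v xs =
     map (\<lambda>(j, i). (j, v @ [i], False)) (fixed_balls b s0 s1 xs)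
     @ map (\<lambda>j. (j, v, True)) (drop (s0 + b * s1) xs)"

lemma fixed_balls_map:
  "fixed_balls b s0 s1 (map \<rho> xs) = map (\<lambda>(j, i). (\<rho> j, i)) (fixed_balls b s0 s1 xs)"
  by (simp add: fixed_balls_def map_concat o_def take_map drop_map)

lemma split_tasks_map:
  "split_tasks b s0 s1 (p @ v) (map \<rho> xs) =
     map (\<lambda>(k, v, r). (\<rho> k, p @ v, r)) (split_tasks b s0 s1 v xs)"
  by (simp add: split_tasks_def fixed_balls_map o_def case_prod_beta drop_map)

text \<open>The functional whose least fixed point is \<open>handle\<close>, with the recursive
  calls abstracted as \<open>f\<close>. Fixpoint induction, monotonicity, continuity and the finite
  iterates below are all statements about this one functional.\<close>

definition handle_step :: "nat \<Rightarrow> nat \<Rightarrow> nat \<Rightarrow> nat \<Rightarrow> (nat list \<Rightarrow> nat \<Rightarrow> real) \<Rightarrow>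
    ((nat \<times> nat list \<times> bool) list \<Rightarrow> config \<Rightarrow> config spmf) \<Rightarrow>
    (nat \<times> nat list \<times> bool) list \<Rightarrow> config \<Rightarrow> config spmf" where
  "handle_step b s s0 s1 \<omega> f ts cfg =
    (case ts of
       [] \<Rightarrow> return_spmf cfg
     | (k, v, r) # ts' \<Rightarrow>
         (if r then
            bind_spmf (spmf_of_pmf (child_pmf b (\<omega> v))) (\<lambda>i. f ((k, v @ [i], False) # ts') cfg)
          else if n_v cfg v = 0 \<or> (is_leaf cfg v \<and> C_v cfg v < s) then f ts' (cfg(k \<mapsto> v))
          else if \<not> is_leaf cfg v then f ((k, v, True) # ts') cfg
          else
            bind_spmf (spmf_of_set {xs. distinct xs \<and> set xs = insert k (balls_at cfg v)})
              (\<lambda>xs. f (split_tasks b s0 s1 v xs @ ts') (stay_config s0 v xs cfg))))"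

lemma split_tasks_alt:
  "concat (map (\<lambda>i. map (\<lambda>j. (j, v @ [i], False)) (take s1 (drop (s0 + i * s1) xs))) [0..<b])
    @ map (\<lambda>j. (j, v, True)) (drop (s0 + b * s1) xs) @ ts = split_tasks b s0 s1 v xs @ ts"
  by (simp add: split_tasks_def fixed_balls_def map_concat o_def)

lemma handle_handle_step: "handle b s s0 s1 \<omega> ts cfg = handle_step b s s0 s1 \<omega> (handle b s s0 s1 \<omega>) ts cfg"
  by (subst handle.simps)
     (auto simp: handle_step_def Let_def split_tasks_alt stay_config_def[symmetric] split: list.split)

text \<open>All arguments of \<open>handle\<close> form one tuple in the generic rule, but
  \<open>b\<close>, \<open>s\<close>, \<open>s0\<close>, \<open>s1\<close> never change along the
  recursion; this form keeps them fixed and leaves the environment, the tasks and the configuration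
  variable.\<close>

lemma handle_induct:
  assumes "spmf.admissible (\<lambda>f. P (\<lambda>\<omega> ts cfg. f ((((((b, s), s0), s1), \<omega>), ts), cfg)))"
  assumes "P (\<lambda>\<omega> ts cfg. return_pmf None)"
  assumes "\<And>f. P f \<Longrightarrow> P (\<lambda>\<omega>. handle_step b s s0 s1 \<omega> (f \<omega>))"
  shows "P (handle b s s0 s1)"
proof (rule handle.fixp_induct[where P="\<lambda>F. P (F b s s0 s1)"], goal_cases)
  case 1
  show ?case using assms(1) by (simp add: curry_def)
next
  case 2
  show ?case by (rule assms)
next
  case (3 f)
  from assms(3)[OF this] show ?case
    apply (rule back_subst[where P=P])
    apply (intro ext)
    apply (simp add: handle_step_def Let_def split_tasks_alt stay_config_def[symmetric] split: list.split)
    done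
qed

section \<open>Sequential composition of task lists\<close>

lemma handle_Nil [simp]: "handle b s s0 s1 \<omega> [] cfg = return_spmf cfg"
  by (subst handle_handle_step) (simp add: handle_step_def)

lemma handle_step_mono:
  assumes "\<And>ts cfg. ord_spmf (=) (f ts cfg) (g ts cfg)"
  shows "ord_spmf (=) (handle_step b s s0 s1 \<omega> f ts cfg) (handle_step b s s0 s1 \<omega> g ts cfg)"
  using assms
  by (auto simp: handle_step_def simp del: bind_spmf_of_pmf split: list.split intro!: bind_spmf_mono')

text \<open>The task list is a stack: the tail is untouched until all work caused by the head is
  done. Equality cannot be the induction invariant, because an approximation of bounded recursion
  depth spends its budget differently on the two sides; hence two inequalities, each comparing an
  approximation on one side with the full \<open>handle\<close> on the other.\<close>

lemma handle_append_le:
  "ord_spmf (=) (handle b s s0 s1 \<omega> (ts @ ts') cfg)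
     (bind_spmf (handle b s s0 s1 \<omega> ts cfg) (handle b s s0 s1 \<omega> ts'))"
proof -
  have "\<forall>\<omega> ts ts' cfg. ord_spmf (=) (handle b s s0 s1 \<omega> (ts @ ts') cfg)
     (bind_spmf (handle b s s0 s1 \<omega> ts cfg) (handle b s s0 s1 \<omega> ts'))"

  proof (rule handle_induct[where P="\<lambda>f. \<forall>\<omega> ts ts' cfg. ord_spmf (=) (f \<omega> (ts @ ts') cfg)
     (bind_spmf (handle b s s0 s1 \<omega> ts cfg) (handle b s s0 s1 \<omega> ts'))"], goal_cases)
    case 1
    show ?case by simp
  next
    case 2
    show ?case by simp
  next
    case (3 f)
    show ?case
    proof (intro allI, goal_cases)
      case (1 \<omega> ts ts' cfg)
      show ?case
      proof (cases ts)
        case Nil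
        \<comment> \<open>The induction hypothesis with an empty second list says that
          \<open>f\<close> lies below \<open>handle\<close>.\<close>
        have "ord_spmf (=) (f \<omega> ts cfg) (handle b s s0 s1 \<omega> ts cfg)" for ts cfg
        proof -
          have "handle b s s0 s1 \<omega> [] = return_spmf" by (rule ext) simp
          thus ?thesis using 3[rule_format, of \<omega> ts "[]" cfg] by simp
        qed
        hence "ord_spmf (=) (handle_step b s s0 s1 \<omega> (f \<omega>) ts' cfg)
                 (handle_step b s s0 s1 \<omega> (handle b s s0 s1 \<omega>) ts' cfg)"
          by (rule handle_step_mono)
        thus ?thesis by (simp add: Nil handle_handle_step[symmetric])
      next
        case (Cons t ts1)
        obtain k v r where t: "t = (k, v, r)" by (cases t)
        note IH = 3[rule_format]
        have 11: "ord_spmf (=) (f \<omega> (t' # ts1 @ ts') cfg)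
           (bind_spmf (handle b s s0 s1 \<omega> (t' # ts1) cfg) (handle b s s0 s1 \<omega> ts'))" for t'
          using IH[of \<omega> "t' # ts1" ts' cfg] by simp
        have 12: "ord_spmf (=) (f \<omega> (zs @ ts1 @ ts') cfg')
           (bind_spmf (handle b s s0 s1 \<omega> (zs @ ts1) cfg') (handle b s s0 s1 \<omega> ts'))" for zs cfg'
          using IH[of \<omega> "zs @ ts1" ts' cfg'] by simp
        show ?thesis unfolding Cons t append_Cons
          apply (subst (1) handle_handle_step)
          unfolding handle_step_def list.case prod.case
          by (auto simp: bind_spmf_assoc 11 12 IH simp del: bind_spmf_of_pmf intro!: bind_spmf_mono')
      qed
    qed
  qed
  thus ?thesis by blast
qed

lemma handle_append_ge:
  "ord_spmf (=) (bind_spmf (handle b s s0 s1 \<omega> ts cfg) (handle b s s0 s1 \<omega> ts'))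
     (handle b s s0 s1 \<omega> (ts @ ts') cfg)"
proof -
  have "\<forall>\<omega> ts ts' cfg. ord_spmf (=) (bind_spmf (handle b s s0 s1 \<omega> ts cfg) (handle b s s0 s1 \<omega> ts'))
     (handle b s s0 s1 \<omega> (ts @ ts') cfg)"
  proof (rule handle_induct[where P="\<lambda>f. \<forall>\<omega> ts ts' cfg.
      ord_spmf (=) (bind_spmf (f \<omega> ts cfg) (handle b s s0 s1 \<omega> ts'))
     (handle b s s0 s1 \<omega> (ts @ ts') cfg)"], goal_cases)
    case 1
    show ?case by simp
  next
    case 2
    show ?case by simp
  next
    case (3 f)
    show ?case
    proof (intro allI, goal_cases)
      case (1 \<omega> ts ts' cfg)
      show ?case
      proof (cases ts)
        case Nil
        thus ?thesis by (simp add: handle_step_def)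
      next
        case (Cons t ts1)
        obtain k v r where t: "t = (k, v, r)" by (cases t)
        note IH = 3[rule_format]
        have 11: "ord_spmf (=) (bind_spmf (f \<omega> (t' # ts1) cfg) (handle b s s0 s1 \<omega> ts'))
           (handle b s s0 s1 \<omega> (t' # ts1 @ ts') cfg)" for t'
          using IH[of \<omega> "t' # ts1" cfg ts'] by simp
        have 12: "ord_spmf (=) (bind_spmf (f \<omega> (zs @ ts1) cfg') (handle b s s0 s1 \<omega> ts'))
           (handle b s s0 s1 \<omega> (zs @ ts1 @ ts') cfg')" for zs cfg'
          using IH[of \<omega> "zs @ ts1" cfg' ts'] by simp
        show ?thesis unfolding Cons t append_Cons
          apply (subst (1) handle_handle_step)
          unfolding handle_step_def list.case prod.case
          by (auto simp: bind_spmf_assoc 11 12 IH simp del: bind_spmf_of_pmf intro!: bind_spmf_mono')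
      qed
    qed
  qed
  thus ?thesis by blast
qed

lemma handle_append:
  "handle b s s0 s1 \<omega> (ts @ ts') cfg
     = bind_spmf (handle b s s0 s1 \<omega> ts cfg) (handle b s s0 s1 \<omega> ts')"
  using handle_append_le handle_append_ge by (rule spmf.leq_antisym)

lemma handle_Cons:
  "handle b s s0 s1 \<omega> (t # ts) cfg
     = bind_spmf (handle b s s0 s1 \<omega> [t] cfg) (handle b s s0 s1 \<omega> ts)"
  using handle_append[of b s s0 s1 \<omega> "[t]" ts cfg] by simp

lemma handle_route:
  "handle b s s0 s1 \<omega> [(k, v, True)] cfg
     = bind_spmf (spmf_of_pmf (child_pmf b (\<omega> v))) (\<lambda>i. handle b s s0 s1 \<omega> [(k, v @ [i], False)] cfg)"
  by (subst handle_handle_step) (simp add: handle_step_def)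

lemma insert_balls_eq_handle:
  "insert_balls b s s0 s1 \<omega> n = handle b s s0 s1 \<omega> (map (\<lambda>j. (j, [], False)) [0..<n]) Map.empty"
  by (induction n) (auto simp: handle_append)

text \<open>Places a configuration \<open>c\<close> of a whole tree below the vertex
  \<open>p\<close> and renames ball \<open>k\<close> to \<open>\<rho> k\<close>; every other ball is
  where \<open>outer\<close> has it. With \<open>p = []\<close> this is a pure renaming, with
  \<open>\<rho> = id\<close> a pure shift, and both special cases are used.\<close>

definition put :: "nat list \<Rightarrow> (nat \<Rightarrow> nat) \<Rightarrow> config \<Rightarrow> config \<Rightarrow> config" where
  "put p \<rho> outer c = (\<lambda>j. if j \<in> \<rho> ` dom c then map_option ((@) p) (c (inv \<rho> j)) else outer j)"

lemma put_apply:
  "inj \<rho> \<Longrightarrow> put p \<rho> outer c (\<rho> k) = (case c k of Some u \<Rightarrow> Some (p @ u) | None \<Rightarrow> outer (\<rho> k))"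
  by (auto simp: put_def inj_image_mem_iff split: option.split)

lemma put_apply': "j \<notin> range \<rho> \<Longrightarrow> put p \<rho> outer c j = outer j"
  by (auto simp: put_def)

lemma put_eqI:
  assumes "inj \<rho>" "\<And>k. f (\<rho> k) = (case c k of Some u \<Rightarrow> Some (p @ u) | None \<Rightarrow> outer (\<rho> k))"
    "\<And>j. j \<notin> range \<rho> \<Longrightarrow> f j = outer j"
  shows "f = put p \<rho> outer c"
proof
  fix j
  show "f j = put p \<rho> outer c j"
    using assms by (cases "j \<in> range \<rho>") (auto simp: put_apply put_apply')
qed

lemma put_update: "inj \<rho> \<Longrightarrow> (put p \<rho> outer c)(\<rho> k \<mapsto> p @ v) = put p \<rho> outer (c(k \<mapsto> v))"
  by (rule put_eqI) (auto simp: put_apply put_apply' inj_eq)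

lemma balls_in_put:
  assumes "inj \<rho>" and outer: "\<And>j u. outer j = Some u \<Longrightarrow> \<not> prefix p u"
  shows "balls_in (put p \<rho> outer c) (p @ v) = \<rho> ` balls_in c v"
proof -
  have o: "\<not> prefix (p @ v) u" if "outer j = Some u" for j u
    using outer[OF that] by (auto simp: prefix_def)
  show ?thesis
  proof (rule set_eqI)
    fix j
    show "j \<in> balls_in (put p \<rho> outer c) (p @ v) \<longleftrightarrow> j \<in> \<rho> ` balls_in c v"
    proof (cases "j \<in> range \<rho>")
      case True
      then obtain k where "j = \<rho> k" by blast
      thus ?thesis using o[of "\<rho> k"]
        by (auto simp: balls_in_def put_apply[OF assms(1)] inj_image_mem_iff[OF assms(1)] split: option.split)
    next
      case False
      thus ?thesis using o[of j] by (auto simp: balls_in_def put_apply')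
    qed
  qed
qed

lemma balls_at_put:
  assumes "inj \<rho>" and outer: "\<And>j u. outer j = Some u \<Longrightarrow> \<not> prefix p u"
  shows "balls_at (put p \<rho> outer c) (p @ v) = \<rho> ` balls_at c v"
proof -
  have o: "\<not> prefix (p @ v) u" if "outer j = Some u" for j u
    using outer[OF that] by (auto simp: prefix_def)
  show ?thesis
  proof (rule set_eqI)
    fix j
    show "j \<in> balls_at (put p \<rho> outer c) (p @ v) \<longleftrightarrow> j \<in> \<rho> ` balls_at c v"
    proof (cases "j \<in> range \<rho>")
      case True
      then obtain k where "j = \<rho> k" by blast
      thus ?thesis using o[of "\<rho> k"]
        by (auto simp: balls_at_def put_apply[OF assms(1)] inj_image_mem_iff[OF assms(1)] split: option.split)
    next
      case False
      thus ?thesis using o[of j] by (auto simp: balls_at_def put_apply')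
    qed
  qed
qed

lemma put_stats:
  assumes "inj \<rho>" and outer: "\<And>j u. outer j = Some u \<Longrightarrow> \<not> prefix p u"
  shows "n_v (put p \<rho> outer c) (p @ v) = n_v c v" "C_v (put p \<rho> outer c) (p @ v) = C_v c v"
    "is_leaf (put p \<rho> outer c) (p @ v) = is_leaf c v"
  using assms by (simp_all add: n_v_def C_v_def is_leaf_def balls_at_put balls_in_put
      card_image inj_on_subset[OF assms(1)])

lemma dom_stay_config: "dom (stay_config s0 v xs c) \<subseteq> dom c \<union> set xs"
  by (auto simp: stay_config_def split: if_splits)

lemma stay_config_put:
  assumes "inj \<rho>" and "\<And>k. k \<in> set xs \<Longrightarrow> outer (\<rho> k) = None"
  shows "stay_config s0 (p @ v) (map \<rho> xs) (put p \<rho> outer c) = put p \<rho> outer (stay_config s0 v xs c)"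
  by (rule put_eqI)
     (use assms in \<open>auto simp: stay_config_def put_apply put_apply' inj_image_mem_iff take_map\<close>)

text \<open>Renaming acts bijectively on orderings, so the uniform ordering at a split is
  transported to the uniform ordering.\<close>

lemma perms_image:
  assumes "inj \<rho>"
  shows "{xs. distinct xs \<and> set xs = insert (\<rho> k) (\<rho> ` B)} =
     map \<rho> ` {xs. distinct xs \<and> set xs = insert k B}"
proof safe
  fix xs assume xs: "distinct xs" "set xs = insert (\<rho> k) (\<rho> ` B)"
  have "xs = map \<rho> (map (inv \<rho>) xs)"
    unfolding map_map o_def by (rule map_idI[symmetric]) (use xs(2) in \<open>auto simp: inv_f_f[OF assms]\<close>)
  moreover have "distinct (map (inv \<rho>) xs)"
    using xs by (metis calculation distinct_map)
  moreover have "set (map (inv \<rho>) xs) = insert k B"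
    using xs(2) assms by (simp add: image_image)
  ultimately show "xs \<in> map \<rho> ` {xs. distinct xs \<and> set xs = insert k B}" by blast
next
  fix xs assume xs: "distinct xs" "set xs = insert k B"
  show "distinct (map \<rho> xs)" using xs(1) inj_on_subset[OF assms subset_UNIV] by (simp add: distinct_map)
qed auto

lemma fst_split_tasks: "fst ` set (split_tasks b s0 s1 v xs) \<subseteq> set xs"
  by (auto simp: split_tasks_def fixed_balls_def dest!: in_set_takeD in_set_dropD)

text \<open>The rules at a vertex look only at the balls of its subtree and at its own split vector,
  and \<open>outer\<close> has nothing below \<open>p\<close>; so a run started below
  \<open>p\<close> never sees it. The set \<open>D\<close> contains all balls that the run may move;
  \<open>outer\<close> must not hold any of them, since a released ball has to be nowhere until it
  is placed again.\<close>

lemma handle_put: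
  assumes inj: "inj \<rho>" and outer: "\<And>j u. outer j = Some u \<Longrightarrow> \<not> prefix p u"
    and D: "\<And>k. k \<in> D \<Longrightarrow> outer (\<rho> k) = None"
    and "dom c \<subseteq> D" "fst ` set ts \<subseteq> D"
  shows "handle b s s0 s1 \<omega> (map (\<lambda>(k, v, r). (\<rho> k, p @ v, r)) ts) (put p \<rho> outer c)
    = map_spmf (put p \<rho> outer) (handle b s s0 s1 (\<lambda>u. \<omega> (p @ u)) ts c)"
proof -
  have "\<forall>ts c. dom c \<subseteq> D \<longrightarrow> fst ` set ts \<subseteq> D \<longrightarrow>
     handle b s s0 s1 \<omega> (map (\<lambda>(k, v, r). (\<rho> k, p @ v, r)) ts) (put p \<rho> outer c)
    = map_spmf (put p \<rho> outer) (handle b s s0 s1 (\<lambda>u. \<omega> (p @ u)) ts c)"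
    (is "?P (handle b s s0 s1)")
  proof (rule handle_induct[where P="?P"], goal_cases)
    case 1
    show ?case by simp
  next
    case 2
    show ?case by simp
  next
    case (3 f)
    show ?case
    proof (intro allI impI, goal_cases)
      case (1 ts c)
      show ?case
      proof (cases ts)
        case Nil
        thus ?thesis by (simp add: handle_step_def)
      next
        case (Cons t ts1)
        obtain k v r where t: "t = (k, v, r)" by (cases t)
        have IH: "f \<omega> (map (\<lambda>(k, v, r). (\<rho> k, p @ v, r)) ts') (put p \<rho> outer c') =
           map_spmf (put p \<rho> outer) (f (\<lambda>u. \<omega> (p @ u)) ts' c')"
          if "dom c' \<subseteq> D" "fst ` set ts' \<subseteq> D" for ts' c'
          using 3 that by blast
        have kD: "k \<in> D" "fst ` set ts1 \<subseteq> D" using 1 Cons t by auto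
        have 11: "f \<omega> ((\<rho> k, p @ v @ [i], False) # map (\<lambda>(k, v, r). (\<rho> k, p @ v, r)) ts1) (put p \<rho> outer c)
          = map_spmf (put p \<rho> outer) (f (\<lambda>u. \<omega> (p @ u)) ((k, v @ [i], False) # ts1) c)" for i
          using IH[of c "(k, v @ [i], False) # ts1"] 1 kD by simp
        have 12: "f \<omega> ((\<rho> k, p @ v, True) # map (\<lambda>(k, v, r). (\<rho> k, p @ v, r)) ts1) (put p \<rho> outer c)
          = map_spmf (put p \<rho> outer) (f (\<lambda>u. \<omega> (p @ u)) ((k, v, True) # ts1) c)"
          using IH[of c "(k, v, True) # ts1"] 1 kD by simp
        have 13: "f \<omega> (map (\<lambda>(k, v, r). (\<rho> k, p @ v, r)) ts1) ((put p \<rho> outer c)(\<rho> k \<mapsto> p @ v))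
          = map_spmf (put p \<rho> outer) (f (\<lambda>u. \<omega> (p @ u)) ts1 (c(k \<mapsto> v)))"
          using IH[of "c(k \<mapsto> v)" ts1] 1 kD by (simp add: put_update[OF inj])
        let ?S = "{xs. distinct xs \<and> set xs = insert k (balls_at c v)}"
        have 14: "bind_spmf (spmf_of_set {xs. distinct xs \<and> set xs = insert (\<rho> k) (\<rho> ` balls_at c v)})
             (\<lambda>xs. f \<omega> (split_tasks b s0 s1 (p @ v) xs @ map (\<lambda>(k, v, r). (\<rho> k, p @ v, r)) ts1)
                     (stay_config s0 (p @ v) xs (put p \<rho> outer c)))
           = map_spmf (put p \<rho> outer) (bind_spmf (spmf_of_set ?S)
             (\<lambda>xs. f (\<lambda>u. \<omega> (p @ u)) (split_tasks b s0 s1 v xs @ ts1) (stay_config s0 v xs c)))"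
        proof -
          have inj_map: "inj_on (map \<rho>) ?S" using inj by (meson inj_mapI inj_on_subset subset_UNIV)
          have S: "f \<omega> (split_tasks b s0 s1 (p @ v) (map \<rho> xs) @ map (\<lambda>(k, v, r). (\<rho> k, p @ v, r)) ts1)
                     (stay_config s0 (p @ v) (map \<rho> xs) (put p \<rho> outer c))
            = map_spmf (put p \<rho> outer) (f (\<lambda>u. \<omega> (p @ u)) (split_tasks b s0 s1 v xs @ ts1) (stay_config s0 v xs c))"
            if "set xs = insert k (balls_at c v)" for xs
          proof -
            have xsD: "set xs \<subseteq> D" using that kD 1(1) by (auto simp: balls_at_def)
            have "dom (stay_config s0 v xs c) \<subseteq> D" using dom_stay_config[of s0 v xs c] xsD 1(1) by blast
            moreover have "fst ` set (split_tasks b s0 s1 v xs @ ts1) \<subseteq> D"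
              using fst_split_tasks[of b s0 s1 v xs] xsD kD by auto
            ultimately show ?thesis
              using IH[of "stay_config s0 v xs c" "split_tasks b s0 s1 v xs @ ts1"] xsD
              by (subst stay_config_put[OF inj]) (auto simp: split_tasks_map intro!: D)
          qed
          show ?thesis
            unfolding perms_image[OF inj] map_spmf_of_set_inj_on[OF inj_map, symmetric]
              bind_map_spmf map_spmf_bind_spmf o_def
          proof (rule bind_spmf_cong[OF refl])
            fix xs assume "xs \<in> set_spmf (spmf_of_set ?S)"
            hence "set xs = insert k (balls_at c v)" by (auto simp: set_spmf_of_set split: if_splits)
            thus "f \<omega> (split_tasks b s0 s1 (p @ v) (map \<rho> xs) @ map (\<lambda>(k, v, r). (\<rho> k, p @ v, r)) ts1)
                     (stay_config s0 (p @ v) (map \<rho> xs) (put p \<rho> outer c))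
            = map_spmf (put p \<rho> outer) (f (\<lambda>u. \<omega> (p @ u)) (split_tasks b s0 s1 v xs @ ts1) (stay_config s0 v xs c))"
              by (rule S)
          qed
        qed
        show ?thesis unfolding Cons t
          by (simp only: handle_step_def list.map list.case prod.case put_stats[OF inj outer]
              balls_at_put[OF inj outer] append_assoc 11 12 13 14 map_spmf_bind_spmf o_def
              if_distrib[of "map_spmf (put p \<rho> outer)"])
      qed
    qed
  qed
  thus ?thesis using assms by blast
qed

section \<open>Conservation of balls\<close>

lemma map_fst_fixed_balls: "map fst (fixed_balls b s0 s1 xs) = take (b * s1) (drop s0 xs)"
proof (induction b)
  case (Suc b)
  have "take (Suc b * s1) (drop s0 xs) = take (b * s1) (drop s0 xs) @ take s1 (drop (s0 + b * s1) xs)"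
    by (metis add.commute drop_drop mult_Suc take_add)
  thus ?case using Suc by (simp add: fixed_balls_def o_def)
qed (simp add: fixed_balls_def)

lemma set_fixed_balls: "fst ` set (fixed_balls b s0 s1 xs) = set (take (b * s1) (drop s0 xs))"
  by (metis map_fst_fixed_balls set_map)

lemma set_split:
  "set (take s0 xs) \<union> fst ` set (split_tasks b s0 s1 v xs) = set xs"
proof -
  have "set (take s0 xs) \<union> (set (take (b * s1) (drop s0 xs)) \<union> set (drop (s0 + b * s1) xs)) = set xs"
    by (metis add.commute append_take_drop_id drop_drop set_append)
  moreover have "fst ` set (split_tasks b s0 s1 v xs) =
      set (take (b * s1) (drop s0 xs)) \<union> set (drop (s0 + b * s1) xs)"
    by (simp add: split_tasks_def image_Un set_fixed_balls[symmetric] image_image case_prod_beta)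
  ultimately show ?thesis by simp
qed

lemma dom_stay: 
  assumes "set xs = insert k (balls_at c v)"
  shows "dom (stay_config s0 v xs c) \<union> fst ` set (split_tasks b s0 s1 v xs) = insert k (dom c)"
proof -
  have "dom (stay_config s0 v xs c) = (dom c - set xs) \<union> set (take s0 xs)"
    by (auto simp: stay_config_def split: if_splits dest: in_set_takeD)
  moreover have "set xs \<subseteq> insert k (dom c)" "k \<in> set xs" using assms by (auto simp: balls_at_def)
  ultimately show ?thesis using set_split[of s0 xs b s1 v] by blast
qed

text \<open>Placing a ball moves it from the task list to the configuration; a split moves the
  released balls back to the task list. The union of both is invariant, so a terminating run has
  placed everything.\<close>

lemma dom_handle:
  assumes "c' \<in> set_spmf (handle b s s0 s1 \<omega> ts c)"
  shows "dom c' = dom c \<union> fst ` set ts"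
proof -
  have "\<forall>\<omega> ts c. \<forall>c'\<in>set_spmf (handle b s s0 s1 \<omega> ts c). dom c' = dom c \<union> fst ` set ts"
    (is "?P (handle b s s0 s1)")
  proof (rule handle_induct[where P="?P"], goal_cases)
    case 1
    show ?case by simp
  next
    case 2
    show ?case by simp
  next
    case (3 f)
    show ?case
    proof (intro allI ballI, goal_cases)
      case (1 \<omega> ts c c')
      show ?case
      proof (cases ts)
        case Nil
        thus ?thesis using 1 by (simp add: handle_step_def)
      next
        case (Cons t ts1)
        obtain k v r where t: "t = (k, v, r)" by (cases t)
        have IH: "c' \<in> set_spmf (f \<omega> ts' c1) \<Longrightarrow> dom c' = dom c1 \<union> fst ` set ts'" for ts' c1
          using 3[rule_format, of c' \<omega> ts' c1] by simp
        have split: "dom c' = insert k (dom c \<union> fst ` set ts1)"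
          if "set xs = insert k (balls_at c v)"
             "c' \<in> set_spmf (f \<omega> (split_tasks b s0 s1 v xs @ ts1) (stay_config s0 v xs c))" for xs
          using IH[OF that(2)] dom_stay[OF that(1), of s0 b s1] by (simp add: image_Un Un_assoc[symmetric])
        from 1 have "(\<exists>i. c' \<in> set_spmf (f \<omega> ((k, v @ [i], False) # ts1) c)) \<or>
            c' \<in> set_spmf (f \<omega> ts1 (c(k \<mapsto> v))) \<or> c' \<in> set_spmf (f \<omega> ((k, v, True) # ts1) c) \<or>
            (\<exists>xs. set xs = insert k (balls_at c v) \<and>
              c' \<in> set_spmf (f \<omega> (split_tasks b s0 s1 v xs @ ts1) (stay_config s0 v xs c)))"
          unfolding Cons t handle_step_def list.case prod.case
          by (auto simp add: set_bind_spmf set_spmf_of_set o_def simp del: bind_spmf_of_pmf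
              split: if_splits)
        hence "dom c' = insert k (dom c \<union> fst ` set ts1)"
        proof (elim disjE exE conjE)
          fix xs assume "set xs = insert k (balls_at c v)"
             "c' \<in> set_spmf (f \<omega> (split_tasks b s0 s1 v xs @ ts1) (stay_config s0 v xs c))"
          thus ?thesis by (rule split)
        qed (drule IH, simp)+
        thus ?thesis by (simp add: Cons t)
      qed
    qed
  qed
  from this[rule_format, OF assms] show ?thesis .
qed

text \<open>Finite iterates of the recursion: \<open>handle\<close> is their supremum, which makes it measurable in \<open>\<omega>\<close>.\<close>

primrec handle_fuel :: "nat \<Rightarrow> nat \<Rightarrow> nat \<Rightarrow> nat \<Rightarrow> (nat list \<Rightarrow> nat \<Rightarrow> real) \<Rightarrow> nat \<Rightarrow>
    (nat \<times> nat list \<times> bool) list \<Rightarrow> config \<Rightarrow> config spmf" where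
  "handle_fuel b s s0 s1 \<omega> 0 = (\<lambda>ts cfg. return_pmf None)"
| "handle_fuel b s s0 s1 \<omega> (Suc n) = handle_step b s s0 s1 \<omega> (handle_fuel b s s0 s1 \<omega> n)"

lemma handle_fuel_mono: "m \<le> n \<Longrightarrow> ord_spmf (=) (handle_fuel b s s0 s1 \<omega> m ts cfg) (handle_fuel b s s0 s1 \<omega> n ts cfg)"
proof (induction m arbitrary: n ts cfg)
  case (Suc m)
  then obtain n' where n: "n = Suc n'" "m \<le> n'" by (cases n) auto
  show ?case unfolding n(1) handle_fuel.simps by (rule handle_step_mono) (rule Suc.IH[OF n(2)])
qed simp

lemma handle_fuel_chain: "Complete_Partial_Order.chain (ord_spmf (=)) (range (\<lambda>n. handle_fuel b s s0 s1 \<omega> n ts cfg))"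
proof (rule chainI)
  fix x y assume "x \<in> range (\<lambda>n. handle_fuel b s s0 s1 \<omega> n ts cfg)" "y \<in> range (\<lambda>n. handle_fuel b s s0 s1 \<omega> n ts cfg)"
  then obtain m n where "x = handle_fuel b s s0 s1 \<omega> m ts cfg" "y = handle_fuel b s s0 s1 \<omega> n ts cfg" by auto
  thus "ord_spmf (=) x y \<or> ord_spmf (=) y x"
    using handle_fuel_mono[of m n] handle_fuel_mono[of n m] by (cases "m \<le> n") auto
qed

text \<open>Continuity of the functional: every branch is a single recursive call or a bind of
  recursive calls, and bind commutes with suprema of chains.\<close>

lemma handle_step_lub:
  assumes "\<And>ts cfg. monotone (\<le>) (ord_spmf (=)) (\<lambda>n::nat. F n ts cfg)"
  shows "handle_step b s s0 s1 \<omega> (\<lambda>ts cfg. lub_spmf (range (\<lambda>n::nat. F n ts cfg))) ts cfg =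
    lub_spmf (range (\<lambda>n. handle_step b s s0 s1 \<omega> (F n) ts cfg))"
proof -
  have chain: "Complete_Partial_Order.chain (\<le>) (UNIV :: nat set)"
    by (auto simp: chain_def)
  have B': "bind_spmf x (\<lambda>y. lub_spmf (range (\<lambda>n. F n (h y) (h' y)))) =
      lub_spmf (range (\<lambda>n. bind_spmf x (\<lambda>y. F n (h y) (h' y))))" for x :: "nat list spmf" and h h'
    by (rule bind_lub_spmf2[OF chain assms])
  have B'': "bind_spmf x (\<lambda>y. lub_spmf (range (\<lambda>n. F n (h y) (h' y)))) =
      lub_spmf (range (\<lambda>n. bind_spmf x (\<lambda>y. F n (h y) (h' y))))" for x :: "nat spmf" and h h'
    by (rule bind_lub_spmf2[OF chain assms])
  show ?thesis
  proof (cases ts)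
    case (Cons t ts1)
    obtain k v r where t: "t = (k, v, r)" by (cases t)
    consider "r" | "\<not> r" "n_v cfg v = 0 \<or> is_leaf cfg v \<and> C_v cfg v < s" | "\<not> r" "\<not> is_leaf cfg v" "n_v cfg v \<noteq> 0"
      | "\<not> r" "is_leaf cfg v" "n_v cfg v \<noteq> 0" "\<not> C_v cfg v < s" by blast
    thus ?thesis
      by cases (simp_all only: Cons t handle_step_def list.case prod.case if_True if_False not_True_eq_False
          not_False_eq_True disj_not1 simp_thms B' B'' cong: if_cong)
  qed (simp add: handle_step_def)
qed

text \<open>Kleene iteration. By continuity the supremum of the finite iterates is itself a fixed
  point, so it bounds the least one; conversely each iterate lies below
  \<open>handle\<close>.\<close>

lemma handle_eq_lub: "handle b s s0 s1 \<omega> ts cfg = lub_spmf (range (\<lambda>n. handle_fuel b s s0 s1 \<omega> n ts cfg))"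
proof (rule spmf.leq_antisym)
  have mono: "monotone (\<le>) (ord_spmf (=)) (\<lambda>n. handle_fuel b s s0 s1 \<omega> n ts cfg)" for \<omega> ts cfg
    by (rule monotoneI) (rule handle_fuel_mono)
  have "\<forall>\<omega> ts cfg. ord_spmf (=) (handle b s s0 s1 \<omega> ts cfg) (lub_spmf (range (\<lambda>n. handle_fuel b s s0 s1 \<omega> n ts cfg)))"
    (is "?P (handle b s s0 s1)")
  proof (rule handle_induct[where P="?P"], goal_cases)
    case 1
    show ?case by simp
  next
    case 2
    show ?case by simp
  next
    case (3 f)
    show ?case
    proof (intro allI)
      fix \<omega> ts cfg
      have "ord_spmf (=) (handle_step b s s0 s1 \<omega> (f \<omega>) ts cfg)
        (handle_step b s s0 s1 \<omega> (\<lambda>ts cfg. lub_spmf (range (\<lambda>n. handle_fuel b s s0 s1 \<omega> n ts cfg))) ts cfg)"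
        by (rule handle_step_mono) (use 3 in blast)
      also have "handle_step b s s0 s1 \<omega> (\<lambda>ts cfg. lub_spmf (range (\<lambda>n. handle_fuel b s s0 s1 \<omega> n ts cfg))) ts cfg
        = lub_spmf (range (\<lambda>n. handle_fuel b s s0 s1 \<omega> (Suc n) ts cfg))"
        by (simp add: handle_step_lub[OF mono])
      finally show "ord_spmf (=) (handle_step b s s0 s1 \<omega> (f \<omega>) ts cfg) (lub_spmf (range (\<lambda>n. handle_fuel b s s0 s1 \<omega> n ts cfg)))"
      proof (rule spmf.leq_trans)
        have ch: "Complete_Partial_Order.chain (ord_spmf (=)) (range (\<lambda>n. handle_fuel b s s0 s1 \<omega> (Suc n) ts cfg))"
          by (rule chain_subset[OF handle_fuel_chain[of b s s0 s1 \<omega> ts cfg]]) blast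
        show "ord_spmf (=) (lub_spmf (range (\<lambda>n. handle_fuel b s s0 s1 \<omega> (Suc n) ts cfg)))
            (lub_spmf (range (\<lambda>n. handle_fuel b s s0 s1 \<omega> n ts cfg)))"
          by (rule lub_spmf_least[OF ch]) (auto intro!: lub_spmf_upper handle_fuel_chain simp del: handle_fuel.simps)
      qed
    qed
  qed
  thus "ord_spmf (=) (handle b s s0 s1 \<omega> ts cfg) (lub_spmf (range (\<lambda>n. handle_fuel b s s0 s1 \<omega> n ts cfg)))"
    by blast
next
  have le: "ord_spmf (=) (handle_fuel b s s0 s1 \<omega> n ts cfg) (handle b s s0 s1 \<omega> ts cfg)" for n ts cfg
  proof (induction n arbitrary: ts cfg)
    case (Suc n)
    show ?case by (subst handle_handle_step) (auto intro: handle_step_mono Suc)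
  qed simp
  show "ord_spmf (=) (lub_spmf (range (\<lambda>n. handle_fuel b s s0 s1 \<omega> n ts cfg))) (handle b s s0 s1 \<omega> ts cfg)"
    by (rule lub_spmf_least[OF handle_fuel_chain]) (auto intro: le)
qed

section \<open>Measurability in the environment\<close>

lemma pmf_child_pmf:
  assumes "\<forall>i<b. 0 \<le> w i" "(\<Sum>i<b. w i) = 1"
  shows "pmf (child_pmf b w) i = (if i < b then w i else 0)"
proof -
  have "(\<integral>\<^sup>+ i. ennreal (if i < b then w i else 0) \<partial>count_space UNIV) = (\<Sum>i<b. ennreal (w i))"
    by (subst nn_integral_count_space'[of "{..<b}"]) auto
  also have "\<dots> = 1" using assms by (subst sum_ennreal) auto
  finally show ?thesis
    using assms by (simp add: child_pmf_def pmf_embed_pmf)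
qed

lemma emeasure_bind_spmf:
  "emeasure (measure_spmf (bind_spmf p f)) A = (\<integral>\<^sup>+ x. emeasure (measure_spmf (f x)) A \<partial>measure_spmf p)"
  unfolding measure_spmf_bind o_def
  by (subst emeasure_bind[where N="count_space UNIV"])
     (auto simp: space_subprob_algebra space_measure_spmf)

lemma measurable_emeasure_handle_fuel:
  assumes \<omega>: "\<And>v i. (\<lambda>\<omega>. \<omega> v i) \<in> borel_measurable M"
  shows "(\<lambda>\<omega>. emeasure (measure_spmf (handle_fuel b s s0 s1 \<omega> n ts cfg)) A) \<in> borel_measurable M"
proof (induction n arbitrary: ts cfg)
  case (Suc n)
  have valid: "Measurable.pred M (\<lambda>\<omega>. (\<forall>i<b. 0 \<le> \<omega> v i) \<and> (\<Sum>i<b. \<omega> v i) = 1)" for v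
    using \<omega> by measurable
  \<comment> \<open>Off the simplex \<open>child_pmf\<close> is the point mass at 0, so each mass is
    a measurable case distinction on the whole space, without excluding a null set.\<close>
  have eq: "ennreal (pmf (child_pmf b (\<omega> v)) i) =
     (if (\<forall>i<b. 0 \<le> \<omega> v i) \<and> (\<Sum>i<b. \<omega> v i) = 1 then ennreal (if i < b then \<omega> v i else 0)
      else indicator {0} i)" for \<omega> :: "nat list \<Rightarrow> nat \<Rightarrow> real" and v i
    by (auto simp: pmf_child_pmf) (auto simp: child_pmf_def split: split_indicator)
  have pm: "(\<lambda>\<omega>. ennreal (pmf (child_pmf b (\<omega> v)) i)) \<in> borel_measurable M" for v i
    unfolding eq using valid[of v] \<omega> by (cases "i < b") auto
  have r: "(\<lambda>\<omega>. \<integral>\<^sup>+ i. emeasure (measure_spmf (handle_fuel b s s0 s1 \<omega> n (h i) cfg)) A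
       \<partial>measure_pmf (child_pmf b (\<omega> v))) \<in> borel_measurable M" for v h
    unfolding nn_integral_measure_pmf nn_integral_count_space_nat using pm Suc by measurable
  have sp: "(\<lambda>\<omega>. \<integral>\<^sup>+ xs. emeasure (measure_spmf (handle_fuel b s s0 s1 \<omega> n (h xs) (h' xs))) A
       \<partial>measure_spmf (spmf_of_set S)) \<in> borel_measurable M" for S :: "nat list set" and h h'
    unfolding nn_integral_spmf_of_set using Suc by measurable
  show ?case
  proof (cases ts)
    case (Cons t ts1)
    obtain k v r where t: "t = (k, v, r)" by (cases t)
    consider "r" | "\<not> r" "n_v cfg v = 0 \<or> is_leaf cfg v \<and> C_v cfg v < s" | "\<not> r" "\<not> is_leaf cfg v" "n_v cfg v \<noteq> 0"
      | "\<not> r" "is_leaf cfg v" "n_v cfg v \<noteq> 0" "\<not> C_v cfg v < s" by blast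
    thus ?thesis
      by cases (simp_all add: Cons t handle_step_def emeasure_bind_spmf Suc r sp del: bind_spmf_of_pmf)
  qed (simp add: handle_step_def)
qed simp

lemma measurable_emeasure_handle:
  assumes "\<And>v i. (\<lambda>\<omega>. \<omega> v i) \<in> borel_measurable M"
  shows "(\<lambda>\<omega>. emeasure (measure_spmf (handle b s s0 s1 \<omega> ts cfg)) A) \<in> borel_measurable M"
  unfolding handle_eq_lub emeasure_lub_spmf[OF handle_fuel_chain, simplified] image_image
  using measurable_emeasure_handle_fuel[OF assms, of b s s0 s1 _ ts cfg A] by measurable

lemma measurable_insert_balls:
  assumes "\<And>v i. (\<lambda>\<omega>. \<omega> v i) \<in> borel_measurable M"
  shows "(\<lambda>\<omega>. measure_spmf (insert_balls b s s0 s1 \<omega> n)) \<in> M \<rightarrow>\<^sub>M subprob_algebra (count_space UNIV)"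
  unfolding insert_balls_eq_handle
  by (rule measurable_subprob_algebra)
     (auto intro: measurable_emeasure_handle assms measure_spmf.subprob_space_axioms)

section \<open>Projection to the subtree of a child\<close>

abbreviation "root_tasks \<equiv> map (\<lambda>j. (j, [], False))"
abbreviation "child_tasks \<equiv> map (\<lambda>(j, i). (j, [i], False))"

definition child_config :: "nat \<Rightarrow> config \<Rightarrow> config" where
  "child_config i c = (\<lambda>j. case c j of Some (i' # u) \<Rightarrow> if i' = i then Some u else None | _ \<Rightarrow> None)"

definition child_balls :: "nat \<Rightarrow> (nat \<times> nat) list \<Rightarrow> nat list" where
  "child_balls i A = map fst (filter (\<lambda>(j, i'). i' = i) A)"

definition ball_depth :: "config \<Rightarrow> nat \<Rightarrow> nat" where
  "ball_depth c j = (case c j of Some u \<Rightarrow> length u | None \<Rightarrow> 0)"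

text \<open>Ball \<open>k\<close> of a fresh tree is entry \<open>k\<close> of \<open>js\<close>.
  Beyond the length the value is free; \<open>sum_list js\<close> bounds every entry, so the values
  chosen there are new and the map is injective on all naturals, as \<open>put\<close>
  requires.\<close>

definition relabel :: "nat list \<Rightarrow> nat \<Rightarrow> nat" where
  "relabel js k = (if k < length js then js ! k else Suc (sum_list js + k))"

lemma inj_relabel: "distinct js \<Longrightarrow> inj (relabel js)"
proof (rule injI)
  fix x y assume d: "distinct js" and e: "relabel js x = relabel js y"
  have "js ! k \<le> sum_list js" if "k < length js" for k
    using that by (simp add: elem_le_sum_list)
  hence "js ! k < Suc (sum_list js + l)" if "k < length js" for k l
    using that by (metis le_add1 le_imp_less_Suc le_trans)
  thus "x = y" using e d unfolding relabel_def
    by (auto split: if_splits simp: nth_eq_iff_index_eq) (metis less_irrefl)+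
qed

lemma child_config_Some: "child_config i c j = Some u \<longleftrightarrow> c j = Some (i # u)"
  by (auto simp: child_config_def split: option.split list.split)

lemma child_config_None: "child_config i c j = None \<longleftrightarrow> (\<forall>u. c j \<noteq> Some (i # u))"
  by (metis not_Some_eq child_config_Some option.distinct(1))

lemma ball_depth_child_config: "child_config i c j \<noteq> None \<Longrightarrow> ball_depth c j = Suc (ball_depth (child_config i c) j)"
proof -
  assume "child_config i c j \<noteq> None"
  then obtain u where "child_config i c j = Some u" by blast
  moreover from this have "c j = Some (i # u)" by (simp add: child_config_Some)
  ultimately show ?thesis by (simp add: ball_depth_def)
qed

lemma ball_depth_put_relabel:
  assumes "distinct js" "k < length js" "c k \<noteq> None"
  shows "ball_depth (put [] (relabel js) Map.empty c) (js ! k) = ball_depth c k"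
  using put_apply[OF inj_relabel[OF assms(1)], of "[]" Map.empty c k] assms
  by (auto simp: ball_depth_def relabel_def)

text \<open>The complement of the subtree of child \<open>i\<close>; it is the \<open>outer\<close>
  part when a task is run inside that subtree.\<close>

definition outside :: "nat \<Rightarrow> config \<Rightarrow> config" where
  "outside i c = (\<lambda>j. if child_config i c j = None then c j else None)"

lemma put_outside: "put [i] id (outside i c) (child_config i c) = c"
  by (rule put_eqI[symmetric]) (auto simp: outside_def child_config_Some child_config_None split: option.split)

lemma put_id: "put p id outer c j = (case c j of Some u \<Rightarrow> Some (p @ u) | None \<Rightarrow> outer j)"
  using put_apply[of id p outer c j] unfolding id_apply by simp

lemma child_config_put: "child_config i (put [i] id (outside i c) c') = c'"
proof
  fix j show "child_config i (put [i] id (outside i c) c') j = c' j"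
  proof (cases "c' j")
    case None
    hence "child_config i (put [i] id (outside i c) c') j = None"
      by (auto simp: child_config_None put_id outside_def)
    thus ?thesis using None by simp
  next
    case (Some u)
    thus ?thesis by (simp add: child_config_Some put_id)
  qed
qed

section \<open>Lost mass and integrals of subprobability mass functions\<close>

lemma pmf_bind_spmf_None':
  "ennreal (pmf (bind_spmf p f) None) = ennreal (pmf p None) + (\<integral>\<^sup>+ x. ennreal (pmf (f x) None) \<partial>measure_spmf p)"
proof -
  have "pmf (bind_spmf p f) None = pmf p None + (\<integral>x. pmf (f x) None \<partial>measure_spmf p)"
    by (rule pmf_bind_spmf_None)
  moreover have "integrable (measure_spmf p) (\<lambda>x. pmf (f x) None)"
    by (rule measure_spmf.integrable_const_bound[where B=1]) (auto simp: pmf_le_1)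
  ultimately show ?thesis
    by (subst nn_integral_eq_integral) (auto simp flip: ennreal_plus)
qed

lemma pmf_map_spmf_None: "pmf (map_spmf f p) None = pmf p None"
  by (simp add: pmf_None_eq_weight_spmf)

lemma ord_spmf_nn_integral_mono:
  assumes "ord_spmf (=) p q"
  shows "(\<integral>\<^sup>+ x. f x \<partial>measure_spmf p) \<le> (\<integral>\<^sup>+ x. f x \<partial>measure_spmf q)"
  unfolding nn_integral_measure_spmf using ord_spmf_eq_leD[OF assms]
  by (intro nn_integral_mono mult_right_mono ennreal_leI) auto

lemma nn_integral_bind_spmf:
  "(\<integral>\<^sup>+ x. g x \<partial>measure_spmf (bind_spmf p f)) = (\<integral>\<^sup>+ y. \<integral>\<^sup>+ x. g x \<partial>measure_spmf (f y) \<partial>measure_spmf p)"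
  unfolding measure_spmf_bind o_def
  by (subst nn_integral_bind[where B="count_space UNIV"])
     (auto simp: space_subprob_algebra measure_spmf.subprob_space_axioms)

locale split_params =
  fixes b s s0 s1 :: nat
  assumes b_ge: "b \<ge> 2" and s_pos: "s \<ge> 1" and s0_le: "s0 \<le> s" and s1_le: "b * s1 \<le> s + 1 - s0"
begin

abbreviation H where "H \<equiv> handle b s s0 s1"
abbreviation T where "T \<equiv> insert_balls b s s0 s1"
abbreviation sub :: "(nat list \<Rightarrow> nat \<Rightarrow> real) \<Rightarrow> nat \<Rightarrow> nat list \<Rightarrow> nat \<Rightarrow> real" where
  "sub \<omega> i \<equiv> \<lambda>u. \<omega> (i # u)"

lemma dom_T: "c \<in> set_spmf (T \<omega> n) \<Longrightarrow> dom c = {..<n}"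
  unfolding insert_balls_eq_handle by (drule dom_handle) (auto simp: image_image)

lemma H_root_tasks:
  assumes "distinct js"
  shows "H \<omega> (root_tasks js) Map.empty
     = map_spmf (put [] (relabel js) Map.empty) (T \<omega> (length js))"
proof -
  have A: "root_tasks js = map (\<lambda>(k, v, r). (relabel js k, [] @ v, r)) (root_tasks [0..<length js])"
    by (rule nth_equalityI) (auto simp: relabel_def)
  have B: "Map.empty = put [] (relabel js) Map.empty Map.empty"
    by (rule put_eqI) (auto simp: inj_relabel assms)
  have "H \<omega> (root_tasks js) Map.empty =
     H \<omega> (map (\<lambda>(k, v, r). (relabel js k, [] @ v, r)) (root_tasks [0..<length js])) (put [] (relabel js) Map.empty Map.empty)"
    by (rule arg_cong2[where f="H \<omega>", OF A B])
  also have "\<dots> = map_spmf (put [] (relabel js) Map.empty) (H (\<lambda>u. \<omega> ([] @ u)) (root_tasks [0..<length js]) Map.empty)"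
    by (rule handle_put[where D=UNIV]) (auto simp: inj_relabel assms)
  finally show ?thesis by (simp add: insert_balls_eq_handle)
qed

lemma H_child:
  assumes "c j = None"
  shows "H \<omega> [(j, [i], False)] c =
    map_spmf (put [i] id (outside i c)) (H (sub \<omega> i) [(j, [], False)] (child_config i c))"
proof -
  have "H \<omega> (map (\<lambda>(k, v, r). (id k, [i] @ v, r)) [(j, [], False)]) (put [i] id (outside i c) (child_config i c)) =
    map_spmf (put [i] id (outside i c)) (H (\<lambda>u. \<omega> ([i] @ u)) [(j, [], False)] (child_config i c))"
    by (rule handle_put[where D="insert j (dom (child_config i c))"])
       (use assms in \<open>auto simp: outside_def child_config_None prefix_def split: if_splits dest: child_config_Some[THEN iffD1]\<close>)
  thus ?thesis by (simp add: put_outside)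
qed

lemma child_config_other:
  assumes "c j = None" "i \<noteq> i'" "dom c' = insert j (dom (child_config i c))"
  shows "child_config i' (put [i] id (outside i c) c') = child_config i' c"
proof
  fix k
  show "child_config i' (put [i] id (outside i c) c') k = child_config i' c k"
  proof (cases "c' k")
    case None
    hence "child_config i c k = None" using assms(3) by (metis domIff insertCI)
    thus ?thesis using None by (simp add: child_config_def put_id outside_def)
  next
    case (Some u)
    hence "child_config i' (put [i] id (outside i c) c') k = None"
      using assms(2) by (auto simp: child_config_None put_id)
    moreover have "k = j \<or> child_config i c k \<noteq> None" using Some assms(3) by (metis domI domIff insertE)
    hence "child_config i' c k = None" using assms(1,2) by (auto simp: child_config_None child_config_Some)
    ultimately show ?thesis by simp
  qed
qed

lemma root_put:
  assumes "c j = None" "dom c' = insert j (dom (child_config i c))"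
  shows "put [i] id (outside i c) c' k = Some [] \<longleftrightarrow> c k = Some []"
proof (cases "c' k")
  case None
  hence "child_config i c k = None" using assms(2) by (metis domIff insertCI)
  thus ?thesis using None by (simp add: put_id outside_def)
next
  case (Some u)
  moreover have "k = j \<or> child_config i c k \<noteq> None" using Some assms(2) by (metis domI domIff insertE)
  ultimately show ?thesis using assms(1) by (auto simp: put_id child_config_Some)
qed

text \<open>Tasks addressed to children can neither bring a ball back to the root nor dislodge the
  balls kept there. This fixes the depth of the retained balls and later shows that the root is no
  leaf any more.\<close>

lemma root_H_child_tasks:
  assumes "c' \<in> set_spmf (H \<omega> (child_tasks A) c)" "distinct (map fst A)" "dom c \<inter> fst ` set A = {}"
  shows "c' k = Some [] \<longleftrightarrow> c k = Some []"
  using assms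
proof (induction A arbitrary: c' rule: rev_induct)
  case (snoc a A)
  obtain j i where a: "a = (j, i)" by (cases a)
  from snoc.prems obtain c1 where c1: "c1 \<in> set_spmf (H \<omega> (child_tasks A) c)"
    "c' \<in> set_spmf (H \<omega> [(j, [i], False)] c1)"
    by (auto simp: handle_append set_bind_spmf a)
  have "dom c1 = dom c \<union> fst ` set A"
    using dom_handle[OF c1(1)] by (auto simp: image_image case_prod_beta)
  hence "c1 j = None" using snoc.prems a by (auto simp: domIff)
  moreover from this c1(2) obtain c2 where "c2 \<in> set_spmf (H (sub \<omega> i) [(j, [], False)] (child_config i c1))"
    "c' = put [i] id (outside i c1) c2" by (auto simp: H_child)
  moreover from dom_handle[OF this(1)] have "dom c2 = insert j (dom (child_config i c1))" by auto
  ultimately show ?case using snoc.IH[OF c1(1)] snoc.prems by (simp add: root_put)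
qed simp

lemma H_child_tasks_snoc:
  assumes "distinct (map fst (A @ [(j, i)]))" "dom c \<inter> fst ` set (A @ [(j, i)]) = {}"
  shows "H \<omega> (child_tasks (A @ [(j, i)])) c = bind_spmf (H \<omega> (child_tasks A) c) (\<lambda>c1.
     map_spmf (put [i] id (outside i c1)) (H (sub \<omega> i) [(j, [], False)] (child_config i c1)))"
  unfolding map_append handle_append
proof (rule bind_spmf_cong[OF refl], goal_cases)
  case (1 c1)
  have "dom c1 = dom c \<union> fst ` set A"
    using dom_handle[OF 1] by (auto simp: image_image case_prod_beta)
  hence "c1 j = None" using assms by (auto simp: domIff)
  thus ?case using H_child by simp
qed

text \<open>Seen from child \<open>i\<close>, tasks for other children leave no trace, except that a
  run diverging there destroys the whole outcome. So the left side may have less mass, and only an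
  inequality holds at this stage.\<close>

lemma project_child:
  assumes "distinct (map fst A)" "dom c \<inter> fst ` set A = {}" "child_config i c = Map.empty"
  shows "ord_spmf (=) (map_spmf (child_config i) (H \<omega> (child_tasks A) c))
           (H (sub \<omega> i) (root_tasks (child_balls i A)) Map.empty)"
  using assms
proof (induction A rule: rev_induct)
  case Nil
  thus ?case by (simp add: child_balls_def)
next
  case (snoc a A)
  obtain j i' where a: "a = (j, i')" by (cases a)
  let ?P = "H \<omega> (child_tasks A) c"
  have IH: "ord_spmf (=) (map_spmf (child_config i) ?P) (H (sub \<omega> i) (root_tasks (child_balls i A)) Map.empty)"
    by (rule snoc.IH) (use snoc.prems in \<open>auto simp: a\<close>)
  have eq: "H \<omega> (child_tasks (A @ [(j, i')])) c = bind_spmf ?P (\<lambda>c1.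
     map_spmf (put [i'] id (outside i' c1)) (H (sub \<omega> i') [(j, [], False)] (child_config i' c1)))"
    using snoc.prems a by (intro H_child_tasks_snoc) auto
  show ?case
  proof (cases "i' = i")
    case True
    have 1: "map_spmf (child_config i) (H \<omega> (child_tasks (A @ [(j, i')])) c) =
       bind_spmf (map_spmf (child_config i) ?P) (H (sub \<omega> i) [(j, [], False)])"
      unfolding eq by (simp add: map_spmf_bind_spmf bind_map_spmf o_def True spmf.map_comp child_config_put)
    have 2: "bind_spmf (H (sub \<omega> i) (root_tasks (child_balls i A)) Map.empty) (H (sub \<omega> i) [(j, [], False)])
      = H (sub \<omega> i) (root_tasks (child_balls i (A @ [(j, i')]))) Map.empty"
      by (simp add: child_balls_def True handle_append)
    show ?thesis unfolding a 1 2[symmetric]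
      by (rule bind_spmf_mono'[OF IH spmf.leq_refl])
  next
    case False
    have dm: "c1 j = None" if "c1 \<in> set_spmf ?P" for c1
    proof -
      have "dom c1 = dom c \<union> fst ` set A"
        using dom_handle[OF that] by (auto simp: image_image case_prod_beta)
      thus ?thesis using snoc.prems a by (auto simp: domIff)
    qed
    have 1: "map_spmf (child_config i) (H \<omega> (child_tasks (A @ [(j, i')])) c) =
       bind_spmf ?P (\<lambda>c1. bind_spmf (H (sub \<omega> i') [(j, [], False)] (child_config i' c1)) (\<lambda>_. return_spmf (child_config i c1)))"
      (is "_ = ?R") unfolding eq map_spmf_bind_spmf
    proof (rule bind_spmf_cong[OF refl], goal_cases)
      case (1 c1)
      have "c2 \<in> set_spmf (H (sub \<omega> i') [(j, [], False)] (child_config i' c1)) \<Longrightarrow>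
          child_config i (put [i'] id (outside i' c1) c2) = child_config i c1" for c2
        using dom_handle[of c2] by (intro child_config_other[where j=j]) (auto simp: dm[OF 1] False)
      thus ?case
        by (auto simp: spmf.map_comp o_def map_spmf_conv_bind_spmf intro!: bind_spmf_cong)
    qed
    have 2: "ord_spmf (=) ?R (bind_spmf ?P (\<lambda>c1. return_spmf (child_config i c1)))"
      by (rule bind_spmf_mono'[OF spmf.leq_refl]) (auto simp: bind_spmf_const ord_spmf_return_spmf2 set_scale_spmf split: if_splits)
    have 3: "bind_spmf ?P (\<lambda>c1. return_spmf (child_config i c1)) = map_spmf (child_config i) ?P"
      by (simp add: map_spmf_conv_bind_spmf)
    have 4: "child_balls i (A @ [(j, i')]) = child_balls i A"
      using False by (simp add: child_balls_def)
    show ?thesis unfolding a 1 4 by (rule spmf.leq_trans[OF 2[unfolded 3] IH])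
  qed
qed

text \<open>Union bound over the children: a joint run is lost only if the run in some child is. The
  induction charges the last task to its child, and \<open>project_child\<close> bounds that loss by
  the loss of the isolated run there.\<close>

lemma loss_child_tasks:
  assumes "distinct (map fst A)" "dom c \<inter> fst ` set A = {}" "\<And>i. child_config i c = Map.empty"
    and "snd ` set A \<subseteq> {..<b}"
  shows "ennreal (pmf (H \<omega> (child_tasks A) c) None) \<le>
     (\<Sum>i<b. ennreal (pmf (H (sub \<omega> i) (root_tasks (child_balls i A)) Map.empty) None))"
  using assms
proof (induction A rule: rev_induct)
  case (snoc a A)
  obtain j i where a: "a = (j, i)" by (cases a)
  have i: "i < b" using snoc.prems a by auto
  have rm: "(\<Sum>i<b. g i) = (\<Sum>i\<in>{..<b}-{i}. g i) + g i" for g :: "nat \<Rightarrow> ennreal"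
    using i by (subst sum.remove[of _ i]) (auto simp: add.commute)
  let ?P = "H \<omega> (child_tasks A) c"
  let ?S = "\<lambda>i A. H (sub \<omega> i) (root_tasks (child_balls i A)) Map.empty"
  have IH: "ennreal (pmf ?P None) \<le> (\<Sum>i<b. ennreal (pmf (?S i A) None))"
    by (rule snoc.IH) (use snoc.prems in \<open>auto simp: a\<close>)
  have eq: "H \<omega> (child_tasks (A @ [(j, i)])) c = bind_spmf ?P (\<lambda>c1.
     map_spmf (put [i] id (outside i c1)) (H (sub \<omega> i) [(j, [], False)] (child_config i c1)))"
    using snoc.prems a by (intro H_child_tasks_snoc) auto
  have "ennreal (pmf (H \<omega> (child_tasks (A @ [(j, i)])) c) None) =
     ennreal (pmf ?P None) + (\<integral>\<^sup>+ c1. pmf (H (sub \<omega> i) [(j, [], False)] c1) None \<partial>measure_spmf (map_spmf (child_config i) ?P))"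
    unfolding eq pmf_bind_spmf_None' by (simp add: pmf_map_spmf_None o_def)
  also have "\<dots> \<le> (\<Sum>i<b. ennreal (pmf (?S i A) None)) + (\<integral>\<^sup>+ c1. pmf (H (sub \<omega> i) [(j, [], False)] c1) None \<partial>measure_spmf (?S i A))"
    using snoc.prems by (intro add_mono IH ord_spmf_nn_integral_mono project_child) auto
  also have "\<dots> = (\<Sum>i'\<in>{..<b}-{i}. ennreal (pmf (?S i' A) None)) + ennreal (pmf (bind_spmf (?S i A) (H (sub \<omega> i) [(j, [], False)])) None)"
    unfolding pmf_bind_spmf_None' rm by (simp only: add.assoc)
  also have "bind_spmf (?S i A) (H (sub \<omega> i) [(j, [], False)]) = ?S i (A @ [(j, i)])"
    by (simp add: child_balls_def handle_append)
  also have "(\<Sum>i'\<in>{..<b}-{i}. ennreal (pmf (?S i' A) None)) = (\<Sum>i'\<in>{..<b}-{i}. ennreal (pmf (?S i' (A @ [(j, i)])) None))"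
    by (rule sum.cong) (auto simp: child_balls_def)
  also have "\<dots> + ennreal (pmf (?S i (A @ [(j, i)])) None) = (\<Sum>i'<b. ennreal (pmf (?S i' (A @ [(j, i)])) None))"
    by (rule rm[symmetric])
  finally show ?case by (simp only: a)
qed simp


text \<open>With no loss in any child the union bound gives total mass 1 on the left of
  \<open>project_child\<close>, and an inequality between subprobabilities of equal mass is an
  equality.\<close>

lemma
  assumes "distinct (map fst A)" "dom c \<inter> fst ` set A = {}" "\<And>i. child_config i c = Map.empty"
    and "snd ` set A \<subseteq> {..<b}" and ll: "\<And>i m. i < b \<Longrightarrow> lossless_spmf (T (sub \<omega> i) m)"
  shows lossless_child_tasks: "lossless_spmf (H \<omega> (child_tasks A) c)"
    and project_child_lossless: "map_spmf (child_config i) (H \<omega> (child_tasks A) c)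
           = H (sub \<omega> i) (root_tasks (child_balls i A)) Map.empty"
proof -
  have le: "ord_spmf (=) (map_spmf (child_config i) (H \<omega> (child_tasks A) c))
           (H (sub \<omega> i) (root_tasks (child_balls i A)) Map.empty)"
    using assms by (intro project_child) auto
  have d: "distinct (child_balls i A)" for i
    using assms(1) by (auto simp: child_balls_def distinct_map_filter)
  have "ennreal (pmf (H \<omega> (child_tasks A) c) None) \<le>
     (\<Sum>i<b. ennreal (pmf (H (sub \<omega> i) (root_tasks (child_balls i A)) Map.empty) None))"
    using assms by (intro loss_child_tasks) auto
  also have "\<dots> = 0"
    using ll by (auto simp: H_root_tasks[OF d] pmf_map_spmf_None lossless_iff_pmf_None)
  finally have 0: "pmf (H \<omega> (child_tasks A) c) None = 0" by (simp add: ennreal_eq_0_iff)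
  thus "lossless_spmf (H \<omega> (child_tasks A) c)" by (simp add: lossless_iff_pmf_None)
  have "pmf (map_spmf (child_config i) (H \<omega> (child_tasks A) c)) None = 0" using 0 by (simp add: pmf_map_spmf_None)
  hence "pmf (map_spmf (child_config i) (H \<omega> (child_tasks A) c)) None =
     pmf (H (sub \<omega> i) (root_tasks (child_balls i A)) Map.empty) None"
    using ord_spmf_eqD_pmf_None[OF chain_empty le] by (simp add: antisym)
  with le show "map_spmf (child_config i) (H \<omega> (child_tasks A) c)
           = H (sub \<omega> i) (root_tasks (child_balls i A)) Map.empty"
    by (rule ord_spmf_eq_pmf_None_eq[OF chain_empty])
qed

section \<open>The first split, at the root\<close>

definition root_config :: "nat list \<Rightarrow> config" where
  "root_config xs = (\<lambda>j. if j \<in> set (take s0 xs) then Some [] else None)"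

text \<open>The order of this list is the order in which balls are sent to children: first the
  \<open>s1\<close> balls given to each child, then the other balls of the split, then the later
  insertions. It therefore determines the rank of a ball inside its child; \<open>cs\<close> lists
  the drawn children.\<close>

definition arrivals :: "nat list \<Rightarrow> nat list \<Rightarrow> nat \<Rightarrow> (nat \<times> nat) list" where
  "arrivals xs cs n = fixed_balls b s0 s1 xs @ zip (drop (s0 + b * s1) xs @ [Suc s..<n]) cs"

text \<open>Balls are counted from 0, so the root splits on the arrival of ball \<open>s\<close>;
  these are the orderings of the \<open>s + 1\<close> balls then at hand.\<close>

definition perms :: "nat list set" where
  "perms = {xs. distinct xs \<and> set xs = insert s {..<s}}"

lemma perms_props:
  assumes "xs \<in> perms"
  shows "distinct xs" "set xs = {..s}" "length xs = Suc s"
proof -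
  have "insert s {..<s} = {..s}" by auto
  thus *: "distinct xs" "set xs = {..s}" using assms by (simp_all add: perms_def)
  have "card (set xs) = length xs" by (rule distinct_card) (rule *)
  thus "length xs = Suc s" unfolding *(2) by simp
qed

lemma finite_perms: "finite perms" and perms_nonempty: "perms \<noteq> {}"
proof -
  have "perms \<subseteq> {xs. set xs \<subseteq> {..s} \<and> length xs = Suc s}" using perms_props by auto
  thus "finite perms" by (rule finite_subset) (simp add: finite_lists_length_eq)
  have "[0..<Suc s] \<in> perms" unfolding perms_def mem_Collect_eq by (auto simp del: upt_Suc)
  thus "perms \<noteq> {}" by blast
qed

text \<open>The draws do not depend on the configuration, so they commute with the handling of
  earlier balls and can all be made in advance.\<close>

lemma H_route:
  "H \<omega> (map (\<lambda>j. (j, [], True)) js) c =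
     bind_pmf (replicate_pmf (length js) (child_pmf b (\<omega> []))) (\<lambda>cs. H \<omega> (child_tasks (zip js cs)) c)"
proof (induction js arbitrary: c)
  case Nil
  show ?case by (simp add: bind_return_pmf)
next
  case (Cons j js)
  have "H \<omega> (map (\<lambda>j. (j, [], True)) (j # js)) c =
    bind_pmf (child_pmf b (\<omega> [])) (\<lambda>i. bind_spmf (H \<omega> [(j, [i], False)] c) (H \<omega> (map (\<lambda>j. (j, [], True)) js)))"
    unfolding list.map
    by (subst handle_Cons) (simp only: handle_route bind_spmf_assoc bind_spmf_of_pmf[symmetric] append_Nil)
  also have "\<dots> = bind_pmf (child_pmf b (\<omega> [])) (\<lambda>i. bind_pmf (replicate_pmf (length js) (child_pmf b (\<omega> [])))
      (\<lambda>cs. bind_spmf (H \<omega> [(j, [i], False)] c) (H \<omega> (child_tasks (zip js cs)))))"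
    unfolding Cons.IH
    by (intro bind_pmf_cong refl)
       (simp add: bind_commute_spmf[of "spmf_of_pmf _", unfolded bind_spmf_of_pmf, symmetric])
  also have "\<dots> = bind_pmf (child_pmf b (\<omega> [])) (\<lambda>i. bind_pmf (replicate_pmf (length js) (child_pmf b (\<omega> [])))
      (\<lambda>cs. H \<omega> (child_tasks (zip (j # js) (i # cs))) c))"
    by (simp add: handle_Cons[of _ _ _ _ _ "(j, _, False)" "child_tasks _"])
  also have "\<dots> = bind_pmf (replicate_pmf (length (j # js)) (child_pmf b (\<omega> []))) (\<lambda>cs. H \<omega> (child_tasks (zip (j # js) cs)) c)"
    by (simp add: bind_assoc_pmf bind_return_pmf)
  finally show ?case .
qed

text \<open>The root has become an internal vertex. Finiteness is included because
  \<open>C_v\<close> and \<open>n_v\<close> are cardinalities, which would be 0 on infinite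
  sets.\<close>

definition split_at_root :: "config \<Rightarrow> bool" where
  "split_at_root c \<longleftrightarrow> finite (dom c) \<and> (\<exists>j u. c j = Some u \<and> u \<noteq> [])"

lemma H_at_split_root:
  assumes "split_at_root c"
  shows "H \<omega> ((j, [], False) # ts) c = H \<omega> ((j, [], True) # ts) c"
proof -
  have fin: "finite (dom c)" using assms by (simp add: split_at_root_def)
  have 1: "balls_in c [] = dom c" by (auto simp: balls_in_def)
  have "balls_at c [] \<subset> dom c" using assms by (auto simp: balls_at_def split_at_root_def) force
  hence "C_v c [] < n_v c []" unfolding C_v_def n_v_def 1 by (rule psubset_card_mono[OF fin])
  thus ?thesis by (subst handle_handle_step) (simp add: handle_step_def is_leaf_def)
qed

lemma split_at_root_child_tasks:
  assumes "c' \<in> set_spmf (H \<omega> (child_tasks A) c)" "distinct (map fst A)" "dom c \<inter> fst ` set A = {}"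
    and "split_at_root c"
  shows "split_at_root c'"
proof -
  have d: "dom c' = dom c \<union> fst ` set A" using dom_handle[OF assms(1)] by (auto simp: image_image case_prod_beta)
  obtain j u where ju: "c j = Some u" "u \<noteq> []" using assms(4) by (auto simp: split_at_root_def)
  moreover have "j \<in> dom c'" using d ju by blast
  ultimately obtain u' where "c' j = Some u'" "u' \<noteq> []"
    using root_H_child_tasks[OF assms(1-3), of j] by auto
  moreover have "finite (dom c')" using assms(4) by (simp add: d split_at_root_def)
  ultimately show ?thesis by (auto simp: split_at_root_def)
qed

lemma H_root_tasks_route:
  assumes "split_at_root c" "distinct js" "dom c \<inter> set js = {}"
  shows "H \<omega> (root_tasks js) c = H \<omega> (map (\<lambda>j. (j, [], True)) js) c"
  using assms
proof (induction js arbitrary: c)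
  case (Cons j js)
  have "H \<omega> (root_tasks (j # js)) c = bind_spmf (H \<omega> [(j, [], True)] c) (H \<omega> (root_tasks js))"
    using Cons.prems by (simp add: H_at_split_root handle_Cons[of _ _ _ _ _ "(j, _, _)" "root_tasks js"])
  also have "\<dots> = bind_spmf (H \<omega> [(j, [], True)] c) (H \<omega> (map (\<lambda>j. (j, [], True)) js))"
  proof (rule bind_spmf_cong[OF refl])
    fix c' assume "c' \<in> set_spmf (H \<omega> [(j, [], True)] c)"
    then obtain i where c': "c' \<in> set_spmf (H \<omega> (child_tasks [(j, i)]) c)"
      by (auto simp: handle_route set_bind_spmf simp del: bind_spmf_of_pmf)
    have "split_at_root c'" using Cons.prems by (intro split_at_root_child_tasks[OF c']) auto
    moreover have "dom c' = insert j (dom c)" using dom_handle[OF c'] by auto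
    ultimately show "H \<omega> (root_tasks js) c' = H \<omega> (map (\<lambda>j. (j, [], True)) js) c'"
      using Cons.prems by (intro Cons.IH) auto
  qed
  also have "\<dots> = H \<omega> (map (\<lambda>j. (j, [], True)) (j # js)) c"
    by (simp add: handle_Cons[of _ _ _ _ _ "(j, _, _)" "map _ js"])
  finally show ?case .
qed simp

lemma T_small:
  assumes "m \<le> s"
  shows "T \<omega> m = return_spmf (\<lambda>j. if j < m then Some [] else None)"
  using assms
proof (induction m)
  case (Suc m)
  let ?c = "\<lambda>j. if j < m then Some [] else None :: nat list option"
  have 1: "balls_in ?c [] = {..<m}" "balls_at ?c [] = {..<m}" by (auto simp: balls_in_def balls_at_def split: if_splits)
  have "H \<omega> [(m, [], False)] ?c = return_spmf (?c(m \<mapsto> []))"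
    using Suc.prems by (subst handle_handle_step) (auto simp: handle_step_def is_leaf_def n_v_def C_v_def 1)
  moreover have "?c(m \<mapsto> []) = (\<lambda>j. if j < Suc m then Some [] else None)" by auto
  ultimately show ?case using Suc by simp
qed simp

text \<open>All randomness at the root is drawn first: the ordering of the splitting balls and one
  child per routed ball. What remains is a list of arrivals in children, and every recursion below
  starts from this form.\<close>

lemma T_split:
  assumes "n > s"
  shows "T \<omega> n = bind_spmf (spmf_of_set perms) (\<lambda>xs.
     bind_pmf (replicate_pmf (n - (s0 + b * s1)) (child_pmf b (\<omega> []))) (\<lambda>cs.
       H \<omega> (child_tasks (arrivals xs cs n)) (root_config xs)))"
proof -
  let ?c = "\<lambda>j. if j < s then Some [] else None :: nat list option"
  let ?R = "\<lambda>xs. drop (s0 + b * s1) xs :: nat list"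
  have 1: "balls_in ?c [] = {..<s}" "balls_at ?c [] = {..<s}" by (auto simp: balls_in_def balls_at_def split: if_splits)
  have leaf: "is_leaf ?c []" "n_v ?c [] = s" "C_v ?c [] = s"
    using s_pos by (simp_all add: is_leaf_def n_v_def C_v_def 1)
  have "[0..<n] = [0..<s] @ s # [Suc s..<n]"
    using assms upt_add_eq_append[of 0 s "n - s"] upt_conv_Cons[of s n] by simp
  hence "T \<omega> n = bind_spmf (T \<omega> s) (H \<omega> ((s, [], False) # root_tasks [Suc s..<n]))"
    by (simp add: insert_balls_eq_handle handle_append)
  also have "\<dots> = H \<omega> ((s, [], False) # root_tasks [Suc s..<n]) ?c"
    by (simp add: T_small)
  also have "\<dots> = bind_spmf (spmf_of_set perms) (\<lambda>xs. 
      H \<omega> (split_tasks b s0 s1 [] xs @ root_tasks [Suc s..<n]) (stay_config s0 [] xs ?c))"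
    using s_pos by (subst handle_handle_step) (simp add: handle_step_def leaf 1 perms_def)
  also have "\<dots> = bind_spmf (spmf_of_set perms) (\<lambda>xs.
     bind_pmf (replicate_pmf (n - (s0 + b * s1)) (child_pmf b (\<omega> []))) (\<lambda>cs.
       H \<omega> (child_tasks (arrivals xs cs n)) (root_config xs)))"
  proof (rule bind_spmf_cong[OF refl])
    fix xs assume "xs \<in> set_spmf (spmf_of_set perms)"
    hence "xs \<in> perms" by (simp add: set_spmf_of_set finite_perms)
    note xs = perms_props[OF this]
    have rc: "stay_config s0 [] xs ?c = root_config xs"
      by (rule ext) (use xs in \<open>auto simp: stay_config_def root_config_def dest: in_set_takeD\<close>)
    have domrc: "dom (root_config xs) = set (take s0 xs)" by (auto simp: root_config_def split: if_splits)
    define F where "F = fixed_balls b s0 s1 xs"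
    have dF: "fst ` set F \<subseteq> set (drop s0 xs)" by (auto simp: F_def set_fixed_balls dest: in_set_takeD)
    have "H \<omega> (split_tasks b s0 s1 [] xs @ root_tasks [Suc s..<n]) (root_config xs) =
       bind_spmf (H \<omega> (split_tasks b s0 s1 [] xs) (root_config xs)) (H \<omega> (root_tasks [Suc s..<n]))"
      by (rule handle_append)
    also have "\<dots> = bind_spmf (H \<omega> (split_tasks b s0 s1 [] xs) (root_config xs)) (H \<omega> (map (\<lambda>j. (j, [], True)) [Suc s..<n]))"
    proof (rule bind_spmf_cong[OF refl])
      fix c' assume c': "c' \<in> set_spmf (H \<omega> (split_tasks b s0 s1 [] xs) (root_config xs))"
      have dom: "dom c' = {..s}"
        using dom_handle[OF c'] set_split[of s0 xs b s1 "[]"] by (simp add: domrc xs)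
      have "split_tasks b s0 s1 [] xs = child_tasks F @ map (\<lambda>j. (j, [], True)) (?R xs)"
        by (simp add: split_tasks_def F_def)
      hence "c' \<in> set_spmf (bind_spmf (H \<omega> (child_tasks F) (root_config xs)) (H \<omega> (map (\<lambda>j. (j, [], True)) (?R xs))))"
        using c' by (simp add: handle_append)
      hence "\<exists>cs. length cs = length (?R xs) \<and> c' \<in> set_spmf (H \<omega> (child_tasks (F @ zip (?R xs) cs)) (root_config xs))"
        by (auto simp: set_bind_spmf H_route handle_append set_replicate_pmf bind_spmf_of_pmf[symmetric]
            simp del: bind_spmf_of_pmf)
      then obtain cs where cs: "length cs = length (?R xs)" 
        "c' \<in> set_spmf (H \<omega> (child_tasks (F @ zip (?R xs) cs)) (root_config xs))" by blast
      have R: "split_at_root c'"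
      proof -
        let ?A = "F @ zip (?R xs) cs"
        \<comment> \<open>As \<open>s0 \<le> s\<close> and \<open>s + 1\<close> balls are shuffled,
          the ball in position \<open>s0\<close> is released. It ends up placed, but not at the
          root, which is therefore internal from now on.\<close>
        have "s0 < length xs" using xs s0_le by simp
        hence notin: "xs ! s0 \<notin> set (take s0 xs)"
          using xs(1) by (auto simp: in_set_conv_nth nth_eq_iff_index_eq)
        have mA: "map fst ?A = take (b * s1) (drop s0 xs) @ ?R xs"
          using cs(1) by (simp add: F_def map_fst_fixed_balls)
        have "distinct (take s0 xs @ take (b * s1) (drop s0 xs) @ ?R xs)"
          using xs(1) by (metis add.commute append_take_drop_id drop_drop)
        hence "distinct (take s0 xs @ map fst ?A)" unfolding mA .
        hence A: "distinct (map fst ?A)" "set (take s0 xs) \<inter> fst ` set ?A = {}"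
          by (simp_all only: distinct_append set_map)
        have "xs ! s0 \<in> dom c'" unfolding dom using xs(2) \<open>s0 < length xs\<close> nth_mem by blast
        moreover have "c' (xs ! s0) \<noteq> Some []"
          using root_H_child_tasks[OF cs(2) A(1) A(2)[folded domrc], of "xs ! s0"] notin
          by (simp add: root_config_def)
        ultimately obtain u where "c' (xs ! s0) = Some u" "u \<noteq> []" by auto
        thus ?thesis by (auto simp: split_at_root_def dom)
      qed
      show "H \<omega> (root_tasks [Suc s..<n]) c' = H \<omega> (map (\<lambda>j. (j, [], True)) [Suc s..<n]) c'"
        by (rule H_root_tasks_route[OF R]) (auto simp: dom)
    qed
    also have "\<dots> = H \<omega> (split_tasks b s0 s1 [] xs @ map (\<lambda>j. (j, [], True)) [Suc s..<n]) (root_config xs)"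
      by (rule handle_append[symmetric])
    also have "split_tasks b s0 s1 [] xs @ map (\<lambda>j. (j, [], True)) [Suc s..<n] =
        child_tasks F @ map (\<lambda>j. (j, [], True)) (?R xs @ [Suc s..<n])"
      by (simp add: split_tasks_def F_def)
    also have "H \<omega> \<dots> (root_config xs) = bind_spmf (H \<omega> (child_tasks F) (root_config xs)) (\<lambda>c.
       bind_pmf (replicate_pmf (n - (s0 + b * s1)) (child_pmf b (\<omega> []))) (\<lambda>cs. H \<omega> (child_tasks (zip (?R xs @ [Suc s..<n]) cs)) c))"
    proof -
      have "length (?R xs @ [Suc s..<n]) = n - (s0 + b * s1)"
        using xs(3) s1_le s0_le assms by simp
      thus ?thesis unfolding handle_append H_route by simp
    qed
    also have "\<dots> = bind_pmf (replicate_pmf (n - (s0 + b * s1)) (child_pmf b (\<omega> []))) (\<lambda>cs.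
       bind_spmf (H \<omega> (child_tasks F) (root_config xs)) (H \<omega> (child_tasks (zip (?R xs @ [Suc s..<n]) cs))))"
      by (subst bind_commute_spmf[of _ "spmf_of_pmf _", unfolded bind_spmf_of_pmf]) simp
    also have "\<dots> = bind_pmf (replicate_pmf (n - (s0 + b * s1)) (child_pmf b (\<omega> []))) (\<lambda>cs.
       H \<omega> (child_tasks (arrivals xs cs n)) (root_config xs))"
      by (simp add: handle_append arrivals_def F_def)
    finally show "H \<omega> (split_tasks b s0 s1 [] xs @ root_tasks [Suc s..<n]) (stay_config s0 [] xs ?c) =
       bind_pmf (replicate_pmf (n - (s0 + b * s1)) (child_pmf b (\<omega> []))) (\<lambda>cs.
       H \<omega> (child_tasks (arrivals xs cs n)) (root_config xs))" by (simp add: rc)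
  qed
  finally show ?thesis .
qed

end

section \<open>Losses and path lengths in a fixed environment\<close>

lemma length_child_balls_zip:
  "length js = length cs \<Longrightarrow> length (child_balls i (zip js cs)) = count_list cs i"
  by (induction js cs rule: list_induct2) (auto simp: child_balls_def)

lemma child_balls_append: "child_balls i (A @ B) = child_balls i A @ child_balls i B"
  by (simp add: child_balls_def)

lemma child_balls_fixed:
  "i < b \<Longrightarrow> child_balls i (fixed_balls b s0 s1 xs) = take s1 (drop (s0 + i * s1) xs)"
proof (induction b)
  case (Suc b)
  have *: "fixed_balls (Suc b) s0 s1 xs = fixed_balls b s0 s1 xs @ map (\<lambda>j. (j, b)) (take s1 (drop (s0 + b * s1) xs))"
    by (simp add: fixed_balls_def)
  have "snd ` set (fixed_balls b s0 s1 xs) \<subseteq> {..<b}" by (auto simp: fixed_balls_def)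
  hence "child_balls b (fixed_balls b s0 s1 xs) = []"
    by (fastforce simp: child_balls_def filter_empty_conv)
  thus ?case using Suc unfolding * child_balls_append
    by (cases "i = b") (auto simp: child_balls_def filter_map o_def)
qed simp

lemma snd_fixed_balls: "snd ` set (fixed_balls b s0 s1 xs) \<subseteq> {..<b}"
  by (auto simp: fixed_balls_def)

lemma sum_list_child_balls:
  fixes g :: "nat \<Rightarrow> ennreal"
  assumes "snd ` set A \<subseteq> {..<b}"
  shows "(\<Sum>i<b. sum_list (map g (child_balls i A))) = sum_list (map g (map fst A))"
  using assms
proof (induction A)
  case (Cons a A)
  have "(\<Sum>i<b. sum_list (map g (child_balls i (a # A)))) =
      (\<Sum>i<b. (if i = snd a then g (fst a) else 0) + sum_list (map g (child_balls i A)))"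
    by (rule sum.cong) (auto simp: child_balls_def case_prod_beta)
  thus ?case using Cons by (simp add: sum.distrib)
qed (simp add: child_balls_def)

lemma nn_integral_const_lossless: "lossless_spmf p \<Longrightarrow> (\<integral>\<^sup>+ x. c \<partial>measure_spmf p) = c"
  by (simp add: lossless_spmf_def measure_spmf.emeasure_eq_measure space_measure_spmf)

lemma map_count_list_replicate_pmf:
  "map_pmf (\<lambda>cs. count_list cs i) (replicate_pmf m p) = binomial_pmf m (pmf p i)"
proof (induction m)
  case 0
  show ?case by (simp add: binomial_pmf_0 pmf_le_1)
next
  case (Suc m)
  have B: "bernoulli_pmf (pmf p i) = map_pmf (\<lambda>x. x = i) p"
  proof (rule pmf_eqI)
    fix y
    have "measure_pmf.prob p {x. x \<noteq> i} = 1 - pmf p i"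
      using measure_pmf.prob_compl[of "{i}" p] by (simp add: pmf.rep_eq Collect_neg_eq Compl_eq_Diff_UNIV)
    moreover have "measure_pmf.prob p {x. x = i} = pmf p i" by (simp add: pmf.rep_eq)
    ultimately show "pmf (bernoulli_pmf (pmf p i)) y = pmf (map_pmf (\<lambda>x. x = i) p) y"
      by (cases y) (simp_all add: pmf_map vimage_def pmf_le_1)
  qed
  show ?case
    by (simp add: binomial_pmf_Suc pmf_le_1 B bind_map_pmf map_bind_pmf bind_assoc_pmf bind_return_pmf
        Suc[symmetric] add.commute[of _ "count_list _ _"] if_distrib)
       (auto intro!: bind_pmf_cong simp: bind_return_pmf map_pmf_def)
qed

lemma nn_integral_count_list:
  "(\<integral>\<^sup>+ cs. g (count_list cs i) \<partial>replicate_pmf m p) = (\<integral>\<^sup>+ a. g a \<partial>binomial_pmf m (pmf p i))"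
  unfolding map_count_list_replicate_pmf[symmetric] by simp

text \<open>Singles out the draw of the followed ball from the draws before and after it.\<close>

lemma replicate_pmf_split:
  "replicate_pmf (m1 + Suc m2) p = bind_pmf p (\<lambda>i. bind_pmf (replicate_pmf m1 p) (\<lambda>xs.
     bind_pmf (replicate_pmf m2 p) (\<lambda>ys. return_pmf (xs @ i # ys))))"
  by (subst bind_commute_pmf)
     (simp add: replicate_pmf_distrib bind_assoc_pmf bind_return_pmf del: replicate_pmf.simps(2) add_Suc_right
       , simp add: bind_assoc_pmf bind_return_pmf)

context split_params begin

text \<open>Out of \<open>n\<close> balls, those that choose their child by an independent draw. For
  a ball with 0-based index \<open>j > s\<close>, \<open>rem j\<close> counts the drawing balls
  ahead of it.\<close>

definition rem where "rem n = n - (s0 + b * s1)"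

lemma set_child_pmf: "set_pmf (child_pmf b w) \<subseteq> {..<b}"
proof (cases "(\<forall>i<b. 0 \<le> w i) \<and> (\<Sum>i<b. w i) = 1")
  case True
  thus ?thesis by (auto simp: set_pmf_eq pmf_child_pmf split: if_splits)
next
  case False
  hence "child_pmf b w = return_pmf 0" by (auto simp: child_pmf_def)
  thus ?thesis using b_ge by auto
qed

lemma arrivals_props:
  assumes xs: "xs \<in> perms" and n: "n > s" and cs: "cs \<in> set_pmf (replicate_pmf (rem n) (child_pmf b w))"
  shows "map fst (arrivals xs cs n) = drop s0 xs @ [Suc s..<n]"
    and "distinct (map fst (arrivals xs cs n))"
    and "dom (root_config xs) \<inter> fst ` set (arrivals xs cs n) = {}"
    and "child_config i (root_config xs) = Map.empty"
    and "snd ` set (arrivals xs cs n) \<subseteq> {..<b}"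
    and "i < b \<Longrightarrow> length (child_balls i (arrivals xs cs n)) = s1 + count_list cs i"
proof -
  note p = perms_props[OF xs]
  have c: "length cs = rem n" "set cs \<subseteq> {..<b}"
    using cs set_child_pmf[of w] by (auto simp: set_replicate_pmf in_lists_conv_set)
  have len: "length (drop (s0 + b * s1) xs @ [Suc s..<n]) = length cs"
    using p(3) s1_le s0_le n by (simp add: c rem_def)
  have "map fst (arrivals xs cs n) = take (b * s1) (drop s0 xs) @ drop (s0 + b * s1) xs @ [Suc s..<n]"
    using len by (simp add: arrivals_def map_fst_fixed_balls)
  also have "\<dots> = drop s0 xs @ [Suc s..<n]"
    by (metis add.commute append.assoc append_take_drop_id drop_drop)
  finally show 1: "map fst (arrivals xs cs n) = drop s0 xs @ [Suc s..<n]" .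
  have sd: "set (drop s0 xs) \<subseteq> {..s}" using p(2) set_drop_subset[of s0 xs] by simp
  show "distinct (map fst (arrivals xs cs n))" unfolding 1 using sd p(1) by auto
  have rc: "dom (root_config xs) = set (take s0 xs)" by (auto simp: root_config_def split: if_splits)
  have "set (take s0 xs) \<inter> set (drop s0 xs) = {}" using p(1) by (simp add: set_take_disj_set_drop_if_distinct)
  moreover have "set (take s0 xs) \<subseteq> {..s}" using p(2) set_take_subset[of s0 xs] by simp
  ultimately have "set (take s0 xs) \<inter> set (map fst (arrivals xs cs n)) = {}" unfolding 1 by auto
  thus "dom (root_config xs) \<inter> fst ` set (arrivals xs cs n) = {}" by (simp only: rc set_map)
  show "child_config i (root_config xs) = Map.empty"
    by (rule ext) (auto simp: child_config_None root_config_def)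
  show "snd ` set (arrivals xs cs n) \<subseteq> {..<b}"
    using snd_fixed_balls[of b s0 s1 xs] c(2) by (auto simp: arrivals_def image_Un dest: set_zip_rightD)
  assume i: "i < b"
  have "s0 + i * s1 + s1 \<le> length xs"
  proof -
    have "(i + 1) * s1 \<le> b * s1" using i by (intro mult_right_mono) auto
    thus ?thesis using p(3) s1_le s0_le by simp
  qed
  hence "length (child_balls i (fixed_balls b s0 s1 xs)) = s1"
    using child_balls_fixed[OF i] by simp
  thus "length (child_balls i (arrivals xs cs n)) = s1 + count_list cs i"
    unfolding arrivals_def child_balls_append length_append length_child_balls_zip[OF len] by simp
qed

text \<open>One level of the union bound; after averaging the environment it becomes a linear
  recursion for the expected loss.\<close>

lemma loss_T:
  assumes n: "n > s"
  shows "ennreal (pmf (T \<omega> n) None) \<le>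
     (\<integral>\<^sup>+ cs. (\<Sum>i<b. ennreal (pmf (T (sub \<omega> i) (s1 + count_list cs i)) None))
        \<partial>replicate_pmf (rem n) (child_pmf b (\<omega> [])))"
proof -
  let ?R = "replicate_pmf (rem n) (child_pmf b (\<omega> []))"
  have 1: "ennreal (pmf (bind_pmf ?R (\<lambda>cs. H \<omega> (child_tasks (arrivals xs cs n)) (root_config xs))) None) \<le>
     (\<integral>\<^sup>+ cs. (\<Sum>i<b. ennreal (pmf (T (sub \<omega> i) (s1 + count_list cs i)) None)) \<partial>?R)"
    if xs: "xs \<in> perms" for xs
    unfolding ennreal_pmf_bind
  proof (rule nn_integral_mono_AE, unfold AE_measure_pmf_iff, rule ballI)
    fix cs assume cs: "cs \<in> set_pmf ?R"
    note p = arrivals_props[OF xs n cs]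
    have d: "distinct (child_balls i (arrivals xs cs n))" for i
      using p(2) by (auto simp: child_balls_def distinct_map_filter)
    have "ennreal (pmf (H \<omega> (child_tasks (arrivals xs cs n)) (root_config xs)) None) \<le>
      (\<Sum>i<b. ennreal (pmf (H (sub \<omega> i) (root_tasks (child_balls i (arrivals xs cs n))) Map.empty) None))"
      by (rule loss_child_tasks[OF p(2,3,4,5)])
    also have "\<dots> = (\<Sum>i<b. ennreal (pmf (T (sub \<omega> i) (s1 + count_list cs i)) None))"
      by (rule sum.cong) (auto simp: H_root_tasks[OF d] pmf_map_spmf_None p(6))
    finally show "ennreal (pmf (H \<omega> (child_tasks (arrivals xs cs n)) (root_config xs)) None) \<le>
      (\<Sum>i<b. ennreal (pmf (T (sub \<omega> i) (s1 + count_list cs i)) None))" .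
  qed
  have "ennreal (pmf (T \<omega> n) None) =
    (\<integral>\<^sup>+ xs. ennreal (pmf (bind_pmf ?R (\<lambda>cs. H \<omega> (child_tasks (arrivals xs cs n)) (root_config xs))) None)
       \<partial>measure_spmf (spmf_of_set perms))"
    unfolding T_split[OF n] pmf_bind_spmf_None' rem_def
    using finite_perms perms_nonempty lossless_iff_pmf_None[of "spmf_of_set perms"] by simp
  also have "\<dots> \<le> (\<integral>\<^sup>+ xs. (\<integral>\<^sup>+ cs. (\<Sum>i<b. ennreal (pmf (T (sub \<omega> i) (s1 + count_list cs i)) None)) \<partial>?R)
       \<partial>measure_spmf (spmf_of_set perms))"
    by (rule nn_integral_mono_AE, unfold AE_measure_spmf_iff, rule ballI, rule 1)
       (simp add: set_spmf_of_set finite_perms)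
  also have "\<dots> = (\<integral>\<^sup>+ cs. (\<Sum>i<b. ennreal (pmf (T (sub \<omega> i) (s1 + count_list cs i)) None)) \<partial>?R)"
    using finite_perms perms_nonempty by (subst nn_integral_const_lossless) simp_all
  finally show ?thesis .
qed

text \<open>Once the outcome after the split is a function of the draws \<open>cs\<close> alone, the
  uniform ordering integrates out.\<close>

lemma integral_T:
  fixes g :: "config \<Rightarrow> ennreal" and h :: "nat list \<Rightarrow> ennreal"
  assumes n: "n > s" and ll: "\<And>i m. i < b \<Longrightarrow> lossless_spmf (T (sub \<omega> i) m)"
    and step: "\<And>xs cs. xs \<in> perms \<Longrightarrow> cs \<in> set_pmf (replicate_pmf (rem n) (child_pmf b (\<omega> []))) \<Longrightarrow>
       (\<integral>\<^sup>+ c. g c \<partial>measure_spmf (H \<omega> (child_tasks (arrivals xs cs n)) (root_config xs))) = h cs"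
  shows "(\<integral>\<^sup>+ c. g c \<partial>measure_spmf (T \<omega> n)) = (\<integral>\<^sup>+ cs. h cs \<partial>replicate_pmf (rem n) (child_pmf b (\<omega> [])))"
proof -
  let ?R = "replicate_pmf (rem n) (child_pmf b (\<omega> []))"
  have "(\<integral>\<^sup>+ c. g c \<partial>measure_spmf (T \<omega> n)) =
    (\<integral>\<^sup>+ xs. \<integral>\<^sup>+ cs. (\<integral>\<^sup>+ c. g c \<partial>measure_spmf (H \<omega> (child_tasks (arrivals xs cs n)) (root_config xs))) \<partial>?R
       \<partial>measure_spmf (spmf_of_set perms))"
    unfolding T_split[OF n] bind_spmf_of_pmf[symmetric] nn_integral_bind_spmf rem_def[symmetric] by simp
  also have "\<dots> = (\<integral>\<^sup>+ xs. \<integral>\<^sup>+ cs. h cs \<partial>?R \<partial>measure_spmf (spmf_of_set perms))"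
    by (intro nn_integral_cong_AE)
       (auto simp: AE_measure_spmf_iff set_spmf_of_set finite_perms AE_measure_pmf_iff step intro!: nn_integral_cong_AE)
  also have "\<dots> = (\<integral>\<^sup>+ cs. h cs \<partial>?R)"
    using finite_perms perms_nonempty by (subst nn_integral_const_lossless) simp_all
  finally show ?thesis .
qed


lemma ball_depth_child:
  assumes xs: "xs \<in> perms" and n: "n > s" and cs: "cs \<in> set_pmf (replicate_pmf (rem n) (child_pmf b w))"
    and ll: "\<And>i m. i < b \<Longrightarrow> lossless_spmf (T (sub \<omega> i) m)"
    and c: "c \<in> set_spmf (H \<omega> (child_tasks (arrivals xs cs n)) (root_config xs))"
    and i: "i < b" and j: "j \<in> set (child_balls i (arrivals xs cs n))"
  shows "ball_depth c j = Suc (ball_depth (child_config i c) j)"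
proof (rule ball_depth_child_config)
  note p = arrivals_props[OF xs n cs]
  have "child_config i c \<in> set_spmf (map_spmf (child_config i) (H \<omega> (child_tasks (arrivals xs cs n)) (root_config xs)))"
    using c by auto
  hence "child_config i c \<in> set_spmf (H (sub \<omega> i) (root_tasks (child_balls i (arrivals xs cs n))) Map.empty)"
    using project_child_lossless[OF p(2,3,4,5) ll] by simp
  from dom_handle[OF this] j show "child_config i c j \<noteq> None" by (auto simp: image_image)
qed

lemma integral_child:
  fixes g :: "config \<Rightarrow> ennreal"
  assumes xs: "xs \<in> perms" and n: "n > s" and cs: "cs \<in> set_pmf (replicate_pmf (rem n) (child_pmf b w))"
    and ll: "\<And>i m. i < b \<Longrightarrow> lossless_spmf (T (sub \<omega> i) m)" and i: "i < b"
  shows "(\<integral>\<^sup>+ c. g (child_config i c) \<partial>measure_spmf (H \<omega> (child_tasks (arrivals xs cs n)) (root_config xs))) =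
    (\<integral>\<^sup>+ c. g (put [] (relabel (child_balls i (arrivals xs cs n))) Map.empty c)
       \<partial>measure_spmf (T (sub \<omega> i) (s1 + count_list cs i)))"
proof -
  note p = arrivals_props[OF xs n cs]
  have d: "distinct (child_balls i (arrivals xs cs n))"
    using p(2) by (auto simp: child_balls_def distinct_map_filter)
  have "(\<integral>\<^sup>+ c. g (child_config i c) \<partial>measure_spmf (H \<omega> (child_tasks (arrivals xs cs n)) (root_config xs))) =
     (\<integral>\<^sup>+ c. g c \<partial>measure_spmf (map_spmf (child_config i) (H \<omega> (child_tasks (arrivals xs cs n)) (root_config xs))))"
    by (simp add: o_def)
  also have "map_spmf (child_config i) (H \<omega> (child_tasks (arrivals xs cs n)) (root_config xs)) =
     map_spmf (put [] (relabel (child_balls i (arrivals xs cs n))) Map.empty) (T (sub \<omega> i) (s1 + count_list cs i))"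
    using project_child_lossless[OF p(2,3,4,5) ll, where i=i] H_root_tasks[OF d, of "sub \<omega> i"] p(6)[OF i] by simp
  finally show ?thesis by (simp add: o_def)
qed

text \<open>Summed over all balls, the random ordering of the split cancels: retained balls count
  \<open>f 0\<close>, and each child contributes the same sum for its own tree with depths raised by
  one. This reaches also the balls of rank at most \<open>s + 1\<close>, whose individual fate
  depends on the ordering.\<close>

lemma path_length_T:
  fixes f :: "nat \<Rightarrow> ennreal"
  assumes n: "n > s" and ll: "\<And>i m. i < b \<Longrightarrow> lossless_spmf (T (sub \<omega> i) m)"
  shows "(\<integral>\<^sup>+ c. (\<Sum>j<n. f (ball_depth c j)) \<partial>measure_spmf (T \<omega> n)) =
    of_nat s0 * f 0 + (\<Sum>i<b. \<integral>\<^sup>+ a. (\<integral>\<^sup>+ c. (\<Sum>k<s1 + a. f (Suc (ball_depth c k))) \<partial>measure_spmf (T (sub \<omega> i) (s1 + a)))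
       \<partial>binomial_pmf (rem n) (pmf (child_pmf b (\<omega> [])) i))"
proof -
  let ?R = "replicate_pmf (rem n) (child_pmf b (\<omega> []))"
  let ?W = "\<lambda>i m. \<integral>\<^sup>+ c. (\<Sum>k<m. f (Suc (ball_depth c k))) \<partial>measure_spmf (T (sub \<omega> i) m)"
  have "(\<integral>\<^sup>+ c. (\<Sum>j<n. f (ball_depth c j)) \<partial>measure_spmf (T \<omega> n)) =
    (\<integral>\<^sup>+ cs. of_nat s0 * f 0 + (\<Sum>i<b. ?W i (s1 + count_list cs i)) \<partial>?R)"
  proof (rule integral_T[OF n ll])
    fix xs cs assume xs: "xs \<in> perms" and cs: "cs \<in> set_pmf ?R"
    note p = arrivals_props[OF xs n cs] and q = perms_props[OF xs]
    let ?A = "arrivals xs cs n"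
    let ?P = "H \<omega> (child_tasks ?A) (root_config xs)"
    have d: "distinct (child_balls i ?A)" for i
      using p(2) by (auto simp: child_balls_def distinct_map_filter)
    have ll': "lossless_spmf ?P" by (rule lossless_child_tasks[OF p(2,3,4,5) ll])
    have set: "{..<n} = set (take s0 xs @ map fst ?A)" and dist: "distinct (take s0 xs @ map fst ?A)"
    proof -
      have e: "take s0 xs @ map fst ?A = xs @ [Suc s..<n]"
        unfolding p(1) append.assoc[symmetric] append_take_drop_id ..
      show "{..<n} = set (take s0 xs @ map fst ?A)" 
      proof -
        have "{..<n} = {..s} \<union> {Suc s..<n}" using n by auto
        thus ?thesis unfolding e set_append q(2) by simp
      qed
      show "distinct (take s0 xs @ map fst ?A)" 
      proof -
        have "{..s} \<inter> {Suc s..<n} = {}" by auto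
        thus ?thesis unfolding e distinct_append q(2) using q(1) by simp
      qed
    qed
    have "(\<Sum>j<n. f (ball_depth c j)) = of_nat s0 * f 0 +
       (\<Sum>i<b. sum_list (map (\<lambda>j. f (Suc (ball_depth (child_config i c) j))) (child_balls i ?A)))"
      if c: "c \<in> set_spmf ?P" for c
    proof -
      have "(\<Sum>j<n. f (ball_depth c j)) = sum_list (map (\<lambda>j. f (ball_depth c j)) (take s0 xs)) + sum_list (map (\<lambda>j. f (ball_depth c j)) (map fst ?A))"
        unfolding set sum.distinct_set_conv_list[OF dist] by simp
      also have "map (\<lambda>j. f (ball_depth c j)) (take s0 xs) = replicate s0 (f 0)"
      proof -
        have "ball_depth c j = 0" if "j \<in> set (take s0 xs)" for j
          using root_H_child_tasks[OF c p(2,3), of j] that by (simp add: root_config_def ball_depth_def)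
        hence "map (\<lambda>j. f (ball_depth c j)) (take s0 xs) = map (\<lambda>_. f 0) (take s0 xs)"
          by (intro map_cong refl) simp
        also have "\<dots> = replicate s0 (f 0)" using q(3) s0_le by (simp add: map_replicate_const)
        finally show ?thesis .
      qed
      also have "sum_list (map (\<lambda>j. f (ball_depth c j)) (map fst ?A)) = (\<Sum>i<b. sum_list (map (\<lambda>j. f (ball_depth c j)) (child_balls i ?A)))"
        by (rule sum_list_child_balls[OF p(5), symmetric])
      also have "\<dots> = (\<Sum>i<b. sum_list (map (\<lambda>j. f (Suc (ball_depth (child_config i c) j))) (child_balls i ?A)))"
        using ball_depth_child[OF xs n cs ll c] by (intro sum.cong refl arg_cong[where f=sum_list] map_cong) auto
      finally show ?thesis by (simp add: sum_list_replicate)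
    qed
    hence "(\<integral>\<^sup>+ c. (\<Sum>j<n. f (ball_depth c j)) \<partial>measure_spmf ?P) = (\<integral>\<^sup>+ c. of_nat s0 * f 0 +
       (\<Sum>i<b. sum_list (map (\<lambda>j. f (Suc (ball_depth (child_config i c) j))) (child_balls i ?A))) \<partial>measure_spmf ?P)"
      by (intro nn_integral_cong_AE) (simp add: AE_measure_spmf_iff)
    also have "\<dots> = of_nat s0 * f 0 + (\<Sum>i<b. \<integral>\<^sup>+ c. sum_list (map (\<lambda>j. f (Suc (ball_depth (child_config i c) j))) (child_balls i ?A)) \<partial>measure_spmf ?P)"
      by (subst nn_integral_add, simp, simp, subst nn_integral_const_lossless[OF ll'],
          subst nn_integral_sum, simp_all)
    also have "(\<Sum>i<b. \<integral>\<^sup>+ c. sum_list (map (\<lambda>j. f (Suc (ball_depth (child_config i c) j))) (child_balls i ?A)) \<partial>measure_spmf ?P) =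
       (\<Sum>i<b. ?W i (s1 + count_list cs i))"
    proof (rule sum.cong[OF refl])
      fix i assume "i \<in> {..<b}"
      hence i: "i < b" by simp
      have "(\<integral>\<^sup>+ c. sum_list (map (\<lambda>j. f (Suc (ball_depth (child_config i c) j))) (child_balls i ?A)) \<partial>measure_spmf ?P) =
         (\<integral>\<^sup>+ c. sum_list (map (\<lambda>j. f (Suc (ball_depth (put [] (relabel (child_balls i ?A)) Map.empty c) j))) (child_balls i ?A))
          \<partial>measure_spmf (T (sub \<omega> i) (s1 + count_list cs i)))"
        by (rule integral_child[OF xs n cs ll i])
      also have "\<dots> = ?W i (s1 + count_list cs i)"
      proof (rule nn_integral_cong_AE, unfold AE_measure_spmf_iff, rule ballI)
        fix c assume c: "c \<in> set_spmf (T (sub \<omega> i) (s1 + count_list cs i))"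
        have "ball_depth (put [] (relabel (child_balls i ?A)) Map.empty c) (child_balls i ?A ! k) = ball_depth c k"
          if "k < s1 + count_list cs i" for k
          using that dom_T[OF c] p(6)[OF i] by (intro ball_depth_put_relabel[OF d]) auto
        thus "sum_list (map (\<lambda>j. f (Suc (ball_depth (put [] (relabel (child_balls i ?A)) Map.empty c) j))) (child_balls i ?A))
           = (\<Sum>k<s1 + count_list cs i. f (Suc (ball_depth c k)))"
          by (simp add: sum_list_sum_nth p(6)[OF i] lessThan_atLeast0)
      qed
      finally show "(\<integral>\<^sup>+ c. sum_list (map (\<lambda>j. f (Suc (ball_depth (child_config i c) j))) (child_balls i ?A)) \<partial>measure_spmf ?P) =
        ?W i (s1 + count_list cs i)" .
    qed
    finally show "(\<integral>\<^sup>+ c. (\<Sum>j<n. f (ball_depth c j)) \<partial>measure_spmf ?P) = of_nat s0 * f 0 + (\<Sum>i<b. ?W i (s1 + count_list cs i))" .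
  qed
  also have "\<dots> = of_nat s0 * f 0 + (\<Sum>i<b. \<integral>\<^sup>+ cs. ?W i (s1 + count_list cs i) \<partial>?R)"
    by (simp add: nn_integral_add nn_integral_sum)
  also have "(\<Sum>i<b. \<integral>\<^sup>+ cs. ?W i (s1 + count_list cs i) \<partial>?R) =
     (\<Sum>i<b. \<integral>\<^sup>+ a. ?W i (s1 + a) \<partial>binomial_pmf (rem n) (pmf (child_pmf b (\<omega> [])) i))"
    by (rule sum.cong[OF refl], rule nn_integral_count_list)
  finally show ?thesis .
qed

text \<open>For \<open>s < j\<close> the ball arrives after the split, so its child is one draw from
  the split vector; this draw is the source of the size bias. Then \<open>a\<close> earlier and
  \<open>d\<close> later draws fall into the same child, which makes \<open>s1 + a\<close> its
  0-based rank there and \<open>s1 + a + Suc d\<close> the size of the subtree.\<close>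

lemma single_ball_T:
  fixes f :: "nat \<Rightarrow> ennreal"
  assumes j: "s < j" "j < n" and ll: "\<And>i m. i < b \<Longrightarrow> lossless_spmf (T (sub \<omega> i) m)"
  shows "(\<integral>\<^sup>+ c. f (ball_depth c j) \<partial>measure_spmf (T \<omega> n)) =
    (\<integral>\<^sup>+ i. \<integral>\<^sup>+ a. \<integral>\<^sup>+ d. (\<integral>\<^sup>+ c. f (Suc (ball_depth c (s1 + a))) \<partial>measure_spmf (T (sub \<omega> i) (s1 + a + Suc d)))
        \<partial>binomial_pmf (n - Suc j) (pmf (child_pmf b (\<omega> [])) i)
        \<partial>binomial_pmf (rem j) (pmf (child_pmf b (\<omega> [])) i)
        \<partial>child_pmf b (\<omega> []))"
proof -
  let ?R = "replicate_pmf (rem n) (child_pmf b (\<omega> []))"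
  let ?V = "\<lambda>i a d. \<integral>\<^sup>+ c. f (Suc (ball_depth c (s1 + a))) \<partial>measure_spmf (T (sub \<omega> i) (s1 + a + Suc d))"
  have n: "n > s" using j by simp
  have rem: "rem n = rem j + Suc (n - Suc j)" using j s1_le s0_le by (simp add: rem_def)
  have "(\<integral>\<^sup>+ c. f (ball_depth c j) \<partial>measure_spmf (T \<omega> n)) =
    (\<integral>\<^sup>+ cs. ?V (cs ! rem j) (count_list (take (rem j) cs) (cs ! rem j)) (count_list (drop (Suc (rem j)) cs) (cs ! rem j)) \<partial>?R)"
  proof (rule integral_T[OF n ll])
    fix xs cs assume xs: "xs \<in> perms" and cs: "cs \<in> set_pmf ?R"
    note p = arrivals_props[OF xs n cs] and q = perms_props[OF xs]
    let ?A = "arrivals xs cs n"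
    let ?P = "H \<omega> (child_tasks ?A) (root_config xs)"
    define i where "i = cs ! rem j"
    have lcs: "length cs = rem n" and scs: "set cs \<subseteq> {..<b}"
      using cs set_child_pmf[of "\<omega> []"] by (auto simp: set_replicate_pmf in_lists_conv_set)
    have "rem j < length cs" using lcs rem by simp
    hence i: "i < b" unfolding i_def using scs nth_mem by blast
    have d: "distinct (child_balls i ?A)"
      using p(2) by (auto simp: child_balls_def distinct_map_filter)
    let ?js = "drop (s0 + b * s1) xs @ [Suc s..<n]"
    have ljs: "length ?js = length cs" using q(3) s1_le s0_le j by (simp add: lcs rem_def)
    \<comment> \<open>The list begins with the drawing balls of the split; \<open>j > s\<close> lies
      in the second part, so its position is its index minus the number of balls that do not
      draw.\<close>
    have jsj: "?js ! rem j = j"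
    proof -
      have "s0 + b * s1 \<le> Suc s" using s1_le s0_le by simp
      moreover have "\<not> j - (s0 + b * s1) < Suc s - (s0 + b * s1)"
        using j by (simp add: not_less diff_le_mono)
      ultimately show ?thesis using q(3) j by (simp add: nth_append rem_def)
    qed
    have cs_eq: "cs = take (rem j) cs @ i # drop (Suc (rem j)) cs"
      unfolding i_def using lcs rem by (simp add: id_take_nth_drop)
    have js_eq: "?js = take (rem j) ?js @ j # drop (Suc (rem j)) ?js"
    proof -
      have "rem j < length ?js" unfolding ljs lcs rem by simp
      from id_take_nth_drop[OF this] show ?thesis unfolding jsj .
    qed
    have zip: "zip ?js cs = zip (take (rem j) ?js) (take (rem j) cs) @ (j, i) # zip (drop (Suc (rem j)) ?js) (drop (Suc (rem j)) cs)"
      by (subst js_eq, subst cs_eq, subst zip_append) (simp_all only: length_take ljs zip_Cons_Cons)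
    define r where "r = s1 + count_list (take (rem j) cs) i"
    have "\<exists>L L'. child_balls i ?A = L @ j # L' \<and> length L = r"
    proof -
      have l1: "length (child_balls i (fixed_balls b s0 s1 xs)) = s1"
        using p(6)[OF i] length_child_balls_zip[OF ljs, of i] by (simp add: arrivals_def child_balls_append)
      have l2: "length (child_balls i (zip (take (rem j) ?js) (take (rem j) cs))) = count_list (take (rem j) cs) i"
        by (rule length_child_balls_zip) (use ljs in auto)
      have "child_balls i ?A = (child_balls i (fixed_balls b s0 s1 xs) @ child_balls i (zip (take (rem j) ?js) (take (rem j) cs)))
         @ j # child_balls i (zip (drop (Suc (rem j)) ?js) (drop (Suc (rem j)) cs))"
        unfolding arrivals_def child_balls_append zip by (simp add: child_balls_def)
      thus ?thesis using l1 l2 unfolding r_def by (metis length_append)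
    qed
    then obtain L L' where L: "child_balls i ?A = L @ j # L'" "length L = r" by blast
    have jr: "child_balls i ?A ! r = j" "r < length (child_balls i ?A)" using L by auto
    have N: "s1 + count_list cs i = r + Suc (count_list (drop (Suc (rem j)) cs) i)"
      unfolding r_def by (subst cs_eq) simp
    have "(\<integral>\<^sup>+ c. f (ball_depth c j) \<partial>measure_spmf ?P) = (\<integral>\<^sup>+ c. f (Suc (ball_depth (child_config i c) j)) \<partial>measure_spmf ?P)"
      using ball_depth_child[OF xs n cs ll _ i, of _ j] L by (intro nn_integral_cong_AE) (auto simp: AE_measure_spmf_iff)
    also have "\<dots> = (\<integral>\<^sup>+ c. f (Suc (ball_depth (put [] (relabel (child_balls i ?A)) Map.empty c) j))
        \<partial>measure_spmf (T (sub \<omega> i) (s1 + count_list cs i)))"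
      by (rule integral_child[OF xs n cs ll i])
    also have "\<dots> = (\<integral>\<^sup>+ c. f (Suc (ball_depth c r)) \<partial>measure_spmf (T (sub \<omega> i) (s1 + count_list cs i)))"
    proof (rule nn_integral_cong_AE, unfold AE_measure_spmf_iff, rule ballI)
      fix c assume c: "c \<in> set_spmf (T (sub \<omega> i) (s1 + count_list cs i))"
      have "ball_depth (put [] (relabel (child_balls i ?A)) Map.empty c) (child_balls i ?A ! r) = ball_depth c r"
        using dom_T[OF c] jr(2) p(6)[OF i] by (intro ball_depth_put_relabel[OF d jr(2)]) auto
      thus "f (Suc (ball_depth (put [] (relabel (child_balls i ?A)) Map.empty c) j)) = f (Suc (ball_depth c r))"
        by (simp add: jr)
    qed
    also have "\<dots> = ?V i (count_list (take (rem j) cs) i) (count_list (drop (Suc (rem j)) cs) i)"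
      unfolding N r_def ..
    finally show "(\<integral>\<^sup>+ c. f (ball_depth c j) \<partial>measure_spmf ?P) =
      ?V (cs ! rem j) (count_list (take (rem j) cs) (cs ! rem j)) (count_list (drop (Suc (rem j)) cs) (cs ! rem j))"
      unfolding i_def .
  qed
  also have "\<dots> = (\<integral>\<^sup>+ i. \<integral>\<^sup>+ xs. \<integral>\<^sup>+ ys. ?V i (count_list xs i) (count_list ys i) 
       \<partial>replicate_pmf (n - Suc j) (child_pmf b (\<omega> [])) \<partial>replicate_pmf (rem j) (child_pmf b (\<omega> [])) \<partial>child_pmf b (\<omega> []))"
    unfolding rem replicate_pmf_split nn_integral_bind_pmf nn_integral_return_pmf
    by (intro nn_integral_cong_AE)
       (auto simp: AE_measure_pmf_iff set_replicate_pmf nth_append intro!: nn_integral_cong_AE)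
  also have "\<dots> = (\<integral>\<^sup>+ i. \<integral>\<^sup>+ a. \<integral>\<^sup>+ d. ?V i a d
        \<partial>binomial_pmf (n - Suc j) (pmf (child_pmf b (\<omega> [])) i)
        \<partial>binomial_pmf (rem j) (pmf (child_pmf b (\<omega> [])) i)
        \<partial>child_pmf b (\<omega> []))"
  proof (rule nn_integral_cong)
    fix i
    let ?p = "pmf (child_pmf b (\<omega> [])) i"
    have "(\<integral>\<^sup>+ xs. \<integral>\<^sup>+ ys. ?V i (count_list xs i) (count_list ys i) 
       \<partial>replicate_pmf (n - Suc j) (child_pmf b (\<omega> [])) \<partial>replicate_pmf (rem j) (child_pmf b (\<omega> []))) =
      (\<integral>\<^sup>+ xs. \<integral>\<^sup>+ d. ?V i (count_list xs i) d \<partial>binomial_pmf (n - Suc j) ?p \<partial>replicate_pmf (rem j) (child_pmf b (\<omega> [])))"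
      by (rule nn_integral_cong, rule nn_integral_count_list)
    also have "\<dots> = (\<integral>\<^sup>+ a. \<integral>\<^sup>+ d. ?V i a d \<partial>binomial_pmf (n - Suc j) ?p \<partial>binomial_pmf (rem j) ?p)"
      by (rule nn_integral_count_list)
    finally show "(\<integral>\<^sup>+ xs. \<integral>\<^sup>+ ys. ?V i (count_list xs i) (count_list ys i) 
       \<partial>replicate_pmf (n - Suc j) (child_pmf b (\<omega> [])) \<partial>replicate_pmf (rem j) (child_pmf b (\<omega> []))) = \<dots>" .
  qed
  finally show ?thesis .
qed

end

section \<open>The random environment\<close>

lemma nn_integral_binomial:
  assumes "p \<in> {0..1}"
  shows "(\<integral>\<^sup>+ a. F a \<partial>binomial_pmf m p) = (\<Sum>a\<le>m. ennreal (Bernstein m a p) * F a)"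
proof -
  have "(\<integral>\<^sup>+ a. F a \<partial>binomial_pmf m p) = (\<Sum>a\<le>m. F a * ennreal (pmf (binomial_pmf m p) a))"
    by (rule nn_integral_measure_pmf_support) (use assms in \<open>auto simp: set_pmf_binomial_eq split: if_splits\<close>)
  thus ?thesis using assms by (simp add: Bernstein_def mult_ac)
qed

lemma Bernstein_measurable [measurable]: "(\<lambda>x. Bernstein m a x) \<in> borel_measurable borel"
  unfolding Bernstein_def by measurable

locale split_tree = split_params +
  fixes Vlaw :: "(nat \<Rightarrow> real) measure"
  assumes P: "prob_space Vlaw"
    and sets_V: "sets Vlaw = sets (PiM UNIV (\<lambda>_::nat. borel))"
    and simplex: "AE x in Vlaw. (\<forall>i<b. 0 \<le> x i) \<and> (\<Sum>i<b. x i) = 1"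
    and ident: "\<forall>i<b. distr Vlaw borel (\<lambda>x. x i) = distr Vlaw borel (\<lambda>x. x 0)"
    and A1_0: "measure Vlaw {x \<in> space Vlaw. x 0 = 0} = 0"
    and A1_1: "measure Vlaw {x \<in> space Vlaw. x 0 = 1} = 0"
begin

definition env :: "(nat list \<Rightarrow> nat \<Rightarrow> real) measure" where "env = PiM UNIV (\<lambda>_. Vlaw)"
text \<open>Common law of the components. The joint law of a split vector enters the recursions only
  through it, since every term involves a single child.\<close>

definition L :: "real measure" where "L = distr Vlaw borel (\<lambda>x. x 0)"

sublocale V: prob_space Vlaw by (rule P)
sublocale PV: product_prob_space "\<lambda>_::nat list. Vlaw" UNIV by unfold_locales
sublocale env: prob_space env unfolding env_def by (rule prob_space_PiM) (rule P)

lemma space_V: "space Vlaw = UNIV"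
  using sets_eq_imp_space_eq[OF sets_V] by (simp add: space_PiM)

lemma measurable_V: "(\<lambda>x. x i) \<in> borel_measurable Vlaw"
  by (subst measurable_cong_sets[OF sets_V refl]) (rule measurable_component_singleton, simp)

lemma measurable_env_V: "(\<lambda>\<omega>. \<omega> v) \<in> env \<rightarrow>\<^sub>M Vlaw"
  unfolding env_def by (rule measurable_component_singleton) simp

lemma measurable_env: "(\<lambda>\<omega>. \<omega> v i) \<in> borel_measurable env"
  using measurable_compose[OF measurable_env_V measurable_V] .

lemma space_env: "space env = UNIV"
  by (simp add: env_def space_PiM space_V)

lemma distr_root: "distr env Vlaw (\<lambda>\<omega>. \<omega> v) = Vlaw"
  unfolding env_def by (rule PV.PiM_component) simp

lemma distr_sub: "distr env env (\<lambda>\<omega>. sub \<omega> i) = env"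
  using distr_PiM_reindex[of "UNIV :: nat list set" "\<lambda>_. Vlaw" "(#) i" "UNIV :: nat list set"] P
  by (simp add: env_def restrict_UNIV)

lemma measurable_sub: "(\<lambda>\<omega>. sub \<omega> i) \<in> env \<rightarrow>\<^sub>M env"
  unfolding env_def by (rule measurable_PiM_single') (auto simp: space_PiM space_V)

lemma measurable_comp_sub: "u \<in> borel_measurable env \<Longrightarrow> (\<lambda>\<omega>. u (sub \<omega> i)) \<in> borel_measurable env"
  by (rule measurable_compose[OF measurable_sub])

lemma measurable_comp_V: "g \<in> borel_measurable borel \<Longrightarrow> (\<lambda>w. g (w i)) \<in> borel_measurable Vlaw"
  by (rule measurable_compose[OF measurable_V])

lemma measurable_comp_root: "g \<in> borel_measurable borel \<Longrightarrow> (\<lambda>\<omega>. g (\<omega> [] i)) \<in> borel_measurable env"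
  by (rule measurable_compose[OF measurable_env])

text \<open>The root and the subtree of child \<open>i\<close> use disjoint coordinates of the
  product measure, and the subtree coordinates have the law of the whole environment again. This
  self-similarity closes the recursions.\<close>

lemma indep_root_sub:
  assumes [measurable]: "g \<in> borel_measurable Vlaw" "u \<in> borel_measurable env"
  shows "(\<integral>\<^sup>+\<omega>. g (\<omega> []) * u (sub \<omega> i) \<partial>env) = (\<integral>\<^sup>+w. g w \<partial>Vlaw) * (\<integral>\<^sup>+\<omega>. u \<omega> \<partial>env)"
proof -
  let ?R = "PiM {[]} (\<lambda>_. Vlaw)" and ?r = "\<lambda>\<omega>. restrict (\<lambda>v. \<omega> v) {[]}"
  have "env.indep_vars (\<lambda>_. Vlaw) (\<lambda>v \<omega>. \<omega> v) UNIV"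
    by (subst env.indep_vars_iff_distr_eq_PiM)
       (auto simp: distr_root restrict_UNIV measurable_env_V, simp add: env_def distr_id2)
  hence "env.indep_var (PiM {[]} (\<lambda>_. Vlaw)) (\<lambda>\<omega>. restrict (\<lambda>v. \<omega> v) {[]})
      (PiM (range ((#) i)) (\<lambda>_. Vlaw)) (\<lambda>\<omega>. restrict (\<lambda>v. \<omega> v) (range ((#) i)))"
    by (rule env.indep_var_restrict) auto
  hence "env.indep_var ?R ((\<lambda>f. f) \<circ> (\<lambda>\<omega>. restrict (\<lambda>v. \<omega> v) {[]}))
      env ((\<lambda>f u. f (i # u)) \<circ> (\<lambda>\<omega>. restrict (\<lambda>v. \<omega> v) (range ((#) i))))"
  proof (rule env.indep_var_compose)
    show "(\<lambda>f u. f (i # u)) \<in> PiM (range ((#) i)) (\<lambda>_. Vlaw) \<rightarrow>\<^sub>M env"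
      unfolding env_def
      by (rule measurable_PiM_single') (auto simp: space_PiM space_V intro!: measurable_component_singleton)
  qed simp
  hence ind: "env.indep_var ?R ?r env (\<lambda>\<omega>. sub \<omega> i)" by (simp add: o_def)
  hence [measurable]: "?r \<in> env \<rightarrow>\<^sub>M ?R" by (simp add: env.indep_var_distribution_eq)
  have [measurable]: "(\<lambda>f. f []) \<in> ?R \<rightarrow>\<^sub>M Vlaw" by (rule measurable_component_singleton) simp
  note [measurable] = measurable_sub
  from ind have d: "distr env (?R \<Otimes>\<^sub>M env) (\<lambda>\<omega>. (?r \<omega>, sub \<omega> i)) = distr env ?R ?r \<Otimes>\<^sub>M env"
    unfolding env.indep_var_distribution_eq distr_sub by simp
  have "(\<integral>\<^sup>+\<omega>. g (\<omega> []) * u (sub \<omega> i) \<partial>env) = (\<integral>\<^sup>+z. g (fst z []) * u (snd z) \<partial>distr env (?R \<Otimes>\<^sub>M env) (\<lambda>\<omega>. (?r \<omega>, sub \<omega> i)))"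
    by (subst nn_integral_distr) auto
  also have "\<dots> = (\<integral>\<^sup>+f. \<integral>\<^sup>+\<omega>. g (f []) * u \<omega> \<partial>env \<partial>distr env ?R ?r)"
    unfolding d by (subst env.nn_integral_fst[symmetric]) auto
  also have "\<dots> = (\<integral>\<^sup>+f. g (f []) * (\<integral>\<^sup>+\<omega>. u \<omega> \<partial>env) \<partial>distr env ?R ?r)"
    by (simp add: nn_integral_cmult)
  also have "\<dots> = (\<integral>\<^sup>+f. g (f []) \<partial>distr env ?R ?r) * (\<integral>\<^sup>+\<omega>. u \<omega> \<partial>env)"
    by (rule nn_integral_multc) simp
  also have "(\<integral>\<^sup>+f. g (f []) \<partial>distr env ?R ?r) = (\<integral>\<^sup>+w. g w \<partial>distr env Vlaw (\<lambda>\<omega>. \<omega> []))"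
    by (simp add: nn_integral_distr measurable_env_V)
  also have "\<dots> = (\<integral>\<^sup>+w. g w \<partial>Vlaw)" unfolding distr_root ..
  finally show ?thesis .
qed

definition valid :: "(nat \<Rightarrow> real) \<Rightarrow> bool" where
  "valid w \<longleftrightarrow> (\<forall>i<b. 0 \<le> w i) \<and> (\<Sum>i<b. w i) = 1"

lemma AE_valid: "AE \<omega> in env. valid (\<omega> v)"
proof -
  have "AE w in distr env Vlaw (\<lambda>\<omega>. \<omega> v). valid w"
    unfolding distr_root valid_def by (rule simplex)
  thus ?thesis by (rule AE_distrD[OF measurable_env_V])
qed

lemma valid_le_1: "valid w \<Longrightarrow> i < b \<Longrightarrow> w i \<in> {0..1}"
  using member_le_sum[of i "{..<b}" w] by (auto simp: valid_def)

lemma pmf_child_valid: "valid w \<Longrightarrow> i < b \<Longrightarrow> pmf (child_pmf b w) i = w i"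
  by (simp add: valid_def pmf_child_pmf)

lemma nn_integral_L: "g \<in> borel_measurable borel \<Longrightarrow> i < b \<Longrightarrow> (\<integral>\<^sup>+w. g (w i) \<partial>Vlaw) = (\<integral>\<^sup>+x. g x \<partial>L)"
proof -
  assume [measurable]: "g \<in> borel_measurable borel" and i: "i < b"
  have "L = distr Vlaw borel (\<lambda>w. w i)" unfolding L_def using ident i by metis
  thus ?thesis by (simp add: nn_integral_distr measurable_V)
qed

sublocale L: prob_space L unfolding L_def by (rule V.prob_space_distr) (rule measurable_V)

lemma sets_L [measurable_cong, simp]: "sets L = sets borel" by (simp add: L_def)

lemma AE_L: "AE x in L. 0 < x \<and> x < 1"
proof -
  have [measurable]: "(\<lambda>w. w 0) \<in> borel_measurable Vlaw" by (rule measurable_V)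
  have "AE w in Vlaw. w 0 \<in> {0..1}"
    using simplex by eventually_elim (use valid_le_1 b_ge in \<open>auto simp: valid_def\<close>)
  moreover have "AE w in Vlaw. w 0 \<noteq> 0"
    by (rule AE_I[where N="{x \<in> space Vlaw. x 0 = 0}"]) (use A1_0 in \<open>auto simp: V.emeasure_eq_measure\<close>)
  moreover have "AE w in Vlaw. w 0 \<noteq> 1"
    by (rule AE_I[where N="{x \<in> space Vlaw. x 0 = 1}"]) (use A1_1 in \<open>auto simp: V.emeasure_eq_measure\<close>)
  ultimately have "AE w in Vlaw. 0 < w 0 \<and> w 0 < 1" by eventually_elim auto
  thus ?thesis unfolding L_def by (subst AE_distr_iff) (auto simp: measurable_V)
qed

text \<open>The components sum to 1 and share the law \<open>L\<close>. Consequently b x dL(x) is a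
  probability: the law of the proportion of the child that a drawing ball enters.\<close>

lemma L_size_bias: "real b * (\<integral>x. x \<partial>L) = 1"
proof -
  have int: "integrable L (\<lambda>x. x)"
  proof (rule L.integrable_const_bound[where B=1])
    show "AE x in L. norm x \<le> 1" by (rule AE_mp[OF AE_L], rule AE_I2) simp
    show "(\<lambda>x. x) \<in> borel_measurable L" by measurable
  qed
  have nonneg: "AE x in L. 0 \<le> x" by (rule AE_mp[OF AE_L], rule AE_I2) simp
  have "ennreal (real b * (\<integral>x. x \<partial>L)) = of_nat b * ennreal (\<integral>x. x \<partial>L)"
    by (simp add: ennreal_mult' ennreal_of_nat_eq_real_of_nat)
  also have "ennreal (\<integral>x. x \<partial>L) = (\<integral>\<^sup>+x. ennreal x \<partial>L)"
    by (rule nn_integral_eq_integral[symmetric, OF int nonneg])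
  also have "of_nat b * \<dots> = (\<Sum>i<b. \<integral>\<^sup>+w. ennreal (w i) \<partial>Vlaw)"
    by (simp add: nn_integral_L[where g=ennreal])
  also have "\<dots> = (\<integral>\<^sup>+w. (\<Sum>i<b. ennreal (w i)) \<partial>Vlaw)"
    by (rule nn_integral_sum[symmetric]) (simp add: measurable_comp_V[where g=ennreal])
  also have "\<dots> = (\<integral>\<^sup>+w. 1 \<partial>Vlaw)"
  proof (rule nn_integral_cong_AE)
    show "AE w in Vlaw. (\<Sum>i<b. ennreal (w i)) = 1"
      using simplex by eventually_elim (subst sum_ennreal, auto)
  qed
  also have "\<dots> = ennreal 1" by (simp add: V.emeasure_space_1)
  finally have "ennreal (real b * (\<integral>x. x \<partial>L)) = ennreal 1" .
  moreover have "0 \<le> (\<integral>x. x \<partial>L)" by (rule integral_nonneg_AE) (rule nonneg)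
  ultimately show ?thesis by (subst (asm) ennreal_inj) auto
qed

text \<open>From a fixed environment to expectations: the binomial weights are Bernstein polynomials
  in one component, independence factorises each term, and equal laws merge the \<open>b\<close>
  children.\<close>

lemma anneal_binomial:
  fixes u :: "nat \<Rightarrow> (nat list \<Rightarrow> nat \<Rightarrow> real) \<Rightarrow> ennreal"
  assumes u [simp, measurable]: "\<And>a. u a \<in> borel_measurable env"
  shows "(\<integral>\<^sup>+\<omega>. c + (\<Sum>i<b. \<integral>\<^sup>+a. u a (sub \<omega> i) \<partial>binomial_pmf m (pmf (child_pmf b (\<omega> [])) i)) \<partial>env) =
     c + of_nat b * (\<integral>\<^sup>+x. (\<Sum>a\<le>m. ennreal (Bernstein m a x) * (\<integral>\<^sup>+\<omega>. u a \<omega> \<partial>env)) \<partial>L)"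
proof -
  let ?w = "\<lambda>a x. ennreal (Bernstein m a x)"
  have [measurable]: "(\<lambda>\<omega>. ?w a (\<omega> [] i) * u a (sub \<omega> i)) \<in> borel_measurable env" for i a
    using measurable_comp_root[where g="?w a" and i=i] by (intro borel_measurable_times_ennreal measurable_comp_sub) simp_all
  have "(\<integral>\<^sup>+\<omega>. c + (\<Sum>i<b. \<integral>\<^sup>+a. u a (sub \<omega> i) \<partial>binomial_pmf m (pmf (child_pmf b (\<omega> [])) i)) \<partial>env) =
     (\<integral>\<^sup>+\<omega>. c + (\<Sum>i<b. \<Sum>a\<le>m. ?w a (\<omega> [] i) * u a (sub \<omega> i)) \<partial>env)"
  proof (rule nn_integral_cong_AE, rule AE_mp[OF AE_valid[of "[]"]], intro AE_I2 impI)
    fix \<omega> :: "nat list \<Rightarrow> nat \<Rightarrow> real" assume v: "valid (\<omega> [])"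
    have "(\<integral>\<^sup>+a. u a (sub \<omega> i) \<partial>binomial_pmf m (pmf (child_pmf b (\<omega> [])) i)) =
      (\<Sum>a\<le>m. ?w a (\<omega> [] i) * u a (sub \<omega> i))" if i: "i < b" for i
      unfolding pmf_child_valid[OF v i] by (rule nn_integral_binomial[OF valid_le_1[OF v i]])
    thus "c + (\<Sum>i<b. \<integral>\<^sup>+a. u a (sub \<omega> i) \<partial>binomial_pmf m (pmf (child_pmf b (\<omega> [])) i)) =
       c + (\<Sum>i<b. \<Sum>a\<le>m. ?w a (\<omega> [] i) * u a (sub \<omega> i))" by simp
  qed
  also have "\<dots> = c + (\<Sum>i<b. \<Sum>a\<le>m. \<integral>\<^sup>+\<omega>. ?w a (\<omega> [] i) * u a (sub \<omega> i) \<partial>env)"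
    by (simp add: nn_integral_add nn_integral_sum env.emeasure_space_1)
  also have "(\<Sum>i<b. \<Sum>a\<le>m. \<integral>\<^sup>+\<omega>. ?w a (\<omega> [] i) * u a (sub \<omega> i) \<partial>env) =
     (\<Sum>i<b. \<Sum>a\<le>m. (\<integral>\<^sup>+w. ?w a (w i) \<partial>Vlaw) * (\<integral>\<^sup>+\<omega>. u a \<omega> \<partial>env))"
    using measurable_comp_V[where g="?w _"] by (intro sum.cong refl indep_root_sub) simp_all
  also have "\<dots> = (\<Sum>i<b. \<Sum>a\<le>m. (\<integral>\<^sup>+x. ?w a x \<partial>L) * (\<integral>\<^sup>+\<omega>. u a \<omega> \<partial>env))"
  proof (intro sum.cong refl)
    fix i a assume "i \<in> {..<b}"
    thus "(\<integral>\<^sup>+w. ?w a (w i) \<partial>Vlaw) * (\<integral>\<^sup>+\<omega>. u a \<omega> \<partial>env) = (\<integral>\<^sup>+x. ?w a x \<partial>L) * (\<integral>\<^sup>+\<omega>. u a \<omega> \<partial>env)"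
      using nn_integral_L[of "?w a" i] by simp
  qed
  also have "\<dots> = of_nat b * (\<Sum>a\<le>m. \<integral>\<^sup>+x. ?w a x * (\<integral>\<^sup>+\<omega>. u a \<omega> \<partial>env) \<partial>L)"
    by (simp add: nn_integral_multc)
  also have "\<dots> = of_nat b * (\<integral>\<^sup>+x. (\<Sum>a\<le>m. ?w a x * (\<integral>\<^sup>+\<omega>. u a \<omega> \<partial>env)) \<partial>L)"
    by (simp add: nn_integral_sum)
  finally show ?thesis .
qed

text \<open>As in \<open>anneal_binomial\<close>, with the choice of the child giving one more
  factor \<open>x\<close>: the proportion is drawn from the size-biased law b x dL(x), and both
  binomials share it.\<close>

lemma anneal_single:
  fixes u :: "nat \<Rightarrow> nat \<Rightarrow> (nat list \<Rightarrow> nat \<Rightarrow> real) \<Rightarrow> ennreal"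
  assumes u [simp, measurable]: "\<And>a d. u a d \<in> borel_measurable env"
  shows "(\<integral>\<^sup>+\<omega>. (\<integral>\<^sup>+i. \<integral>\<^sup>+a. \<integral>\<^sup>+d. u a d (sub \<omega> i) \<partial>binomial_pmf m' (pmf (child_pmf b (\<omega> [])) i)
         \<partial>binomial_pmf m (pmf (child_pmf b (\<omega> [])) i) \<partial>child_pmf b (\<omega> [])) \<partial>env) =
     of_nat b * (\<integral>\<^sup>+x. (\<Sum>a\<le>m. \<Sum>d\<le>m'. ennreal (x * Bernstein m a x * Bernstein m' d x) * (\<integral>\<^sup>+\<omega>. u a d \<omega> \<partial>env)) \<partial>L)"
proof -
  let ?w = "\<lambda>a d x. ennreal (x * Bernstein m a x * Bernstein m' d x)"
  have "(\<integral>\<^sup>+\<omega>. (\<integral>\<^sup>+i. \<integral>\<^sup>+a. \<integral>\<^sup>+d. u a d (sub \<omega> i) \<partial>binomial_pmf m' (pmf (child_pmf b (\<omega> [])) i)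
         \<partial>binomial_pmf m (pmf (child_pmf b (\<omega> [])) i) \<partial>child_pmf b (\<omega> [])) \<partial>env) =
    (\<integral>\<^sup>+\<omega>. (\<Sum>i<b. \<Sum>a\<le>m. \<Sum>d\<le>m'. ?w a d (\<omega> [] i) * u a d (sub \<omega> i)) \<partial>env)"
  proof (rule nn_integral_cong_AE, rule AE_mp[OF AE_valid[of "[]"]], intro AE_I2 impI)
    fix \<omega> :: "nat list \<Rightarrow> nat \<Rightarrow> real" assume v: "valid (\<omega> [])"
    let ?B = "\<lambda>i. \<integral>\<^sup>+a. \<integral>\<^sup>+d. u a d (sub \<omega> i) \<partial>binomial_pmf m' (pmf (child_pmf b (\<omega> [])) i)
         \<partial>binomial_pmf m (pmf (child_pmf b (\<omega> [])) i)"
    have "(\<integral>\<^sup>+i. ?B i \<partial>child_pmf b (\<omega> [])) = (\<Sum>i<b. ?B i * ennreal (pmf (child_pmf b (\<omega> [])) i))"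
      by (rule nn_integral_measure_pmf_support) (use set_child_pmf in auto)
    also have "\<dots> = (\<Sum>i<b. \<Sum>a\<le>m. \<Sum>d\<le>m'. ?w a d (\<omega> [] i) * u a d (sub \<omega> i))"
    proof (rule sum.cong[OF refl])
      fix i assume "i \<in> {..<b}"
      hence i: "i < b" by simp
      note x = valid_le_1[OF v i]
      have B: "Bernstein m a (\<omega> [] i) \<ge> 0" "Bernstein m' a (\<omega> [] i) \<ge> 0" for a
        using x by (auto intro: Bernstein_nonneg)
      show "?B i * ennreal (pmf (child_pmf b (\<omega> [])) i) = (\<Sum>a\<le>m. \<Sum>d\<le>m'. ?w a d (\<omega> [] i) * u a d (sub \<omega> i))"
        using x B
        by (simp add: pmf_child_valid[OF v i] nn_integral_binomial sum_distrib_left sum_distrib_right ennreal_mult mult_ac)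
    qed
    finally show "(\<integral>\<^sup>+i. ?B i \<partial>child_pmf b (\<omega> [])) = (\<Sum>i<b. \<Sum>a\<le>m. \<Sum>d\<le>m'. ?w a d (\<omega> [] i) * u a d (sub \<omega> i))" .
  qed
  also have "\<dots> = (\<Sum>i<b. \<Sum>a\<le>m. \<Sum>d\<le>m'. \<integral>\<^sup>+\<omega>. ?w a d (\<omega> [] i) * u a d (sub \<omega> i) \<partial>env)"
  proof -
    have [measurable]: "(\<lambda>\<omega>. ?w a d (\<omega> [] i) * u a d (sub \<omega> i)) \<in> borel_measurable env" for i a d
      using measurable_comp_root[where g="?w a d" and i=i] by (intro borel_measurable_times_ennreal measurable_comp_sub) simp_all
    show ?thesis by (simp add: nn_integral_sum)
  qed
  also have "\<dots> = (\<Sum>i<b. \<Sum>a\<le>m. \<Sum>d\<le>m'. (\<integral>\<^sup>+w. ?w a d (w i) \<partial>Vlaw) * (\<integral>\<^sup>+\<omega>. u a d \<omega> \<partial>env))"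
    using measurable_comp_V[where g="?w _ _"] by (intro sum.cong refl indep_root_sub) simp_all
  also have "\<dots> = (\<Sum>i<b. \<Sum>a\<le>m. \<Sum>d\<le>m'. (\<integral>\<^sup>+x. ?w a d x \<partial>L) * (\<integral>\<^sup>+\<omega>. u a d \<omega> \<partial>env))"
  proof (intro sum.cong refl)
    fix i a d assume "i \<in> {..<b}"
    thus "(\<integral>\<^sup>+w. ?w a d (w i) \<partial>Vlaw) * (\<integral>\<^sup>+\<omega>. u a d \<omega> \<partial>env) = (\<integral>\<^sup>+x. ?w a d x \<partial>L) * (\<integral>\<^sup>+\<omega>. u a d \<omega> \<partial>env)"
      using nn_integral_L[of "?w a d" i] by simp
  qed
  also have "\<dots> = of_nat b * (\<Sum>a\<le>m. \<Sum>d\<le>m'. \<integral>\<^sup>+x. ?w a d x * (\<integral>\<^sup>+\<omega>. u a d \<omega> \<partial>env) \<partial>L)"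
    by (simp add: nn_integral_multc)
  also have "\<dots> = of_nat b * (\<integral>\<^sup>+x. (\<Sum>a\<le>m. \<Sum>d\<le>m'. ?w a d x * (\<integral>\<^sup>+\<omega>. u a d \<omega> \<partial>env)) \<partial>L)"
    by (simp add: nn_integral_sum)
  finally show ?thesis .
qed

end

lemma Bernstein_moment1: "(\<Sum>a\<le>m. Bernstein m a x * (c + real a)) = c + real m * x"
proof -
  have "(\<Sum>a\<le>m. Bernstein m a x * (c + real a)) = c * (\<Sum>a\<le>m. Bernstein m a x) + (\<Sum>a\<le>m. real a * Bernstein m a x)"
    unfolding sum_distrib_left sum.distrib[symmetric] by (rule sum.cong) (auto simp: algebra_simps)
  thus ?thesis by (simp add: sum_Bernstein sum_k_Bernstein)
qed

lemma Bernstein_moment2: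
  "(\<Sum>a\<le>m. Bernstein m a x * ((c + real a) * (c + real a - 1))) =
     c * (c - 1) + 2 * c * real m * x + real m * (real m - 1) * x\<^sup>2"
proof -
  have "(\<Sum>a\<le>m. Bernstein m a x * ((c + real a) * (c + real a - 1))) =
     c * (c - 1) * (\<Sum>a\<le>m. Bernstein m a x) + 2 * c * (\<Sum>a\<le>m. real a * Bernstein m a x)
       + (\<Sum>a\<le>m. real a * (real a - 1) * Bernstein m a x)"
    unfolding sum_distrib_left sum.distrib[symmetric] by (rule sum.cong) (auto simp: algebra_simps power2_eq_square)
  thus ?thesis by (simp add: sum_Bernstein sum_k_Bernstein sum_kk_Bernstein)
qed

section \<open>Almost sure termination and the law of the depth\<close>

context split_tree begin

lemma integrable_L_bounded:
  assumes "f \<in> borel_measurable borel" "\<And>x. 0 < x \<Longrightarrow> x < 1 \<Longrightarrow> \<bar>f x\<bar> \<le> (B::real)"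
  shows "integrable L f"
proof (rule L.integrable_const_bound[where B=B])
  show "AE x in L. norm (f x) \<le> B" using AE_L by eventually_elim (simp add: assms(2))
  show "f \<in> borel_measurable L" using assms(1) by (subst measurable_cong_sets[OF sets_L refl])
qed

lemma Bernstein_le_1: "0 \<le> x \<Longrightarrow> x \<le> 1 \<Longrightarrow> Bernstein m a x \<le> 1"
proof (cases "a \<le> m")
  case True
  assume x: "0 \<le> x" "x \<le> 1"
  have "Bernstein m a x \<le> (\<Sum>a\<le>m. Bernstein m a x)"
    using True x by (intro member_le_sum) (auto intro: Bernstein_nonneg)
  thus ?thesis by (simp add: sum_Bernstein)
qed (simp add: Bernstein_def binomial_eq_0)

lemma integrable_Bernstein: "integrable L (Bernstein m a)"
  by (rule integrable_L_bounded[where B=1]) (auto intro: Bernstein_le_1 simp: Bernstein_nonneg)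

lemma nn_integral_Bernstein:
  assumes h: "\<And>a. h a \<ge> 0"
  shows "(\<integral>\<^sup>+x. (\<Sum>a\<le>m. ennreal (Bernstein m a x) * ennreal (h a)) \<partial>L) =
     ennreal (\<integral>x. (\<Sum>a\<le>m. Bernstein m a x * h a) \<partial>L)"
proof -
  have nonneg: "AE x in L. 0 \<le> (\<Sum>a\<le>m. Bernstein m a x * h a)"
    using AE_L by eventually_elim (auto intro!: sum_nonneg mult_nonneg_nonneg h Bernstein_nonneg)
  have "(\<integral>\<^sup>+x. (\<Sum>a\<le>m. ennreal (Bernstein m a x) * ennreal (h a)) \<partial>L) =
     (\<integral>\<^sup>+x. ennreal (\<Sum>a\<le>m. Bernstein m a x * h a) \<partial>L)"
  proof (rule nn_integral_cong_AE)
    show "AE x in L. (\<Sum>a\<le>m. ennreal (Bernstein m a x) * ennreal (h a)) = ennreal (\<Sum>a\<le>m. Bernstein m a x * h a)"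
      using AE_L
    proof eventually_elim
      case (elim x)
      hence "0 \<le> Bernstein m a x" for a by (intro Bernstein_nonneg) auto
      thus ?case using h by (subst sum_ennreal[symmetric]) (auto simp: ennreal_mult)
    qed
  qed
  also have "\<dots> = ennreal (\<integral>x. (\<Sum>a\<le>m. Bernstein m a x * h a) \<partial>L)"
    by (rule nn_integral_eq_integral) (auto intro!: nonneg integrable_Bernstein)
  finally show ?thesis .
qed

text \<open>Two balls drawing independently meet in a child with probability b E(V^2), which is
  below 1 because V lies in (0, 1) almost surely. The bound 1 / b covers the pairs that involve a
  ball assigned deterministically.\<close>

definition rho where "rho = max (real b * (\<integral>x. x\<^sup>2 \<partial>L)) (1 / real b)"

lemma integrable_x: "integrable L (\<lambda>x. x)" and integrable_x2: "integrable L (\<lambda>x. x\<^sup>2)"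
proof -
  show "integrable L (\<lambda>x. x)" by (rule integrable_L_bounded[where B=1]) auto
  show "integrable L (\<lambda>x. x\<^sup>2)" by (rule integrable_L_bounded[where B=1]) (auto simp: power_le_one)
qed

lemma rho_less_1: "rho < 1"
proof -
  have "(\<integral>x. x\<^sup>2 \<partial>L) < (\<integral>x. x \<partial>L)"
  proof (rule L.integral_less_AE_space[OF integrable_x2 integrable_x])
    show "AE x in L. x\<^sup>2 < x" using AE_L by eventually_elim (simp add: power2_eq_square)
    show "emeasure L (space L) \<noteq> 0" by (simp add: L.emeasure_space_1)
  qed
  hence "real b * (\<integral>x. x\<^sup>2 \<partial>L) < real b * (\<integral>x. x \<partial>L)" using b_ge by simp
  thus ?thesis using b_ge by (simp add: rho_def L_size_bias)
qed

lemma rho_pos: "rho > 0"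
  using b_ge by (simp add: rho_def less_max_iff_disj)

text \<open>n(n - 1) counts ordered pairs of balls. Pairs sharing a child are fixed-fixed,
  fixed-drawn or drawn-drawn, matching the three terms in the expansion of (t + m)(t + m - 1) with t
  = b s1 fixed and m drawn balls; each kind shrinks at least by the factor
  \<open>rho\<close>.\<close>

lemma factorial_moment_split:
  assumes n: "n > s"
  shows "real b * (\<integral>x. (\<Sum>a\<le>rem n. Bernstein (rem n) a x * (real (s1 + a) * (real (s1 + a) - 1))) \<partial>L)
     \<le> rho * (real n * (real n - 1))"
proof -
  define m where "m = real (rem n)"
  define t where "t = real b * real s1"
  define I1 where "I1 = (\<integral>x. x \<partial>L)"
  define I2 where "I2 = (\<integral>x. x\<^sup>2 \<partial>L)"
  have bI: "real b * I1 = 1" using L_size_bias by (simp add: I1_def)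
  have I2: "real b * I2 \<le> rho" by (simp add: rho_def I2_def)
  have "1 / real b \<le> rho" by (simp add: rho_def)
  hence r: "1 \<le> rho * real b" using b_ge by (simp add: divide_le_eq)
  have n_eq: "real n = real s0 + t + m"
  proof -
    have "s0 + b * s1 \<le> n" using n s1_le s0_le by simp
    thus ?thesis unfolding t_def m_def rem_def by simp
  qed
  have "(\<integral>x. (\<Sum>a\<le>rem n. Bernstein (rem n) a x * (real (s1 + a) * (real (s1 + a) - 1))) \<partial>L) =
     (\<integral>x. real s1 * (real s1 - 1) + 2 * real s1 * m * x + m * (m - 1) * x\<^sup>2 \<partial>L)"
    by (rule Bochner_Integration.integral_cong[OF refl])
       (simp only: of_nat_add Bernstein_moment2 m_def)
  also have "\<dots> = real s1 * (real s1 - 1) + 2 * real s1 * m * I1 + m * (m - 1) * I2"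
    using integrable_x integrable_x2 by (simp add: I1_def I2_def L.prob_space)
  finally have E: "(\<integral>x. (\<Sum>a\<le>rem n. Bernstein (rem n) a x * (real (s1 + a) * (real (s1 + a) - 1))) \<partial>L) = \<dots>" .
  have "real b * (\<integral>x. (\<Sum>a\<le>rem n. Bernstein (rem n) a x * (real (s1 + a) * (real (s1 + a) - 1))) \<partial>L)
     = t * (real s1 - 1) + 2 * real s1 * m * (real b * I1) + m * (m - 1) * (real b * I2)"
    unfolding E by (simp add: t_def algebra_simps)
  also have "\<dots> \<le> rho * (t * (t - 1)) + rho * (2 * t * m) + rho * (m * (m - 1))"
  proof (intro add_mono)
    have "t * (real s1 - 1) \<le> (rho * real b) * (t * (real s1 - 1))"
    proof (cases "s1 = 0")
      case False
      hence "0 \<le> t * (real s1 - 1)" by (simp add: t_def)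
      thus ?thesis using mult_right_mono[OF r] by simp
    qed (simp add: t_def)
    also have "\<dots> = rho * (t * (t - real b))" by (simp add: t_def algebra_simps)
    also have "\<dots> \<le> rho * (t * (t - 1))"
      using rho_pos b_ge by (intro mult_left_mono) (auto simp: t_def)
    finally show "t * (real s1 - 1) \<le> rho * (t * (t - 1))" .
    have "2 * real s1 * m * (real b * I1) = 2 * real s1 * m * 1" by (simp only: bI)
    also have "\<dots> \<le> 2 * real s1 * m * (rho * real b)"
      by (intro mult_left_mono r) (simp add: m_def)
    finally show "2 * real s1 * m * (real b * I1) \<le> rho * (2 * t * m)" by (simp add: t_def mult_ac)
    have "0 \<le> m * (m - 1)" by (cases "rem n") (auto simp: m_def)
    from mult_left_mono[OF I2 this]
    show "m * (m - 1) * (real b * I2) \<le> rho * (m * (m - 1))" by (simp add: mult_ac)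
  qed
  also have "\<dots> = rho * ((t + m) * (t + m - 1))" by (simp add: algebra_simps)
  also have "\<dots> \<le> rho * (real n * (real n - 1))"
  proof (rule mult_left_mono)
    have n1: "real n \<ge> 1" using n by simp
    have tm: "0 \<le> t + m" "t + m \<le> real n" using n_eq by (auto simp: t_def m_def)
    have "(t + m) * (t + m - 1) \<le> (t + m) * (real n - 1)" using tm by (intro mult_left_mono) auto
    also have "\<dots> \<le> real n * (real n - 1)" using tm n1 by (intro mult_right_mono) auto
    finally show "(t + m) * (t + m - 1) \<le> real n * (real n - 1)" .
  qed (use rho_pos in simp)
  finally show ?thesis .
qed

lemma kernel_T: "(\<lambda>\<omega>. measure_spmf (T \<omega> n)) \<in> env \<rightarrow>\<^sub>M subprob_algebra (count_space UNIV)"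
  by (rule measurable_insert_balls) (rule measurable_env)

lemma measurable_T_nn: "(\<lambda>\<omega>. \<integral>\<^sup>+c. g c \<partial>measure_spmf (T \<omega> n)) \<in> borel_measurable env"
  by (rule measurable_compose[OF kernel_T nn_integral_measurable_subprob_algebra]) simp

lemma measurable_loss: "(\<lambda>\<omega>. ennreal (pmf (T \<omega> n) None)) \<in> borel_measurable env"
proof -
  have "ennreal (pmf p None) = 1 - (\<integral>\<^sup>+c. 1 \<partial>measure_spmf p)" for p :: "config spmf"
    unfolding pmf_None_eq_weight_spmf
    by (simp add: measure_spmf.emeasure_eq_measure ennreal_minus[OF weight_spmf_nonneg, symmetric])
  thus ?thesis using measurable_T_nn[where g="\<lambda>_. 1" and n=n] by simp
qed

text \<open>Trees with at most \<open>s\<close> balls never fail, and for larger ones n(n - 1)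
  exceeds the trivial bound 1. Every level gained multiplies the bound by \<open>rho\<close>, so
  letting \<open>J\<close> grow leaves no loss.\<close>

lemma expected_loss_le: "(\<integral>\<^sup>+\<omega>. pmf (T \<omega> n) None \<partial>env) \<le> ennreal (rho ^ J * (real n * (real n - 1)))"
proof (induction J arbitrary: n)
  case 0
  show ?case
  proof (cases "n \<le> s")
    case True
    thus ?thesis by (simp add: T_small)
  next
    case False
    hence n: "real n \<ge> 2" using s_pos by simp
    have "(\<integral>\<^sup>+\<omega>. pmf (T \<omega> n) None \<partial>env) \<le> (\<integral>\<^sup>+\<omega>. 1 \<partial>env)"
      by (intro nn_integral_mono) (simp add: pmf_le_1)
    also have "\<dots> = ennreal 1" by (simp add: env.emeasure_space_1)
    also have "1 \<le> real n * (real n - 1)" using mult_mono[of 1 "real n" 1 "real n - 1"] n by simp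
    finally show ?thesis using ennreal_leI by (simp add: order_trans)
  qed
next
  case (Suc J)
  show ?case
  proof (cases "n \<le> s")
    case True
    thus ?thesis by (simp add: T_small)
  next
    case False
    hence n: "n > s" by simp
    let ?z = "\<lambda>n. \<integral>\<^sup>+\<omega>. pmf (T \<omega> n) None \<partial>env"
    let ?h = "\<lambda>a. real (s1 + a) * (real (s1 + a) - 1)"
    have h: "?h a \<ge> 0" for a by (cases "s1 + a") auto
    have "?z n \<le> (\<integral>\<^sup>+\<omega>. (\<integral>\<^sup>+ cs. (\<Sum>i<b. ennreal (pmf (T (sub \<omega> i) (s1 + count_list cs i)) None))
        \<partial>replicate_pmf (rem n) (child_pmf b (\<omega> []))) \<partial>env)"
      by (intro nn_integral_mono loss_T n)
    also have "\<dots> = (\<integral>\<^sup>+\<omega>. 0 + (\<Sum>i<b. \<integral>\<^sup>+a. ennreal (pmf (T (sub \<omega> i) (s1 + a)) None)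
        \<partial>binomial_pmf (rem n) (pmf (child_pmf b (\<omega> [])) i)) \<partial>env)"
      by (rule nn_integral_cong, subst nn_integral_sum, simp, unfold add_0_left, rule sum.cong[OF refl],
          rule nn_integral_count_list)
    also have "\<dots> = 0 + of_nat b * (\<integral>\<^sup>+x. (\<Sum>a\<le>rem n. ennreal (Bernstein (rem n) a x) * ?z (s1 + a)) \<partial>L)"
      by (rule anneal_binomial) (simp_all add: measurable_loss)
    also have "\<dots> = of_nat b * (\<integral>\<^sup>+x. (\<Sum>a\<le>rem n. ennreal (Bernstein (rem n) a x) * ?z (s1 + a)) \<partial>L)" by simp
    also have "\<dots> \<le> of_nat b * (\<integral>\<^sup>+x. (\<Sum>a\<le>rem n. ennreal (Bernstein (rem n) a x) * ennreal (rho ^ J * ?h a)) \<partial>L)"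
      by (intro mult_left_mono nn_integral_mono sum_mono Suc.IH) auto
    also have "\<dots> = ennreal (real b) * ennreal (\<integral>x. (\<Sum>a\<le>rem n. Bernstein (rem n) a x * (rho ^ J * ?h a)) \<partial>L)"
      using h rho_pos by (subst nn_integral_Bernstein) (auto simp: ennreal_of_nat_eq_real_of_nat)
    also have "\<dots> = ennreal (rho ^ J * (real b * (\<integral>x. (\<Sum>a\<le>rem n. Bernstein (rem n) a x * ?h a) \<partial>L)))"
      by (simp add: ennreal_mult'[symmetric] sum_distrib_left[symmetric] mult.left_commute[of _ "rho ^ J"])
    also have "\<dots> \<le> ennreal (rho ^ Suc J * (real n * (real n - 1)))"
      using mult_left_mono[OF factorial_moment_split[OF n], of "rho ^ J"] rho_pos
      by (intro ennreal_leI) (simp add: mult_ac)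
    finally show ?thesis .
  qed
qed

lemma AE_lossless: "AE \<omega> in env. \<forall>n. lossless_spmf (T \<omega> n)"
proof (subst AE_all_countable, rule allI)
  fix n
  have "(\<lambda>J. rho ^ J * (real n * (real n - 1))) \<longlonglongrightarrow> 0 * (real n * (real n - 1))"
    using rho_pos rho_less_1 by (intro tendsto_mult LIMSEQ_realpow_zero tendsto_const) auto
  hence "(\<lambda>J. ennreal (rho ^ J * (real n * (real n - 1)))) \<longlonglongrightarrow> ennreal 0"
    by (intro tendsto_ennrealI) simp
  from LIMSEQ_le_const[OF this] have "(\<integral>\<^sup>+\<omega>. pmf (T \<omega> n) None \<partial>env) \<le> ennreal 0"
    using expected_loss_le by blast
  hence "(\<integral>\<^sup>+\<omega>. pmf (T \<omega> n) None \<partial>env) = 0" by simp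
  hence "AE \<omega> in env. ennreal (pmf (T \<omega> n) None) = 0"
    by (subst (asm) nn_integral_0_iff_AE) (auto simp: measurable_loss)
  thus "AE \<omega> in env. lossless_spmf (T \<omega> n)"
    by eventually_elim (simp add: lossless_iff_pmf_None ennreal_eq_0_iff)
qed

lemma AE_lossless_sub: "AE \<omega> in env. \<forall>i<b. \<forall>n. lossless_spmf (T (sub \<omega> i) n)"
proof (rule AE_mp[OF _ AE_I2])
  have "AE \<omega> in env. \<forall>n. lossless_spmf (T (sub \<omega> i) n)" for i
    by (rule AE_distrD[OF measurable_sub, where P="\<lambda>\<omega>. \<forall>n. lossless_spmf (T \<omega> n)"])
       (simp only: distr_sub AE_lossless)
  thus "AE \<omega> in env. \<forall>i. \<forall>n. lossless_spmf (T (sub \<omega> i) n)" by (subst AE_all_countable) simp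
qed simp


section \<open>Exponential moments of the depths\<close>

lemma nn_integral_T_small:
  assumes "n \<le> s"
  shows "(\<integral>\<^sup>+c. g c \<partial>measure_spmf (T \<omega> n)) = g (\<lambda>j. if j < n then Some [] else None)"
  by (simp add: T_small[OF assms] spmf_of_pmf_return_pmf[symmetric] del: spmf_of_pmf_return_pmf)

lemma first_moment_split:
  assumes n: "n > s"
  shows "real b * (\<integral>x. (\<Sum>a\<le>rem n. Bernstein (rem n) a x * real (s1 + a)) \<partial>L) = real n - real s0"
proof -
  have le: "s0 + b * s1 \<le> n" using n s1_le s0_le by simp
  have "(\<integral>x. (\<Sum>a\<le>rem n. Bernstein (rem n) a x * real (s1 + a)) \<partial>L) = (\<integral>x. real s1 + real (rem n) * x \<partial>L)"
    by (rule Bochner_Integration.integral_cong[OF refl]) (simp only: of_nat_add Bernstein_moment1)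
  also have "\<dots> = real s1 + real (rem n) * (\<integral>x. x \<partial>L)"
    using integrable_x by (simp add: L.prob_space)
  finally have "real b * (\<integral>x. (\<Sum>a\<le>rem n. Bernstein (rem n) a x * real (s1 + a)) \<partial>L)
     = real b * real s1 + real (rem n) * (real b * (\<integral>x. x \<partial>L))" by (simp add: algebra_simps)
  thus ?thesis unfolding L_size_bias using le by (simp add: rem_def of_nat_diff)
qed

text \<open>Truncating depths at \<open>J\<close> permits induction on \<open>J\<close> with a bound
  free of \<open>J\<close>. One level multiplies the sum by \<open>q\<close> and the pair count by
  \<open>rho\<close>. The bound n + A n(n - 1) reproduces itself when A = (q - 1) + q
  \<open>rho\<close> A, because n <= n(n - 1) for n >= 2 lets the surplus (q - 1) n be charged to
  pairs.\<close>

lemma exponential_path_length: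
  assumes q: "q \<ge> 1" "q * rho < 1"
  defines "A \<equiv> (q - 1) / (1 - q * rho)"
  shows "(\<integral>\<^sup>+\<omega>. \<integral>\<^sup>+c. (\<Sum>j<n. ennreal (q ^ min (ball_depth c j) J)) \<partial>measure_spmf (T \<omega> n) \<partial>env)
     \<le> ennreal (real n + A * (real n * (real n - 1)))"
proof -
  have A: "A \<ge> 0" using q by (simp add: A_def)
  have nn: "real n * (real n - 1) \<ge> 0" for n by (cases n) auto
  have small: "(\<integral>\<^sup>+\<omega>. \<integral>\<^sup>+c. (\<Sum>j<n. ennreal (q ^ min (ball_depth c j) J)) \<partial>measure_spmf (T \<omega> n) \<partial>env)
     \<le> ennreal (real n + A * (real n * (real n - 1)))" if "n \<le> s" for n J
  proof -
    have "(\<integral>\<^sup>+\<omega>. \<integral>\<^sup>+c. (\<Sum>j<n. ennreal (q ^ min (ball_depth c j) J)) \<partial>measure_spmf (T \<omega> n) \<partial>env) = ennreal (real n)"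
      by (simp add: nn_integral_T_small[OF that] ball_depth_def env.emeasure_space_1 ennreal_of_nat_eq_real_of_nat)
    also have "\<dots> \<le> ennreal (real n + A * (real n * (real n - 1)))"
      using A nn by (intro ennreal_leI) simp
    finally show "(\<integral>\<^sup>+\<omega>. \<integral>\<^sup>+c. (\<Sum>j<n. ennreal (q ^ min (ball_depth c j) J)) \<partial>measure_spmf (T \<omega> n) \<partial>env)
     \<le> ennreal (real n + A * (real n * (real n - 1)))" .
  qed
  show ?thesis
  proof (induction J arbitrary: n)
    case 0
    have "(\<integral>\<^sup>+\<omega>. \<integral>\<^sup>+c. (\<Sum>j<n. ennreal (q ^ min (ball_depth c j) 0)) \<partial>measure_spmf (T \<omega> n) \<partial>env) \<le>
      (\<integral>\<^sup>+\<omega>. ennreal (real n) * 1 \<partial>env)"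
      by (rule nn_integral_mono)
         (simp add: ennreal_of_nat_eq_real_of_nat, rule mult_left_le, auto intro: measure_spmf.subprob_emeasure_le_1)
    also have "\<dots> = ennreal (real n)" by (simp add: env.emeasure_space_1)
    also have "\<dots> \<le> ennreal (real n + A * (real n * (real n - 1)))"
      using A nn by (intro ennreal_leI) simp
    finally show ?case .
  next
    case (Suc J)
    show ?case
    proof (cases "n \<le> s")
      case True
      thus ?thesis by (rule small)
    next
      case False
      hence n: "n > s" by simp
      let ?F = "\<lambda>m. \<integral>\<^sup>+\<omega>. \<integral>\<^sup>+c. (\<Sum>j<m. ennreal (q ^ min (ball_depth c j) J)) \<partial>measure_spmf (T \<omega> m) \<partial>env"
      let ?u = "\<lambda>a \<omega>. \<integral>\<^sup>+ c. (\<Sum>k<s1 + a. ennreal (q ^ min (Suc (ball_depth c k)) (Suc J))) \<partial>measure_spmf (T \<omega> (s1 + a))"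
      let ?h = "\<lambda>a. real (s1 + a) + A * (real (s1 + a) * (real (s1 + a) - 1))"
      have h: "?h a \<ge> 0" for a using A nn[of "s1 + a"] by simp
      have u: "(\<integral>\<^sup>+\<omega>. ?u a \<omega> \<partial>env) = ennreal q * ?F (s1 + a)" for a
        using q by (simp add: ennreal_mult nn_integral_cmult measurable_T_nn flip: sum_distrib_left)
      have "(\<integral>\<^sup>+\<omega>. \<integral>\<^sup>+c. (\<Sum>j<n. ennreal (q ^ min (ball_depth c j) (Suc J))) \<partial>measure_spmf (T \<omega> n) \<partial>env) =
        (\<integral>\<^sup>+\<omega>. of_nat s0 + (\<Sum>i<b. \<integral>\<^sup>+a. ?u a (sub \<omega> i) \<partial>binomial_pmf (rem n) (pmf (child_pmf b (\<omega> [])) i)) \<partial>env)"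
      proof (rule nn_integral_cong_AE, rule AE_mp[OF AE_lossless_sub], intro AE_I2 impI)
        fix \<omega> :: "nat list \<Rightarrow> nat \<Rightarrow> real"
        assume "\<forall>i<b. \<forall>n. lossless_spmf (T (sub \<omega> i) n)"
        thus "(\<integral>\<^sup>+c. (\<Sum>j<n. ennreal (q ^ min (ball_depth c j) (Suc J))) \<partial>measure_spmf (T \<omega> n)) =
          of_nat s0 + (\<Sum>i<b. \<integral>\<^sup>+a. ?u a (sub \<omega> i) \<partial>binomial_pmf (rem n) (pmf (child_pmf b (\<omega> [])) i))"
          by (subst path_length_T[OF n, where f="\<lambda>d. ennreal (q ^ min d (Suc J))"]) simp_all
      qed
      also have "\<dots> = of_nat s0 + of_nat b * (\<integral>\<^sup>+x. (\<Sum>a\<le>rem n. ennreal (Bernstein (rem n) a x) * (\<integral>\<^sup>+\<omega>. ?u a \<omega> \<partial>env)) \<partial>L)"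
        by (rule anneal_binomial) (rule measurable_T_nn)
      also have "\<dots> \<le> of_nat s0 + of_nat b * (\<integral>\<^sup>+x. (\<Sum>a\<le>rem n. ennreal (Bernstein (rem n) a x) * ennreal (q * ?h a)) \<partial>L)"
      proof -
        have "ennreal q * ?F (s1 + a) \<le> ennreal (q * ?h a)" for a
          using q h ennreal_mult[of q "?h a"] mult_left_mono[OF Suc.IH[of "s1 + a"], of "ennreal q"] by simp
        thus ?thesis unfolding u
          by (intro add_left_mono mult_left_mono nn_integral_mono sum_mono) auto
      qed
      also have "\<dots> = ennreal (real s0 + q * (real b * (\<integral>x. (\<Sum>a\<le>rem n. Bernstein (rem n) a x * ?h a) \<partial>L)))"
      proof -
        have "0 \<le> (\<integral>x. (\<Sum>a\<le>rem n. Bernstein (rem n) a x * ?h a) \<partial>L)"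
          by (rule integral_nonneg_AE, rule AE_mp[OF AE_L], rule AE_I2, rule impI, rule sum_nonneg,
              rule mult_nonneg_nonneg[OF Bernstein_nonneg h]) simp_all
        moreover have "(\<integral>x. (\<Sum>a\<le>rem n. Bernstein (rem n) a x * (q * ?h a)) \<partial>L) =
          q * (\<integral>x. (\<Sum>a\<le>rem n. Bernstein (rem n) a x * ?h a) \<partial>L)"
          unfolding mult.left_commute[of _ q] sum_distrib_left[symmetric] by (rule integral_mult_right_zero)
        ultimately show ?thesis using q h
          by (subst nn_integral_Bernstein) (auto simp: ennreal_of_nat_eq_real_of_nat ennreal_mult'[symmetric] mult_ac)
      qed
      also have "(\<integral>x. (\<Sum>a\<le>rem n. Bernstein (rem n) a x * ?h a) \<partial>L) =
         (\<integral>x. (\<Sum>a\<le>rem n. Bernstein (rem n) a x * real (s1 + a)) \<partial>L) +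
         A * (\<integral>x. (\<Sum>a\<le>rem n. Bernstein (rem n) a x * (real (s1 + a) * (real (s1 + a) - 1))) \<partial>L)"
      proof -
        have "(\<Sum>a\<le>rem n. Bernstein (rem n) a x * ?h a) = (\<Sum>a\<le>rem n. Bernstein (rem n) a x * real (s1 + a)) +
          A * (\<Sum>a\<le>rem n. Bernstein (rem n) a x * (real (s1 + a) * (real (s1 + a) - 1)))" for x
          unfolding sum_distrib_left sum.distrib[symmetric] by (rule sum.cong) (auto simp: algebra_simps)
        moreover have "integrable L (\<lambda>x. \<Sum>a\<le>rem n. Bernstein (rem n) a x * real (s1 + a))"
          "integrable L (\<lambda>x. A * (\<Sum>a\<le>rem n. Bernstein (rem n) a x * (real (s1 + a) * (real (s1 + a) - 1))))"
          using integrable_Bernstein by (auto intro!: Bochner_Integration.integrable_sum integrable_mult_left integrable_mult_right)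
        ultimately show ?thesis by (simp only: Bochner_Integration.integral_add integral_mult_right_zero)
      qed
      also have "ennreal (real s0 + q * (real b * \<dots>)) \<le> ennreal (real n + A * (real n * (real n - 1)))"
      proof (rule ennreal_leI)
        let ?I1 = "\<integral>x. (\<Sum>a\<le>rem n. Bernstein (rem n) a x * real (s1 + a)) \<partial>L"
        let ?I2 = "\<integral>x. (\<Sum>a\<le>rem n. Bernstein (rem n) a x * (real (s1 + a) * (real (s1 + a) - 1))) \<partial>L"
        define N where "N = real n * (real n - 1)"
        have n2: "real n \<ge> 2" using n s_pos by simp
        have "real n \<le> N" using mult_left_mono[of 1 "real n - 1" "real n"] n2 by (simp add: N_def)
        have Aq: "A * (1 - q * rho) = q - 1" using q by (simp add: A_def)
        have "real s0 + q * (real b * (?I1 + A * ?I2)) = real s0 + q * (real b * ?I1) + q * A * (real b * ?I2)"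
          by (simp add: algebra_simps)
        also have "\<dots> \<le> real s0 + q * (real n - real s0) + q * A * (rho * N)"
          unfolding first_moment_split[OF n] N_def using A q
          by (intro add_left_mono mult_left_mono factorial_moment_split n) simp_all
        also have "\<dots> \<le> real n + (q - 1) * real n + q * A * (rho * N)"
          using q mult_right_mono[of 1 q "real s0"] by (simp add: algebra_simps)
        also have "\<dots> \<le> real n + (q - 1) * N + q * A * (rho * N)"
          using \<open>real n \<le> N\<close> q by (intro add_right_mono add_left_mono mult_left_mono) auto
        also have "\<dots> = real n + A * N" unfolding Aq[symmetric] by (simp add: algebra_simps)
        finally show "real s0 + q * (real b * (?I1 + A * ?I2)) \<le> real n + A * (real n * (real n - 1))"
          unfolding N_def .
      qed
      finally show ?thesis .
    qed
  qed
qed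

text \<open>The masses add up to 1 because insertion terminates almost surely; otherwise \<open>embed_pmf\<close> would be junk.\<close>

definition depth_pmf :: "nat \<Rightarrow> nat \<Rightarrow> nat pmf" where
  "depth_pmf n k = embed_pmf (\<lambda>d. enn2real (\<integral>\<^sup>+\<omega>. \<integral>\<^sup>+c. indicator {d} (ball_depth c (k - 1)) \<partial>measure_spmf (T \<omega> n) \<partial>env))"

lemma nn_integral_depth_pmf:
  fixes f :: "nat \<Rightarrow> ennreal"
  shows "(\<integral>\<^sup>+d. f d \<partial>depth_pmf n k) = (\<integral>\<^sup>+\<omega>. \<integral>\<^sup>+c. f (ball_depth c (k - 1)) \<partial>measure_spmf (T \<omega> n) \<partial>env)"
proof -
  define p where "p d = (\<integral>\<^sup>+\<omega>. \<integral>\<^sup>+c. indicator {d} (ball_depth c (k - 1)) \<partial>measure_spmf (T \<omega> n) \<partial>env)" for d :: nat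
  have suminf: "(\<Sum>d. p d * f d) = (\<integral>\<^sup>+\<omega>. \<integral>\<^sup>+c. f (ball_depth c (k - 1)) \<partial>measure_spmf (T \<omega> n) \<partial>env)"
    for f :: "nat \<Rightarrow> ennreal"
  proof -
    have "(\<Sum>d. p d * f d) = (\<Sum>d. \<integral>\<^sup>+\<omega>. \<integral>\<^sup>+c. indicator {d} (ball_depth c (k - 1)) * f d \<partial>measure_spmf (T \<omega> n) \<partial>env)"
      unfolding p_def by (simp add: nn_integral_multc measurable_T_nn)
    also have "\<dots> = (\<integral>\<^sup>+\<omega>. (\<Sum>d. \<integral>\<^sup>+c. indicator {d} (ball_depth c (k - 1)) * f d \<partial>measure_spmf (T \<omega> n)) \<partial>env)"
      by (rule nn_integral_suminf[symmetric]) (rule measurable_T_nn)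
    also have "\<dots> = (\<integral>\<^sup>+\<omega>. \<integral>\<^sup>+c. (\<Sum>d. indicator {d} (ball_depth c (k - 1)) * f d) \<partial>measure_spmf (T \<omega> n) \<partial>env)"
      by (simp add: nn_integral_suminf)
    also have "\<dots> = (\<integral>\<^sup>+\<omega>. \<integral>\<^sup>+c. f (ball_depth c (k - 1)) \<partial>measure_spmf (T \<omega> n) \<partial>env)"
    proof -
      have "(\<Sum>d. indicator {d} x * f d) = f x" for x :: nat
        by (subst suminf_finite[of "{x}"]) (auto simp: indicator_def)
      thus ?thesis by simp
    qed
    finally show ?thesis .
  qed
  have total: "(\<Sum>d. p d) = 1"
  proof -
    have "(\<Sum>d. p d) = (\<integral>\<^sup>+\<omega>. \<integral>\<^sup>+c. 1 \<partial>measure_spmf (T \<omega> n) \<partial>env)"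
      using suminf[of "\<lambda>_. 1"] by simp
    also have "\<dots> = (\<integral>\<^sup>+\<omega>. 1 \<partial>env)"
      using AE_lossless by (intro nn_integral_cong_AE, eventually_elim) (rule nn_integral_const_lossless, blast)
    finally show ?thesis by (simp add: env.emeasure_space_1)
  qed
  have fin: "p d < \<top>" for d
  proof -
    have "p d \<le> (\<Sum>d. p d)" using sum_le_suminf[of p "{d}"] by simp
    thus ?thesis unfolding total by (simp add: le_less_trans)
  qed
  have pmf: "ennreal (pmf (depth_pmf n k) d) = p d" for d
    unfolding depth_pmf_def p_def[symmetric] 
    by (subst pmf_embed_pmf) (use fin in \<open>auto simp: nn_integral_count_space_nat total\<close>)
  have "(\<integral>\<^sup>+d. f d \<partial>depth_pmf n k) = (\<Sum>d. p d * f d)"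
    by (simp add: nn_integral_measure_pmf nn_integral_count_space_nat pmf)
  thus ?thesis unfolding suminf .
qed

lemma depth_pmf_recursion:
  fixes f :: "nat \<Rightarrow> ennreal"
  assumes "s < j" "j < n"
  shows "(\<integral>\<^sup>+d. f d \<partial>depth_pmf n (Suc j)) =
    of_nat b * (\<integral>\<^sup>+x. (\<Sum>a\<le>rem j. \<Sum>d\<le>n - Suc j.
        ennreal (x * Bernstein (rem j) a x * Bernstein (n - Suc j) d x) *
        (\<integral>\<^sup>+d'. f (Suc d') \<partial>depth_pmf (s1 + a + Suc d) (Suc (s1 + a)))) \<partial>L)"
proof -
  have "(\<integral>\<^sup>+d. f d \<partial>depth_pmf n (Suc j)) = (\<integral>\<^sup>+\<omega>. \<integral>\<^sup>+ i. \<integral>\<^sup>+ a. \<integral>\<^sup>+ d. (\<integral>\<^sup>+ c. f (Suc (ball_depth c (s1 + a))) \<partial>measure_spmf (T (sub \<omega> i) (s1 + a + Suc d)))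
        \<partial>binomial_pmf (n - Suc j) (pmf (child_pmf b (\<omega> [])) i)
        \<partial>binomial_pmf (rem j) (pmf (child_pmf b (\<omega> [])) i)
        \<partial>child_pmf b (\<omega> []) \<partial>env)"
    unfolding nn_integral_depth_pmf diff_Suc_1
    by (rule nn_integral_cong_AE, rule AE_mp[OF AE_lossless_sub], intro AE_I2 impI)
       (rule single_ball_T[OF assms], blast)
  also have "\<dots> = of_nat b * (\<integral>\<^sup>+x. (\<Sum>a\<le>rem j. \<Sum>d\<le>n - Suc j.
        ennreal (x * Bernstein (rem j) a x * Bernstein (n - Suc j) d x) *
        (\<integral>\<^sup>+\<omega>. \<integral>\<^sup>+ c. f (Suc (ball_depth c (s1 + a))) \<partial>measure_spmf (T \<omega> (s1 + a + Suc d)) \<partial>env)) \<partial>L)"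
    by (rule anneal_single) (rule measurable_T_nn)
  finally show ?thesis unfolding nn_integral_depth_pmf diff_Suc_1 .
qed

text \<open>A single depth is bounded by the sum over all balls, and monotone convergence removes
  the truncation. The wasted factor n is harmless, since later only the logarithm of this bound
  counts.\<close>

lemma exponential_moment_depth_pmf:
  assumes q: "q \<ge> 1" "q * rho < 1" and k: "1 \<le> k" "k \<le> n"
  shows "(\<integral>\<^sup>+d. ennreal (q ^ d) \<partial>depth_pmf n k) \<le> ennreal (real n + (q - 1) / (1 - q * rho) * (real n * (real n - 1)))"
proof -
  have "(\<integral>\<^sup>+d. ennreal (q ^ d) \<partial>depth_pmf n k) = (\<integral>\<^sup>+d. (SUP J. ennreal (q ^ min d J)) \<partial>depth_pmf n k)"
  proof (rule nn_integral_cong)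
    fix d
    show "ennreal (q ^ d) = (SUP J. ennreal (q ^ min d J))"
    proof (rule antisym)
      show "ennreal (q ^ d) \<le> (SUP J. ennreal (q ^ min d J))" by (rule SUP_upper2[of d]) auto
      show "(SUP J. ennreal (q ^ min d J)) \<le> ennreal (q ^ d)"
        using q by (intro SUP_least ennreal_leI power_increasing) auto
    qed
  qed
  also have "\<dots> = (SUP J. \<integral>\<^sup>+d. ennreal (q ^ min d J) \<partial>depth_pmf n k)"
    using q by (intro nn_integral_monotone_convergence_SUP)
       (auto simp: incseq_def le_fun_def intro!: ennreal_leI power_increasing)
  also have "\<dots> \<le> ennreal (real n + (q - 1) / (1 - q * rho) * (real n * (real n - 1)))"
  proof (rule SUP_least)
    fix J
    have "(\<integral>\<^sup>+d. ennreal (q ^ min d J) \<partial>depth_pmf n k) \<le>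
       (\<integral>\<^sup>+\<omega>. \<integral>\<^sup>+c. (\<Sum>j<n. ennreal (q ^ min (ball_depth c j) J)) \<partial>measure_spmf (T \<omega> n) \<partial>env)"
      unfolding nn_integral_depth_pmf using k
      by (intro nn_integral_mono member_le_sum[of "k - 1" "{..<n}" "\<lambda>j. ennreal (q ^ min (ball_depth _ j) J)"]) auto
    also note exponential_path_length[OF q, of n J]
    finally show "(\<integral>\<^sup>+d. ennreal (q ^ min d J) \<partial>depth_pmf n k) \<le>
      ennreal (real n + (q - 1) / (1 - q * rho) * (real n * (real n - 1)))" .
  qed
  finally show ?thesis .
qed

text \<open>Transfers the integrals of the statement, taken over a bind of measures, to a discrete
  law on the naturals.\<close>

lemma distr_split_law:
  "distr (split_law b s s0 s1 Vlaw n) (count_space UNIV) (\<lambda>c. ball_depth c (k - 1)) = measure_pmf (depth_pmf n k)"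
proof (rule measure_eqI)
  have sets: "sets (split_law b s s0 s1 Vlaw n) = UNIV"
    unfolding split_law_def env_def[symmetric]
    by (subst sets_bind[where N="count_space UNIV"]) (auto simp: space_env)
  fix A :: "nat set"
  have "emeasure (distr (split_law b s s0 s1 Vlaw n) (count_space UNIV) (\<lambda>c. ball_depth c (k - 1))) A =
    emeasure (split_law b s s0 s1 Vlaw n) {c. ball_depth c (k - 1) \<in> A}"
    using sets sets_eq_imp_space_eq[of "split_law b s s0 s1 Vlaw n" "count_space UNIV"]
    by (subst emeasure_distr) (auto simp: measurable_def vimage_def)
  also have "\<dots> = (\<integral>\<^sup>+\<omega>. emeasure (measure_spmf (T \<omega> n)) {c. ball_depth c (k - 1) \<in> A} \<partial>env)"
    unfolding split_law_def env_def[symmetric]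
    by (subst emeasure_bind[OF _ kernel_T]) (auto simp: space_env)
  also have "\<dots> = (\<integral>\<^sup>+\<omega>. \<integral>\<^sup>+c. indicator A (ball_depth c (k - 1)) \<partial>measure_spmf (T \<omega> n) \<partial>env)"
  proof (rule nn_integral_cong)
    fix \<omega>
    have "(\<integral>\<^sup>+c. indicator A (ball_depth c (k - 1)) \<partial>measure_spmf (T \<omega> n)) =
      (\<integral>\<^sup>+c. indicator {c. ball_depth c (k - 1) \<in> A} c \<partial>measure_spmf (T \<omega> n))"
      by (rule nn_integral_cong) (simp add: indicator_def)
    thus "emeasure (measure_spmf (T \<omega> n)) {c. ball_depth c (k - 1) \<in> A} = (\<integral>\<^sup>+c. indicator A (ball_depth c (k - 1)) \<partial>measure_spmf (T \<omega> n))"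
      by simp
  qed
  also have "\<dots> = emeasure (depth_pmf n k) A" unfolding nn_integral_depth_pmf[symmetric] by simp
  finally show "emeasure (distr (split_law b s s0 s1 Vlaw n) (count_space UNIV) (\<lambda>c. ball_depth c (k - 1))) A = emeasure (depth_pmf n k) A" .
qed simp

lemma integral_split_law:
  fixes f :: "nat \<Rightarrow> real"
  shows "(\<integral>c. f (ball_depth c (k - 1)) \<partial>split_law b s s0 s1 Vlaw n) = measure_pmf.expectation (depth_pmf n k) f"
proof -
  have sets: "sets (split_law b s s0 s1 Vlaw n) = UNIV"
    unfolding split_law_def env_def[symmetric]
    by (subst sets_bind[where N="count_space UNIV"]) (auto simp: space_env)
  show ?thesis unfolding distr_split_law[symmetric]
    using sets sets_eq_imp_space_eq[of "split_law b s s0 s1 Vlaw n" "count_space UNIV"]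
    by (subst integral_distr) (auto simp: measurable_def)
qed

lemma depth_eq_ball_depth: "depth c k = real (ball_depth c k)"
  by (simp add: depth_def ball_depth_def split: option.split)

lemma ED_eq: "ED b s s0 s1 Vlaw n k = measure_pmf.expectation (depth_pmf n k) real"
  unfolding ED_def depth_eq_ball_depth by (rule integral_split_law)

lemma VarD_eq: "VarD b s s0 s1 Vlaw n k =
    measure_pmf.expectation (depth_pmf n k) (\<lambda>d. (real d - measure_pmf.expectation (depth_pmf n k) real)\<^sup>2)"
  unfolding VarD_def ED_eq depth_eq_ball_depth by (rule integral_split_law)

end

section \<open>One step of the rank chain\<close>

text \<open>Absorption: (m + 1) C(m, a) / (a + 1) = C(m + 1, a + 1). Multiplied by (m + 1) x, the
  sum is the binomial distribution of m + 1 trials without its mass at 0.\<close>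

lemma Bernstein_inverse_moment:
  assumes x: "0 < x" "x < 1"
  shows "(\<Sum>a\<le>m. Bernstein m a x / (real a + 1)) \<le> 1 / ((real m + 1) * x)"
proof -
  have "(real m + 1) * x * (Bernstein m a x / (real a + 1)) = Bernstein (Suc m) (Suc a) x" for a
  proof -
    have "real (Suc m) * real (m choose a) = real (Suc a) * real (Suc m choose Suc a)"
      using Suc_times_binomial_eq[of m a] by (metis mult.commute of_nat_mult)
    hence e: "(real m + 1) * real (m choose a) / (real a + 1) = real (Suc m choose Suc a)"
      by (simp add: field_simps del: binomial_Suc_Suc)
    have "(real m + 1) * x * (Bernstein m a x / (real a + 1)) =
      ((real m + 1) * real (m choose a) / (real a + 1)) * (x * x ^ a * (1 - x) ^ (m - a))"
      by (simp add: Bernstein_def)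
    also have "\<dots> = Bernstein (Suc m) (Suc a) x" unfolding e by (simp add: Bernstein_def)
    finally show ?thesis .
  qed
  hence "(real m + 1) * x * (\<Sum>a\<le>m. Bernstein m a x / (real a + 1)) = (\<Sum>a\<le>m. Bernstein (Suc m) (Suc a) x)"
    by (simp add: sum_distrib_left)
  also have "\<dots> \<le> (\<Sum>a\<le>Suc m. Bernstein (Suc m) a x)"
    using x by (subst sum.atMost_Suc_shift) (auto intro: Bernstein_nonneg)
  also have "\<dots> = 1" by (rule sum_Bernstein)
  finally have "(\<Sum>a\<le>m. Bernstein m a x / (real a + 1)) * ((real m + 1) * x) \<le> 1"
    by (simp only: mult.commute)
  moreover have "0 < (real m + 1) * x" using x by simp
  ultimately show ?thesis by (simp only: pos_le_divide_eq)
qed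

text \<open>All bounds are linear in y and 1 / y, so that a mean and an inverse moment of a binomial
  control logarithms. The third is u^2 <= exp u + exp (-u) - 2 at u = |ln y|, where two
  differentiations leave exp z + exp (-z) >= 2.\<close>

lemma ln_bounds:
  fixes y :: real assumes "y > 0"
  shows "ln y \<le> y - 1" "- ln y \<le> 1 / y - 1" "(ln y)\<^sup>2 \<le> y + 1 / y - 2"
proof -
  show "ln y \<le> y - 1" using assms by (rule ln_le_minus_one)
  show "- ln y \<le> 1 / y - 1" using ln_le_minus_one[of "1 / y"] assms by (simp add: ln_div)
  have key: "u\<^sup>2 \<le> exp u + exp (-u) - 2" if "u \<ge> 0" for u :: real
  proof -
    define f where "f = (\<lambda>u::real. exp u + exp (-u) - 2 - u\<^sup>2)"
    have "f 0 \<le> f u"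
    proof (rule DERIV_nonneg_imp_nondecreasing[OF that])
      fix x :: real assume x: "0 \<le> x" "x \<le> u"
      define g where "g = (\<lambda>u::real. exp u - exp (-u) - 2 * u)"
      have "g 0 \<le> g x"
      proof (rule DERIV_nonneg_imp_nondecreasing[OF x(1)])
        fix z :: real
        have "(g has_real_derivative exp z + exp (-z) - 2) (at z)"
          unfolding g_def by (auto intro!: derivative_eq_intros)
        moreover have "exp z + exp (-z) - 2 \<ge> 0"
        proof -
          have "0 \<le> (exp (z/2) - exp (-z/2))\<^sup>2" by simp
          also have "\<dots> = exp z + exp (-z) - 2"
            by (simp add: power2_diff exp_double[symmetric] exp_minus_inverse exp_add[symmetric] mult.assoc)
          finally show ?thesis .
        qed
        ultimately show "\<exists>y. (g has_real_derivative y) (at z) \<and> 0 \<le> y" by blast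
      qed
      hence "exp x - exp (-x) - 2 * x \<ge> 0" by (simp add: g_def)
      moreover have "(f has_real_derivative exp x - exp (-x) - 2 * x) (at x)"
        unfolding f_def by (auto intro!: derivative_eq_intros)
      ultimately show "\<exists>y. (f has_real_derivative y) (at x) \<and> 0 \<le> y" by blast
    qed
    thus ?thesis by (simp add: f_def)
  qed
  have "(ln y)\<^sup>2 = \<bar>ln y\<bar>\<^sup>2" by simp
  also have "\<dots> \<le> exp \<bar>ln y\<bar> + exp (-\<bar>ln y\<bar>) - 2" by (rule key) simp
  also have "\<dots> = y + 1 / y - 2" using assms by (cases "ln y \<ge> 0") (simp_all add: exp_minus inverse_eq_divide)
  finally show "(ln y)\<^sup>2 \<le> y + 1 / y - 2" .
qed

text \<open>Concavity: the derivative 2 (1 + ln x) / x decreases for x >= 1. The added 1 achieves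
  this, as (ln x)^2 itself is convex up to e. The tangent later serves as Jensen's inequality for
  the ratio n / k.\<close>

lemma log_squared_tangent:
  fixes x x0 :: real assumes "x \<ge> 1" "x0 \<ge> 1"
  shows "(1 + ln x)\<^sup>2 \<le> (1 + ln x0)\<^sup>2 + 2 * (1 + ln x0) / x0 * (x - x0)"
proof -
  define f where "f = (\<lambda>x::real. (1 + ln x0)\<^sup>2 + 2 * (1 + ln x0) / x0 * (x - x0) - (1 + ln x)\<^sup>2)"
  have der: "(f has_real_derivative 2 * (1 + ln x0) / x0 - 2 * (1 + ln z) / z) (at z)" if "z \<ge> 1" for z
    unfolding f_def using that assms by (auto intro!: derivative_eq_intros)
  have anti: "(1 + ln v) / v \<le> (1 + ln u) / u" if "1 \<le> u" "u \<le> v" for u v :: real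
  proof -
    have "((\<lambda>z. - ((1 + ln z) / z)) has_real_derivative ln z / z\<^sup>2) (at z)" if "z \<ge> 1" for z :: real
      using that by (auto intro!: derivative_eq_intros simp: field_simps power2_eq_square)
    hence "- ((1 + ln u) / u) \<le> - ((1 + ln v) / v)"
      using that by (intro DERIV_nonneg_imp_nondecreasing[OF that(2), where f="\<lambda>z. - ((1 + ln z) / z)"])
        (meson divide_nonneg_nonneg ln_ge_zero order_trans zero_le_power2)
    thus ?thesis by simp
  qed
  have "f x0 \<le> f x"
  proof (cases "x0 \<le> x")
    case True
    show ?thesis
    proof (rule DERIV_nonneg_imp_nondecreasing[OF True])
      fix z assume z: "x0 \<le> z" "z \<le> x"
      have "2 * ((1 + ln z) / z) \<le> 2 * ((1 + ln x0) / x0)"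
        by (rule mult_left_mono[OF anti]) (use assms z in auto)
      hence "0 \<le> 2 * (1 + ln x0) / x0 - 2 * (1 + ln z) / z" by (simp only: times_divide_eq_right diff_ge_0_iff_ge)
      thus "\<exists>y. (f has_real_derivative y) (at z) \<and> 0 \<le> y"
        using der[of z] assms z by (meson order_trans)
    qed
  next
    case False
    hence "x \<le> x0" by simp
    show ?thesis
    proof (rule DERIV_nonpos_imp_nonincreasing[OF \<open>x \<le> x0\<close>])
      fix z assume z: "x \<le> z" "z \<le> x0"
      have "2 * ((1 + ln x0) / x0) \<le> 2 * ((1 + ln z) / z)"
        by (rule mult_left_mono[OF anti]) (use assms z in auto)
      hence "2 * (1 + ln x0) / x0 - 2 * (1 + ln z) / z \<le> 0" by (simp only: times_divide_eq_right diff_le_0_iff_le)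
      thus "\<exists>y. (f has_real_derivative y) (at z) \<and> y \<le> 0"
        using der[of z] assms z by (meson order_trans)
    qed
  qed
  thus ?thesis by (simp add: f_def)
qed

section \<open>The step law of the rank chain\<close>

context split_tree begin

definition num_fixed :: nat where "num_fixed = s0 + b * s1"

text \<open>Joint mass of \<open>a\<close> earlier and \<open>d\<close> later companions in the
  child entered: two binomials with the same proportion, mixed over the size-biased law.\<close>

definition weight :: "nat \<Rightarrow> nat \<Rightarrow> nat \<times> nat \<Rightarrow> real" where
  "weight m m' = (\<lambda>(a, d). if a \<le> m \<and> d \<le> m' then real b * (\<integral>x. x * Bernstein m a x * Bernstein m' d x \<partial>L) else 0)"

lemma integrable_weight: "integrable L (\<lambda>x. x * Bernstein m a x * Bernstein m' d x)"
proof (rule integrable_L_bounded[where B=1])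
  fix x :: real assume x: "0 < x" "x < 1"
  have "\<bar>x\<bar> * \<bar>Bernstein m a x\<bar> * \<bar>Bernstein m' d x\<bar> \<le> 1 * 1 * 1"
    using x by (intro mult_mono) (auto intro!: Bernstein_le_1 simp: Bernstein_nonneg)
  thus "\<bar>x * Bernstein m a x * Bernstein m' d x\<bar> \<le> 1" by (simp add: abs_mult)
qed measurable

lemma weight_nonneg: "0 \<le> weight m m' z"
proof -
  have "0 \<le> (\<integral>x. x * Bernstein m a x * Bernstein m' d x \<partial>L)" for a d
    by (rule integral_nonneg_AE, rule AE_mp[OF AE_L], rule AE_I2) (auto intro!: mult_nonneg_nonneg Bernstein_nonneg)
  thus ?thesis by (auto simp: weight_def split: prod.split)
qed

lemma sum_weight:
  fixes F :: "nat \<Rightarrow> nat \<Rightarrow> real"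
  shows "(\<Sum>a\<le>m. \<Sum>d\<le>m'. weight m m' (a, d) * F a d) =
     real b * (\<integral>x. x * (\<Sum>a\<le>m. \<Sum>d\<le>m'. Bernstein m a x * Bernstein m' d x * F a d) \<partial>L)"
proof -
  have "(\<integral>x. x * (\<Sum>a\<le>m. \<Sum>d\<le>m'. Bernstein m a x * Bernstein m' d x * F a d) \<partial>L) =
     (\<integral>x. (\<Sum>a\<le>m. \<Sum>d\<le>m'. (x * Bernstein m a x * Bernstein m' d x) * F a d) \<partial>L)"
    by (simp add: sum_distrib_left mult_ac)
  also have "\<dots> = (\<Sum>a\<le>m. \<Sum>d\<le>m'. (\<integral>x. x * Bernstein m a x * Bernstein m' d x \<partial>L) * F a d)"
    by (simp add: integrable_weight)
  finally show ?thesis by (simp add: weight_def sum_distrib_left mult_ac)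
qed

lemma weight_total: "(\<Sum>a\<le>m. \<Sum>d\<le>m'. weight m m' (a, d)) = 1"
  using sum_weight[of m m' "\<lambda>_ _. 1"]
  by (simp add: sum_product[symmetric] sum_Bernstein L_size_bias)

definition step_pmf :: "nat \<Rightarrow> nat \<Rightarrow> (nat \<times> nat) pmf" where
  "step_pmf m m' = embed_pmf (weight m m')"

lemma pmf_step_pmf: "pmf (step_pmf m m') = weight m m'"
proof -
  have "(\<integral>\<^sup>+z. ennreal (weight m m' z) \<partial>count_space UNIV) = (\<Sum>z\<in>{..m} \<times> {..m'}. ennreal (weight m m' z))"
    by (rule nn_integral_count_space') (auto simp: weight_def split: if_splits)
  also have "\<dots> = ennreal (\<Sum>z\<in>{..m} \<times> {..m'}. weight m m' z)"
    by (rule sum_ennreal) (rule weight_nonneg)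
  also have "(\<Sum>z\<in>{..m} \<times> {..m'}. weight m m' z) = (\<Sum>a\<le>m. \<Sum>d\<le>m'. weight m m' (a, d))"
    by (simp add: sum.cartesian_product)
  also note weight_total
  finally show ?thesis unfolding step_pmf_def by (intro ext pmf_embed_pmf weight_nonneg) simp
qed

lemma set_step_pmf: "set_pmf (step_pmf m m') \<subseteq> {..m} \<times> {..m'}"
  by (auto simp: set_pmf_eq pmf_step_pmf weight_def split: if_splits)

lemma expectation_step_pmf:
  fixes F :: "nat \<times> nat \<Rightarrow> real"
  shows "measure_pmf.expectation (step_pmf m m') F =
     real b * (\<integral>x. x * (\<Sum>a\<le>m. \<Sum>d\<le>m'. Bernstein m a x * Bernstein m' d x * F (a, d)) \<partial>L)"
proof -
  have "measure_pmf.expectation (step_pmf m m') F = (\<Sum>z\<in>{..m} \<times> {..m'}. F z * weight m m' z)"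
    using set_step_pmf[of m m'] by (subst integral_measure_pmf_real[of "{..m} \<times> {..m'}"]) (auto simp: pmf_step_pmf)
  also have "\<dots> = (\<Sum>a\<le>m. \<Sum>d\<le>m'. weight m m' (a, d) * F (a, d))"
    by (simp add: sum.cartesian_product mult.commute)
  finally show ?thesis unfolding sum_weight[of m m' "\<lambda>a d. F (a, d)"] .
qed

text \<open>Rank of the followed ball and number of balls in the subtree of the child it enters.\<close>

definition step :: "nat \<Rightarrow> nat \<Rightarrow> (nat \<times> nat) pmf" where
  "step k n = map_pmf (\<lambda>(a, d). (Suc (s1 + a), Suc (s1 + a + d))) (step_pmf (rem (k - 1)) (n - k))"

lemma finite_set_step: "finite (set_pmf (step k n))"
  using finite_subset[OF set_step_pmf] by (auto simp: step_def)

lemma set_step: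
  assumes "s + 1 < k" "k \<le> n" "(k', n') \<in> set_pmf (step k n)"
  shows "1 \<le> k'" "k' \<le> k" "k' \<le> n'" "n' \<le> n"
proof -
  from assms(3) obtain a d where a: "a \<le> rem (k - 1)" "d \<le> n - k" "k' = Suc (s1 + a)" "n' = Suc (s1 + a + d)"
    using set_step_pmf by (fastforce simp: step_def)
  have "s1 \<le> t \<Longrightarrow> s0 + t \<le> s + 1 \<Longrightarrow> s1 + (k - 1 - (s0 + t)) + 1 \<le> k" for t
    using assms(1) by linarith
  moreover have "s1 \<le> b * s1" using b_ge by simp
  moreover have "s0 + b * s1 \<le> s + 1" using s1_le s0_le by linarith
  ultimately have "s1 + rem (k - 1) + 1 \<le> k" unfolding rem_def by blast
  thus "1 \<le> k'" "k' \<le> k" "k' \<le> n'" "n' \<le> n" using a assms by auto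
qed

text \<open>The averaged recursion read as a Markov step: below the child there is a fresh tree with
  a fresh environment. In 1-based ranks \<open>s + 1 < k\<close> says that the ball comes after the
  split.\<close>

lemma depth_pmf_step:
  assumes "s + 1 < k" "k \<le> n"
  shows "depth_pmf n k = bind_pmf (step k n) (\<lambda>(k', n'). map_pmf Suc (depth_pmf n' k'))"
proof (rule pmf_eqI)
  fix d0
  define j where "j = k - 1"
  have j: "k = Suc j" "s < j" "j < n" using assms by (auto simp: j_def)
  let ?m = "rem j" and ?m' = "n - Suc j"
  let ?f = "indicator {d0} :: nat \<Rightarrow> ennreal"
  let ?G = "\<lambda>a d. \<integral>\<^sup>+d'. ?f (Suc d') \<partial>depth_pmf (s1 + a + Suc d) (Suc (s1 + a))"
  have "ennreal (pmf (depth_pmf n k) d0) = (\<integral>\<^sup>+d. ?f d \<partial>depth_pmf n (Suc j))"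
    by (simp add: j emeasure_pmf_single)
  also have "\<dots> = of_nat b * (\<integral>\<^sup>+x. (\<Sum>a\<le>?m. \<Sum>d\<le>?m'. ennreal (x * Bernstein ?m a x * Bernstein ?m' d x) * ?G a d) \<partial>L)"
    by (rule depth_pmf_recursion[OF j(2,3)])
  also have "\<dots> = (\<Sum>a\<le>?m. \<Sum>d\<le>?m'. of_nat b * (\<integral>\<^sup>+x. ennreal (x * Bernstein ?m a x * Bernstein ?m' d x) \<partial>L) * ?G a d)"
  proof -
    have [measurable]: "(\<lambda>x. ennreal (x * Bernstein ?m a x * Bernstein ?m' d x)) \<in> borel_measurable L" for a d
      by (subst measurable_cong_sets[OF sets_L refl]) measurable
    show ?thesis by (simp add: nn_integral_sum nn_integral_multc sum_distrib_left mult.assoc)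
  qed
  also have "\<dots> = (\<Sum>a\<le>?m. \<Sum>d\<le>?m'. ennreal (weight ?m ?m' (a, d)) * ?G a d)"
  proof (intro sum.cong refl)
    fix a d assume "a \<in> {..?m}" "d \<in> {..?m'}"
    moreover have "(\<integral>\<^sup>+x. ennreal (x * Bernstein ?m a x * Bernstein ?m' d x) \<partial>L) =
        ennreal (\<integral>x. x * Bernstein ?m a x * Bernstein ?m' d x \<partial>L)"
      by (rule nn_integral_eq_integral[OF integrable_weight], rule AE_mp[OF AE_L], rule AE_I2)
         (auto intro!: mult_nonneg_nonneg Bernstein_nonneg)
    ultimately show "of_nat b * (\<integral>\<^sup>+x. ennreal (x * Bernstein ?m a x * Bernstein ?m' d x) \<partial>L) * ?G a d =
       ennreal (weight ?m ?m' (a, d)) * ?G a d"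
      by (simp add: weight_def ennreal_of_nat_eq_real_of_nat ennreal_mult')
  qed
  also have "\<dots> = (\<Sum>z\<in>{..?m} \<times> {..?m'}. (case z of (a, d) \<Rightarrow> ?G a d) * ennreal (pmf (step_pmf ?m ?m') z))"
    by (simp add: sum.cartesian_product pmf_step_pmf mult.commute case_prod_beta)
  also have "\<dots> = (\<integral>\<^sup>+z. (case z of (a, d) \<Rightarrow> ?G a d) \<partial>step_pmf ?m ?m')"
    by (rule nn_integral_measure_pmf_support[symmetric]) (use set_step_pmf in auto)
  also have "\<dots> = (\<integral>\<^sup>+z. ?f z \<partial>bind_pmf (step k n) (\<lambda>(k', n'). map_pmf Suc (depth_pmf n' k')))"
    by (simp add: step_def j case_prod_beta nn_integral_bind_pmf)
  also have "\<dots> = ennreal (pmf (bind_pmf (step k n) (\<lambda>(k', n'). map_pmf Suc (depth_pmf n' k'))) d0)"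
    by (simp add: emeasure_pmf_single ennreal_pmf_bind)
  finally show "pmf (depth_pmf n k) d0 = pmf (bind_pmf (step k n) (\<lambda>(k', n'). map_pmf Suc (depth_pmf n' k'))) d0"
    by simp
qed


lemma rem_Suc: "s + 1 < k \<Longrightarrow> real (rem (k - 1)) + 1 = real k - real num_fixed"
proof -
  assume k: "s + 1 < k"
  have "num_fixed \<le> s + 1" using s1_le s0_le unfolding num_fixed_def by linarith
  hence "rem (k - 1) + 1 + num_fixed = k" using k unfolding rem_def num_fixed_def[symmetric] by linarith
  thus ?thesis by linarith
qed

text \<open>Conditional mean of \<open>F\<close> after one step, given that the child has proportion
  \<open>x\<close>. The size bias stays outside as the factor \<open>x\<close>, which cancels
  singularities 1 / x in the estimates below.\<close>

definition inner :: "nat \<Rightarrow> nat \<Rightarrow> (nat \<times> nat \<Rightarrow> real) \<Rightarrow> real \<Rightarrow> real" where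
  "inner k n F x = (\<Sum>a\<le>rem (k - 1). \<Sum>d\<le>n - k. Bernstein (rem (k - 1)) a x * Bernstein (n - k) d x *
      F (Suc (s1 + a), Suc (s1 + a + d)))"

lemma expectation_step:
  fixes F :: "nat \<times> nat \<Rightarrow> real"
  shows "measure_pmf.expectation (step k n) F = real b * (\<integral>x. x * inner k n F x \<partial>L)"
  unfolding step_def inner_def by (simp add: expectation_step_pmf case_prod_beta)

lemma integrable_inner: "integrable L (\<lambda>x. x * inner k n F x)"
proof -
  have "integrable L (\<lambda>x. \<Sum>a\<le>rem (k - 1). \<Sum>d\<le>n - k.
      (x * Bernstein (rem (k - 1)) a x * Bernstein (n - k) d x) * F (Suc (s1 + a), Suc (s1 + a + d)))"
    using integrable_weight by (intro Bochner_Integration.integrable_sum integrable_mult_left)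
  thus ?thesis unfolding inner_def by (simp add: sum_distrib_left mult_ac)
qed

lemma step_le:
  assumes "integrable L \<phi>" "\<And>x. 0 < x \<Longrightarrow> x < 1 \<Longrightarrow> x * inner k n F x \<le> \<phi> x"
  shows "measure_pmf.expectation (step k n) F \<le> real b * (\<integral>x. \<phi> x \<partial>L)"
  unfolding expectation_step
proof (rule mult_left_mono)
  show "(\<integral>x. x * inner k n F x \<partial>L) \<le> (\<integral>x. \<phi> x \<partial>L)"
    by (rule integral_mono_AE[OF integrable_inner assms(1)], rule AE_mp[OF AE_L], rule AE_I2) (simp add: assms(2))
qed simp

lemma step_ge:
  assumes "integrable L \<phi>" "\<And>x. 0 < x \<Longrightarrow> x < 1 \<Longrightarrow> \<phi> x \<le> x * inner k n F x"
  shows "real b * (\<integral>x. \<phi> x \<partial>L) \<le> measure_pmf.expectation (step k n) F"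
  unfolding expectation_step
proof (rule mult_left_mono)
  show "(\<integral>x. \<phi> x \<partial>L) \<le> (\<integral>x. x * inner k n F x \<partial>L)"
    by (rule integral_mono_AE[OF assms(1) integrable_inner], rule AE_mp[OF AE_L], rule AE_I2) (simp add: assms(2))
qed simp

lemma inner_fst: "inner k n (\<lambda>(k', n'). f k') x = (\<Sum>a\<le>rem (k - 1). Bernstein (rem (k - 1)) a x * f (Suc (s1 + a)))"
  unfolding inner_def
  by (simp add: sum_distrib_left[symmetric] sum_distrib_right[symmetric] sum_Bernstein mult_ac
      mult.assoc[of "Bernstein (rem (k - 1)) _ x"] flip: sum_distrib_left)

lemma inner_mono:
  assumes "0 < x" "x < 1" "\<And>a. a \<le> rem (k - 1) \<Longrightarrow> f (Suc (s1 + a)) \<le> g (Suc (s1 + a))"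
  shows "(\<Sum>a\<le>rem (k - 1). Bernstein (rem (k - 1)) a x * f (Suc (s1 + a)))
     \<le> (\<Sum>a\<le>rem (k - 1). Bernstein (rem (k - 1)) a x * g (Suc (s1 + a)) :: real)"
  using assms by (intro sum_mono mult_left_mono Bernstein_nonneg) auto

text \<open>The next three lemmas compare a binomial rank \<open>1 + s1 + a\<close> with its approximation \<open>k x\<close>
  through the ratio \<open>y\<close> of the two, of which both \<open>y\<close> and \<open>1 / y\<close> have explicit moments.\<close>

lemma ratio_moment:
  assumes "s + 1 < k" "0 < x" "x < 1"
  shows "(\<Sum>a\<le>rem (k - 1). Bernstein (rem (k - 1)) a x * (real (Suc (s1 + a)) / (real k * x))) \<le>
     1 + (1 + real s1) / (real k * x)"
proof -
  have "(\<Sum>a\<le>rem (k - 1). Bernstein (rem (k - 1)) a x * (real (Suc (s1 + a)) / (real k * x))) =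
      (\<Sum>a\<le>rem (k - 1). Bernstein (rem (k - 1)) a x * ((1 + real s1) + real a)) / (real k * x)"
    by (simp add: sum_divide_distrib add_ac)
  also have "\<dots> = ((1 + real s1) + real (rem (k - 1)) * x) / (real k * x)"
    unfolding Bernstein_moment1 ..
  also have "\<dots> \<le> ((1 + real s1) + real k * x) / (real k * x)"
    using assms by (intro divide_right_mono add_left_mono mult_right_mono) (auto simp: rem_def)
  also have "\<dots> = 1 + (1 + real s1) / (real k * x)"
    using assms by (simp add: field_simps)
  finally show ?thesis .
qed

lemma inverse_ratio_moment:
  assumes "s + 1 < k" "0 < x" "x < 1" "real num_fixed < real k"
  shows "(\<Sum>a\<le>rem (k - 1). Bernstein (rem (k - 1)) a x * (1 / real (Suc (s1 + a)))) \<le> 1 / ((real k - real num_fixed) * x)"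
proof -
  have "(\<Sum>a\<le>rem (k - 1). Bernstein (rem (k - 1)) a x * (1 / real (Suc (s1 + a)))) \<le>
     (\<Sum>a\<le>rem (k - 1). Bernstein (rem (k - 1)) a x * (1 / (real a + 1)))"
    using assms by (intro sum_mono mult_left_mono Bernstein_nonneg divide_left_mono) auto
  also have "\<dots> \<le> 1 / ((real (rem (k - 1)) + 1) * x)"
    using Bernstein_inverse_moment[OF assms(2,3)] by simp
  finally show ?thesis unfolding rem_Suc[OF assms(1)] .
qed

section \<open>Mean and second moment of the logarithmic step\<close>

definition mu where "mu = - (real b * (\<integral>x. x * ln x \<partial>L))"
text \<open>Variance of ln under the size-biased law, whose mean is -\<open>mu\<close>;
  \<open>sigma2_eq\<close> gives the form used in the statement.\<close>

definition sigma2 where "sigma2 = real b * (\<integral>x. x * (ln x + mu)\<^sup>2 \<partial>L)"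
text \<open>Numerator of the O(1 / k) errors: b (1 + s1) comes from the shift of the rank by 1 + s1,
  and 2 \<open>num_fixed\<close> from the excess of k / (k - \<open>num_fixed\<close>) over 1 once k
  > 2 \<open>num_fixed\<close>.\<close>

definition log_const where "log_const = real b * (1 + real s1) + 2 * real num_fixed"

lemma log_const_nonneg: "0 \<le> log_const" by (simp add: log_const_def)

lemma integrable_x_ln: "integrable L (\<lambda>x. x * ln x)"
proof (rule integrable_L_bounded[where B=1])
  fix x :: real assume x: "0 < x" "x < 1"
  have "- ln x \<le> 1 / x - 1" by (rule ln_bounds(2)) (rule x)
  hence "x * (- ln x) \<le> x * (1 / x - 1)" using x by (intro mult_left_mono) auto
  also have "\<dots> = 1 - x" using x by (simp add: field_simps)
  also have "\<dots> \<le> 1" using x by simp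
  finally have "- (x * ln x) \<le> 1" by simp
  moreover have "x * ln x \<le> 0" using x by (simp add: mult_nonneg_nonpos)
  ultimately show "\<bar>x * ln x\<bar> \<le> 1" by simp
qed simp

lemma integrable_x_ln2: "integrable L (\<lambda>x. x * (ln x)\<^sup>2)"
proof (rule integrable_L_bounded[where B=2])
  fix x :: real assume x: "0 < x" "x < 1"
  have "x * (ln x)\<^sup>2 \<le> x * (x + 1 / x - 2)" using x ln_bounds(3)[of x] by (intro mult_left_mono) auto
  also have "\<dots> = x\<^sup>2 + 1 - 2 * x" using x by (simp add: field_simps power2_eq_square)
  also have "\<dots> \<le> 2" using x power_le_one[of x 2] by simp
  finally show "\<bar>x * (ln x)\<^sup>2\<bar> \<le> 2" using x by simp
qed simp

lemma integrable_x_A: "integrable L (\<lambda>x. x * (ln x + mu)\<^sup>2)"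
proof -
  have "(\<lambda>x. x * (ln x + mu)\<^sup>2) = (\<lambda>x. x * (ln x)\<^sup>2 + 2 * mu * (x * ln x) + mu\<^sup>2 * x)"
    by (auto simp: power2_eq_square algebra_simps)
  thus ?thesis using integrable_x integrable_x_ln integrable_x_ln2 by simp
qed

lemma mu_pos: "mu > 0"
proof -
  have "(\<integral>x. x * ln x \<partial>L) < (\<integral>x. 0 \<partial>L)"
  proof (rule L.integral_less_AE_space[OF integrable_x_ln])
    show "AE x in L. x * ln x < 0" using AE_L by eventually_elim (simp add: mult_pos_neg)
    show "emeasure L (space L) \<noteq> 0" by (simp add: L.emeasure_space_1)
  qed simp
  thus ?thesis using b_ge by (simp add: mu_def mult_pos_neg)
qed

lemma sigma2_nonneg: "sigma2 \<ge> 0"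
  unfolding sigma2_def
  by (rule mult_nonneg_nonneg, simp, rule integral_nonneg_AE, rule AE_mp[OF AE_L], rule AE_I2) simp

lemma sigma2_eq: "sigma2 = real b * (\<integral>x. x * (ln x)\<^sup>2 \<partial>L) - mu\<^sup>2"
proof -
  have "(\<integral>x. x * (ln x + mu)\<^sup>2 \<partial>L) = (\<integral>x. x * (ln x)\<^sup>2 + 2 * mu * (x * ln x) + mu\<^sup>2 * x \<partial>L)"
    by (rule Bochner_Integration.integral_cong[OF refl]) (simp add: power2_eq_square algebra_simps)
  also have "\<dots> = (\<integral>x. x * (ln x)\<^sup>2 \<partial>L) + 2 * mu * (\<integral>x. x * ln x \<partial>L) + mu\<^sup>2 * (\<integral>x. x \<partial>L)"
    using integrable_x integrable_x_ln integrable_x_ln2 by simp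
  finally have "sigma2 = real b * (\<integral>x. x * (ln x)\<^sup>2 \<partial>L) + 2 * mu * (real b * (\<integral>x. x * ln x \<partial>L)) + mu\<^sup>2 * (real b * (\<integral>x. x \<partial>L))"
    by (simp add: sigma2_def algebra_simps)
  moreover have "real b * (\<integral>x. x * ln x \<partial>L) = - mu" by (simp add: mu_def)
  ultimately show ?thesis unfolding L_size_bias by (simp add: power2_eq_square)
qed

text \<open>Bound for the mean of y + 1 / y - 2 under the step law, where y is the new rank over k
  x: the first term comes from y - 1, the second from 1 / y - 1.\<close>

definition delta where "delta k = (real b * (1 + real s1)) / real k + real num_fixed / (real k - real num_fixed)"

lemma delta_le: "s + 1 < k \<Longrightarrow> 2 * num_fixed < k \<Longrightarrow> 0 \<le> delta k \<and> delta k \<le> log_const / real k"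
proof -
  assume k: "s + 1 < k" "2 * num_fixed < k"
  have "real (2 * num_fixed) < real k" using k(2) by (simp only: of_nat_less_iff)
  hence c: "2 * real num_fixed < real k" by simp
  have "real num_fixed * real k \<le> 2 * real num_fixed * (real k - real num_fixed)"
  proof -
    have "real k \<le> 2 * (real k - real num_fixed)" using c by simp
    from mult_left_mono[OF this, of "real num_fixed"] show ?thesis by (simp add: algebra_simps)
  qed
  hence "real num_fixed / (real k - real num_fixed) \<le> 2 * real num_fixed / real k" using c k by (simp add: divide_simps)
  moreover have "0 \<le> real num_fixed / (real k - real num_fixed)" 
  proof (rule divide_nonneg_nonneg)
    have c0: "0 \<le> real num_fixed" by (rule of_nat_0_le_iff)
    show "0 \<le> real num_fixed" by (rule c0)
    show "0 \<le> real k - real num_fixed" using c c0 by linarith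
  qed
  ultimately show ?thesis by (simp add: delta_def log_const_def add_divide_distrib)
qed

lemma step_log_mean:
  assumes k: "s + 1 < k" "2 * num_fixed < k" "k \<le> n"
  shows "\<bar>measure_pmf.expectation (step k n) (\<lambda>(k', n'). ln (real k')) - ln (real k) + mu\<bar> \<le> log_const / real k"
proof -
  let ?m = "rem (k - 1)"
  let ?B = "\<lambda>a x. Bernstein ?m a x"
  have "num_fixed < k" using k(2) by linarith
  hence ck: "real num_fixed < real k" by (simp only: of_nat_less_iff)
  have kk: "k > 0" "real k > 0" using k by auto
  \<comment> \<open>With y the ratio of the new rank to k x, the two linear bounds on ln y give the
    upper and the lower estimate; the weight x of the size bias cancels the factor 1 / x in the
    upper error.\<close>
  have y: "ln (real (Suc (s1 + a))) = ln (real (Suc (s1 + a)) / (real k * x)) + (ln (real k) + ln x)" if "x > 0" for a x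
    using that kk by (simp add: ln_div ln_mult)
  have split: "(\<Sum>a\<le>?m. ?B a x * (g a + c)) = (\<Sum>a\<le>?m. ?B a x * g a) + c" for x g c
    by (simp add: distrib_left sum.distrib sum_distrib_right[symmetric] sum_Bernstein)
  have up: "x * inner k n (\<lambda>(k', n'). ln (real k')) x \<le> (1 + real s1) / real k + (x * ln (real k) + x * ln x)"
    if x: "0 < x" "x < 1" for x
  proof -
    have "inner k n (\<lambda>(k', n'). ln (real k')) x \<le> (\<Sum>a\<le>?m. ?B a x * ((real (Suc (s1 + a)) / (real k * x) - 1) + (ln (real k) + ln x)))"
      unfolding inner_fst by (rule inner_mono[OF x], unfold y[OF x(1)], intro add_right_mono ln_bounds(1)) (use x kk in simp)
    also have "\<dots> = (\<Sum>a\<le>?m. ?B a x * (real (Suc (s1 + a)) / (real k * x) + (ln (real k) + ln x - 1)))"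
      by (simp add: algebra_simps)
    also have "\<dots> \<le> 1 + (1 + real s1) / (real k * x) + (ln (real k) + ln x - 1)"
      unfolding split by (rule add_right_mono) (rule ratio_moment[OF k(1) x])
    finally have "x * inner k n (\<lambda>(k', n'). ln (real k')) x \<le> x * ((1 + real s1) / (real k * x) + (ln (real k) + ln x))"
      using x by (intro mult_left_mono) auto
    also have "\<dots> = x * ((1 + real s1) / (real k * x)) + x * (ln (real k) + ln x)" by (rule distrib_left)
    also have "x * ((1 + real s1) / (real k * x)) = (1 + real s1) / real k" using x by simp
    also have "x * (ln (real k) + ln x) = x * ln (real k) + x * ln x" by (rule distrib_left)
    finally show ?thesis .
  qed
  have lo: "x * (- (real num_fixed / (real k - real num_fixed))) + (x * ln (real k) + x * ln x) \<le> x * inner k n (\<lambda>(k', n'). ln (real k')) x"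
    if x: "0 < x" "x < 1" for x
  proof -
    have "(\<Sum>a\<le>?m. ?B a x * (- (real k * x) * (1 / real (Suc (s1 + a))) + (1 + ln (real k) + ln x))) \<le> inner k n (\<lambda>(k', n'). ln (real k')) x"
      unfolding inner_fst
    proof (rule inner_mono[OF x, of _ "\<lambda>z. - (real k * x) * (1 / real z) + (1 + ln (real k) + ln x)"])
      fix a
      have "- ln (real (Suc (s1 + a)) / (real k * x)) \<le> 1 / (real (Suc (s1 + a)) / (real k * x)) - 1"
        by (rule ln_bounds(2)) (use x kk in simp)
      thus "- (real k * x) * (1 / real (Suc (s1 + a))) + (1 + ln (real k) + ln x) \<le> ln (real (Suc (s1 + a)))"
        unfolding y[OF x(1)] by simp
    qed
    also have "(\<Sum>a\<le>?m. ?B a x * (- (real k * x) * (1 / real (Suc (s1 + a))) + (1 + ln (real k) + ln x))) =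
        - ((real k * x) * (\<Sum>a\<le>?m. ?B a x * (1 / real (Suc (s1 + a))))) + (1 + ln (real k) + ln x)"
      unfolding split by (simp add: sum_distrib_left sum_negf[symmetric] mult_ac)
    finally have lower: "- ((real k * x) * (\<Sum>a\<le>?m. ?B a x * (1 / real (Suc (s1 + a))))) + (1 + ln (real k) + ln x)
        \<le> inner k n (\<lambda>(k', n'). ln (real k')) x" .
    have "(real k * x) * (\<Sum>a\<le>?m. ?B a x * (1 / real (Suc (s1 + a)))) \<le> (real k * x) * (1 / ((real k - real num_fixed) * x))"
      using x kk by (intro mult_left_mono inverse_ratio_moment[OF k(1) x ck]) auto
    also have "\<dots> = 1 + real num_fixed / (real k - real num_fixed)"
      using x ck by (simp add: field_simps)
    finally have "- (real num_fixed / (real k - real num_fixed)) + (ln (real k) + ln x) \<le>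
        - ((real k * x) * (\<Sum>a\<le>?m. ?B a x * (1 / real (Suc (s1 + a))))) + (1 + ln (real k) + ln x)" by simp
    from this lower have "- (real num_fixed / (real k - real num_fixed)) + (ln (real k) + ln x) \<le> inner k n (\<lambda>(k', n'). ln (real k')) x"
      by (rule order_trans)
    hence "x * (- (real num_fixed / (real k - real num_fixed)) + (ln (real k) + ln x)) \<le> x * inner k n (\<lambda>(k', n'). ln (real k')) x"
      using x by (intro mult_left_mono) auto
    thus ?thesis by (simp only: distrib_left)
  qed
  have "measure_pmf.expectation (step k n) (\<lambda>(k', n'). ln (real k')) \<le>
      real b * (\<integral>x. (1 + real s1) / real k + (x * ln (real k) + x * ln x) \<partial>L)"
    using integrable_x integrable_x_ln by (intro step_le up) simp_all
  also have "\<dots> = real b * (1 + real s1) / real k + (real b * (\<integral>x. x \<partial>L)) * ln (real k) + real b * (\<integral>x. x * ln x \<partial>L)"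
    using integrable_x integrable_x_ln by (simp add: L.prob_space algebra_simps)
  also have "\<dots> = real b * (1 + real s1) / real k + ln (real k) - mu"
    unfolding L_size_bias by (simp add: mu_def)
  finally have 1: "measure_pmf.expectation (step k n) (\<lambda>(k', n'). ln (real k')) \<le> real b * (1 + real s1) / real k + ln (real k) - mu" .
  have "real b * (\<integral>x. x * (- (real num_fixed / (real k - real num_fixed))) + (x * ln (real k) + x * ln x) \<partial>L) \<le>
      measure_pmf.expectation (step k n) (\<lambda>(k', n'). ln (real k'))"
    using integrable_x integrable_x_ln by (intro step_ge lo) (intro Bochner_Integration.integrable_add integrable_mult_left, simp_all)
  moreover have "real b * (\<integral>x. x * (- (real num_fixed / (real k - real num_fixed))) + (x * ln (real k) + x * ln x) \<partial>L)
      = (real b * (\<integral>x. x \<partial>L)) * (- (real num_fixed / (real k - real num_fixed))) + (real b * (\<integral>x. x \<partial>L)) * ln (real k) + real b * (\<integral>x. x * ln x \<partial>L)"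
    using integrable_x integrable_x_ln by (simp add: algebra_simps del: of_nat_add of_nat_mult)
  ultimately have 2: "- (real num_fixed / (real k - real num_fixed)) + ln (real k) - mu \<le> measure_pmf.expectation (step k n) (\<lambda>(k', n'). ln (real k'))"
    unfolding L_size_bias by (simp add: mu_def)
  have d: "delta k \<le> log_const / real k" using delta_le k by blast
  have "0 \<le> real num_fixed / (real k - real num_fixed)" using ck by (intro divide_nonneg_nonneg) auto
  moreover have "0 \<le> real b * (1 + real s1) / real k" by simp
  ultimately show ?thesis using 1 2 d unfolding delta_def by linarith
qed


text \<open>The centred increment is (ln x + \<open>mu\<close>) + ln y with y near 1. Young's
  inequality with weight \<eta> separates the two squares: the first has mean \<open>sigma2\<close>,
  and (ln y)^2 <= y + 1 / y - 2 has mean at most \<open>delta k\<close>.\<close>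

lemma step_log_square:
  assumes k: "s + 1 < k" "2 * num_fixed < k" "k \<le> n" and \<eta>: "0 < \<eta>" "\<eta> \<le> 1"
  shows "measure_pmf.expectation (step k n) (\<lambda>(k', n'). (mu + ln (real k') - ln (real k))\<^sup>2) \<le>
      (1 + \<eta>) * sigma2 + (1 + 1 / \<eta>) * delta k"
    and "(1 - \<eta>) * sigma2 - 1 / \<eta> * delta k \<le>
      measure_pmf.expectation (step k n) (\<lambda>(k', n'). (mu + ln (real k') - ln (real k))\<^sup>2)"
proof -
  let ?m = "rem (k - 1)"
  let ?B = "\<lambda>a x. Bernstein ?m a x"
  let ?F = "\<lambda>(k' :: nat, n' :: nat). (mu + ln (real k') - ln (real k))\<^sup>2"
  have "num_fixed < k" using k(2) by linarith
  hence ck: "real num_fixed < real k" by (simp only: of_nat_less_iff)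
  have kk: "k > 0" "real k > 0" using k by auto
  define e where "e = real num_fixed / (real k - real num_fixed)"
  define Y where "Y x a = real (Suc (s1 + a)) / (real k * x)" for x a
  have Ypos: "Y x a > 0" if "x > 0" for x a using that kk by (simp add: Y_def)
  have y: "mu + ln (real (Suc (s1 + a))) - ln (real k) = ln (Y x a) + (ln x + mu)" if "x > 0" for a x
    using that kk by (simp add: Y_def ln_div ln_mult)
  have dsum: "x * (\<Sum>a\<le>?m. ?B a x * (Y x a + 1 / Y x a - 2)) \<le> (1 + real s1) / real k + x * e"
    if x: "0 < x" "x < 1" for x
  proof -
    have "(\<Sum>a\<le>?m. ?B a x * (Y x a + 1 / Y x a - 2)) =
       (\<Sum>a\<le>?m. ?B a x * Y x a) + (real k * x) * (\<Sum>a\<le>?m. ?B a x * (1 / real (Suc (s1 + a)))) - 2 * (\<Sum>a\<le>?m. ?B a x)"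
      unfolding sum_distrib_left sum.distrib[symmetric] sum_subtractf[symmetric]
      by (rule sum.cong) (auto simp: Y_def algebra_simps)
    also have "\<dots> \<le> (1 + (1 + real s1) / (real k * x)) + (real k * x) * (1 / ((real k - real num_fixed) * x)) - 2 * 1"
      unfolding sum_Bernstein Y_def using x kk
      by (intro diff_mono add_mono mult_left_mono ratio_moment[OF k(1) x] inverse_ratio_moment[OF k(1) x ck]) auto
    also have "(real k * x) * (1 / ((real k - real num_fixed) * x)) = 1 + e"
      using x ck by (simp add: e_def field_simps)
    finally have "(\<Sum>a\<le>?m. ?B a x * (Y x a + 1 / Y x a - 2)) \<le> (1 + real s1) / (real k * x) + e" by simp
    hence "x * (\<Sum>a\<le>?m. ?B a x * (Y x a + 1 / Y x a - 2)) \<le> x * ((1 + real s1) / (real k * x) + e)"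
      using x by (intro mult_left_mono) auto
    also have "\<dots> = x * ((1 + real s1) / (real k * x)) + x * e" by (rule distrib_left)
    also have "x * ((1 + real s1) / (real k * x)) = (1 + real s1) / real k" using x by simp
    finally show ?thesis .
  qed
  have int: "integrable L (\<lambda>x. (1 + real s1) / real k + x * e)" using integrable_x by simp
  have bint: "real b * (\<integral>x. (1 + real s1) / real k + x * e \<partial>L) = delta k"
  proof -
    have "real b * (\<integral>x. (1 + real s1) / real k + x * e \<partial>L) = real b * (1 + real s1) / real k + (real b * (\<integral>x. x \<partial>L)) * e"
      using integrable_x by (simp add: L.prob_space algebra_simps)
    thus ?thesis unfolding L_size_bias by (simp add: delta_def e_def)
  qed
  have bA: "real b * (\<integral>x. c * (x * (ln x + mu)\<^sup>2) + d * ((1 + real s1) / real k + x * e) \<partial>L) = c * sigma2 + d * delta k" for c d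
    using integrable_x_A int
    by (simp only: Bochner_Integration.integral_add integrable_mult_right integral_mult_right_zero bint[symmetric] sigma2_def)
       (simp add: algebra_simps)
  have iA: "integrable L (\<lambda>x. c * (x * (ln x + mu)\<^sup>2) + d * ((1 + real s1) / real k + x * e))" for c d
    using integrable_x_A int by simp
  have inner_split: "(\<Sum>a\<le>?m. ?B a x * (c + d * g a)) = c + d * (\<Sum>a\<le>?m. ?B a x * g a)" for x c d g
  proof -
    have "(\<Sum>a\<le>?m. ?B a x * (c + d * g a)) = c * (\<Sum>a\<le>?m. ?B a x) + d * (\<Sum>a\<le>?m. ?B a x * g a)"
      unfolding sum_distrib_left sum.distrib[symmetric] by (rule sum.cong) (auto simp: algebra_simps)
    thus ?thesis by (simp add: sum_Bernstein)
  qed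
  have up: "x * inner k n ?F x \<le> (1 + \<eta>) * (x * (ln x + mu)\<^sup>2) + (1 + 1 / \<eta>) * ((1 + real s1) / real k + x * e)"
    if x: "0 < x" "x < 1" for x
  proof -
    have pw: "(ln (Y x a) + (ln x + mu))\<^sup>2 \<le> (1 + \<eta>) * (ln x + mu)\<^sup>2 + (1 + 1 / \<eta>) * (Y x a + 1 / Y x a - 2)" for a
    proof -
      have "0 \<le> (sqrt \<eta> * (ln x + mu) - ln (Y x a) / sqrt \<eta>)\<^sup>2" by simp
      also have "\<dots> = \<eta> * (ln x + mu)\<^sup>2 + (ln (Y x a))\<^sup>2 / \<eta> - 2 * (ln x + mu) * ln (Y x a)"
        using \<eta> by (simp add: power2_diff power_mult_distrib power_divide)
      finally have "(ln (Y x a) + (ln x + mu))\<^sup>2 \<le> (1 + \<eta>) * (ln x + mu)\<^sup>2 + (1 + 1 / \<eta>) * (ln (Y x a))\<^sup>2"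
        by (simp add: power2_sum algebra_simps)
      also have "\<dots> \<le> (1 + \<eta>) * (ln x + mu)\<^sup>2 + (1 + 1 / \<eta>) * (Y x a + 1 / Y x a - 2)"
        using \<eta> by (intro add_left_mono mult_left_mono ln_bounds(3) Ypos x) auto
      finally show ?thesis .
    qed
    have "inner k n ?F x \<le> (\<Sum>a\<le>?m. ?B a x * ((1 + \<eta>) * (ln x + mu)\<^sup>2 + (1 + 1 / \<eta>) * (Y x a + 1 / Y x a - 2)))"
      unfolding inner_fst y[OF x(1)] using x by (intro sum_mono mult_left_mono pw Bernstein_nonneg) auto
    also have "\<dots> = (1 + \<eta>) * (ln x + mu)\<^sup>2 + (1 + 1 / \<eta>) * (\<Sum>a\<le>?m. ?B a x * (Y x a + 1 / Y x a - 2))"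
      by (rule inner_split)
    finally have "x * inner k n ?F x \<le> x * ((1 + \<eta>) * (ln x + mu)\<^sup>2 + (1 + 1 / \<eta>) * (\<Sum>a\<le>?m. ?B a x * (Y x a + 1 / Y x a - 2)))"
      using x by (intro mult_left_mono) auto
    also have "\<dots> = (1 + \<eta>) * (x * (ln x + mu)\<^sup>2) + (1 + 1 / \<eta>) * (x * (\<Sum>a\<le>?m. ?B a x * (Y x a + 1 / Y x a - 2)))"
      by (simp only: algebra_simps)
    also have "\<dots> \<le> (1 + \<eta>) * (x * (ln x + mu)\<^sup>2) + (1 + 1 / \<eta>) * ((1 + real s1) / real k + x * e)"
      using \<eta> by (intro add_left_mono mult_left_mono dsum x) auto
    finally show ?thesis .
  qed
  have lo: "(1 - \<eta>) * (x * (ln x + mu)\<^sup>2) + (- (1 / \<eta>)) * ((1 + real s1) / real k + x * e) \<le> x * inner k n ?F x"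
    if x: "0 < x" "x < 1" for x
  proof -
    have pw: "(1 - \<eta>) * (ln x + mu)\<^sup>2 + (- (1 / \<eta>)) * (Y x a + 1 / Y x a - 2) \<le> (ln (Y x a) + (ln x + mu))\<^sup>2" for a
    proof -
      have "0 \<le> (sqrt \<eta> * (ln x + mu) + ln (Y x a) / sqrt \<eta>)\<^sup>2" by simp
      also have "\<dots> = \<eta> * (ln x + mu)\<^sup>2 + (ln (Y x a))\<^sup>2 / \<eta> + 2 * (ln x + mu) * ln (Y x a)"
        using \<eta> by (simp add: power2_sum power_mult_distrib power_divide)
      finally have nn: "0 \<le> \<eta> * (ln x + mu)\<^sup>2 + (ln (Y x a))\<^sup>2 / \<eta> + 2 * (ln x + mu) * ln (Y x a)" .
      have "(1 - \<eta>) * (ln x + mu)\<^sup>2 - 1 / \<eta> * (ln (Y x a))\<^sup>2 \<le> (ln (Y x a) + (ln x + mu))\<^sup>2"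
      proof -
        have "(ln (Y x a) + (ln x + mu))\<^sup>2 - ((1 - \<eta>) * (ln x + mu)\<^sup>2 - 1 / \<eta> * (ln (Y x a))\<^sup>2) =
          (ln (Y x a))\<^sup>2 + (\<eta> * (ln x + mu)\<^sup>2 + (ln (Y x a))\<^sup>2 / \<eta> + 2 * (ln x + mu) * ln (Y x a))"
          by (simp add: power2_sum algebra_simps)
        thus ?thesis using nn zero_le_power2[of "ln (Y x a)"] by linarith
      qed
      moreover have "1 / \<eta> * (ln (Y x a))\<^sup>2 \<le> 1 / \<eta> * (Y x a + 1 / Y x a - 2)"
        using \<eta> by (intro mult_left_mono ln_bounds(3) Ypos x) auto
      ultimately show ?thesis by linarith
    qed
    have "(1 - \<eta>) * (ln x + mu)\<^sup>2 + (- (1 / \<eta>)) * (\<Sum>a\<le>?m. ?B a x * (Y x a + 1 / Y x a - 2)) =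
       (\<Sum>a\<le>?m. ?B a x * ((1 - \<eta>) * (ln x + mu)\<^sup>2 + (- (1 / \<eta>)) * (Y x a + 1 / Y x a - 2)))"
      by (rule inner_split[symmetric])
    also have "\<dots> \<le> inner k n ?F x"
      unfolding inner_fst y[OF x(1)] using x by (intro sum_mono mult_left_mono pw Bernstein_nonneg) auto
    finally have "x * ((1 - \<eta>) * (ln x + mu)\<^sup>2 + (- (1 / \<eta>)) * (\<Sum>a\<le>?m. ?B a x * (Y x a + 1 / Y x a - 2))) \<le> x * inner k n ?F x"
      using x by (intro mult_left_mono) auto
    hence "(1 - \<eta>) * (x * (ln x + mu)\<^sup>2) + (- (1 / \<eta>)) * (x * (\<Sum>a\<le>?m. ?B a x * (Y x a + 1 / Y x a - 2))) \<le> x * inner k n ?F x"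
      by (simp only: algebra_simps)
    moreover have "(- (1 / \<eta>)) * ((1 + real s1) / real k + x * e) \<le> (- (1 / \<eta>)) * (x * (\<Sum>a\<le>?m. ?B a x * (Y x a + 1 / Y x a - 2)))"
      using \<eta> by (intro mult_left_mono_neg dsum x) auto
    ultimately show ?thesis by linarith
  qed
  show "measure_pmf.expectation (step k n) ?F \<le> (1 + \<eta>) * sigma2 + (1 + 1 / \<eta>) * delta k"
    using step_le[OF iA up] unfolding bA .
  show "(1 - \<eta>) * sigma2 - 1 / \<eta> * delta k \<le> measure_pmf.expectation (step k n) ?F"
    using step_ge[OF iA lo] unfolding bA by simp
qed

lemma step_mean:
  assumes k: "s + 1 < k" "k \<le> n"
  shows "measure_pmf.expectation (step k n) (\<lambda>(k', n'). real k') \<le> 1 + real s1 + rho * real k"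
proof -
  let ?m = "rem (k - 1)"
  have "x * inner k n (\<lambda>(k', n'). real k') x \<le> (1 + real s1) * x + real ?m * x\<^sup>2" for x
  proof -
    have "inner k n (\<lambda>(k', n'). real k') x = (\<Sum>a\<le>?m. Bernstein ?m a x * ((1 + real s1) + real a))"
      unfolding inner_fst by (simp add: add_ac)
    also have "\<dots> = (1 + real s1) + real ?m * x" by (rule Bernstein_moment1)
    finally show ?thesis by (simp add: power2_eq_square algebra_simps)
  qed
  hence "measure_pmf.expectation (step k n) (\<lambda>(k', n'). real k') \<le> real b * (\<integral>x. (1 + real s1) * x + real ?m * x\<^sup>2 \<partial>L)"
    using integrable_x integrable_x2 by (intro step_le) auto
  also have "\<dots> = (1 + real s1) * (real b * (\<integral>x. x \<partial>L)) + real ?m * (real b * (\<integral>x. x\<^sup>2 \<partial>L))"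
    using integrable_x integrable_x2 by (simp add: algebra_simps)
  also have "\<dots> \<le> (1 + real s1) * 1 + real k * rho"
  proof (intro add_mono mult_mono)
    show "real b * (\<integral>x. x\<^sup>2 \<partial>L) \<le> rho" by (simp add: rho_def)
    show "0 \<le> real b * (\<integral>x. x\<^sup>2 \<partial>L)" by simp
  qed (auto simp: L_size_bias rem_def)
  finally show ?thesis by (simp add: mult_ac)
qed

text \<open>Given the new rank k' and the proportion x, the new size has mean k' + (n - k) x, so the
  ratio has mean 1 + (n - k) x E(1 / k') given x. The inverse moment turns this into (n - c) / (k -
  c) with c = \<open>num_fixed\<close>: up to a factor 1 + O(1 / k), the ratio n / k does not grow
  in mean.\<close>

lemma step_ratio:
  assumes k: "s + 1 < k" "2 * num_fixed < k" "k \<le> n"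
  shows "measure_pmf.expectation (step k n) (\<lambda>(k', n'). real n' / real k') \<le> real n / real k * (1 + 2 * real num_fixed / real k)"
proof -
  let ?m = "rem (k - 1)" and ?m' = "n - k"
  have "num_fixed < k" using k(2) by linarith
  hence ck: "real num_fixed < real k" by (simp only: of_nat_less_iff)
  have "real (2 * num_fixed) < real k" using k(2) by (simp only: of_nat_less_iff)
  hence ck2: "2 * real num_fixed < real k" by simp
  have c0: "0 \<le> real num_fixed" by (rule of_nat_0_le_iff)
  have nk: "real ?m' = real n - real k" using k by (simp add: of_nat_diff)
  have "x * inner k n (\<lambda>(k', n'). real n' / real k') x \<le> x * ((real n - real num_fixed) / (real k - real num_fixed))" if x: "0 < x" "x < 1" for x
  proof -
    have "inner k n (\<lambda>(k', n'). real n' / real k') x =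
      (\<Sum>a\<le>?m. \<Sum>d\<le>?m'. Bernstein ?m a x * (1 / real (Suc (s1 + a))) * (Bernstein ?m' d x * (real (Suc (s1 + a)) + real d)))"
      unfolding inner_def by (intro sum.cong refl) (simp add: add_ac)
    also have "\<dots> = (\<Sum>a\<le>?m. Bernstein ?m a x * (1 / real (Suc (s1 + a))) * (real (Suc (s1 + a)) + real ?m' * x))"
      unfolding sum_distrib_left[symmetric] Bernstein_moment1 ..
    also have "\<dots> = (\<Sum>a\<le>?m. Bernstein ?m a x) + real ?m' * x * (\<Sum>a\<le>?m. Bernstein ?m a x * (1 / real (Suc (s1 + a))))"
      unfolding sum_distrib_left sum.distrib[symmetric]
    proof (intro sum.cong refl)
      fix a
      have "Bernstein ?m a x * (1 / real (Suc (s1 + a))) * (real (Suc (s1 + a)) + real ?m' * x) =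
        Bernstein ?m a x * (1 / real (Suc (s1 + a)) * real (Suc (s1 + a))) + real ?m' * x * (Bernstein ?m a x * (1 / real (Suc (s1 + a))))"
        by (simp only: algebra_simps)
      also have "1 / real (Suc (s1 + a)) * real (Suc (s1 + a)) = 1" by (simp del: of_nat_Suc)
      finally show "Bernstein ?m a x * (1 / real (Suc (s1 + a))) * (real (Suc (s1 + a)) + real ?m' * x) =
        Bernstein ?m a x + real ?m' * x * (Bernstein ?m a x * (1 / real (Suc (s1 + a))))" by simp
    qed
    also have "\<dots> \<le> 1 + real ?m' * x * (1 / ((real k - real num_fixed) * x))"
      unfolding sum_Bernstein using x
      by (intro add_left_mono mult_left_mono inverse_ratio_moment[OF k(1) x ck]) auto
    also have "\<dots> = (real n - real num_fixed) / (real k - real num_fixed)"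
      unfolding nk using x ck by (simp add: field_simps)
    finally show ?thesis using x by (intro mult_left_mono) auto
  qed
  hence "measure_pmf.expectation (step k n) (\<lambda>(k', n'). real n' / real k') \<le>
     real b * (\<integral>x. x * ((real n - real num_fixed) / (real k - real num_fixed)) \<partial>L)"
    using integrable_x by (intro step_le integrable_mult_left) auto
  also have "\<dots> = (real b * (\<integral>x. x \<partial>L)) * ((real n - real num_fixed) / (real k - real num_fixed))"
    by simp
  also have "\<dots> = (real n - real num_fixed) / (real k - real num_fixed)" unfolding L_size_bias by simp
  also have "\<dots> \<le> real n / (real k - real num_fixed)"
    using ck c0 by (intro divide_right_mono) linarith+
  also have "\<dots> \<le> real n / real k * (1 + 2 * real num_fixed / real k)"
  proof -
    have "real k * real k \<le> (real k + 2 * real num_fixed) * (real k - real num_fixed)"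
    proof -
      have "(real k + 2 * real num_fixed) * (real k - real num_fixed) = real k * real k + real num_fixed * (real k - 2 * real num_fixed)"
        by (simp only: algebra_simps)
      thus ?thesis using mult_nonneg_nonneg[OF c0, of "real k - 2 * real num_fixed"] ck2 by linarith
    qed
    hence "1 / (real k - real num_fixed) \<le> 1 / real k * (1 + 2 * real num_fixed / real k)"
      using ck c0 by (simp add: divide_simps)
    from mult_left_mono[OF this, of "real n"] show ?thesis by simp
  qed
  finally show ?thesis .
qed

end

section \<open>The rank chain stopped below a threshold\<close>

text \<open>Turns an exponential moment into a second moment: with L the logarithm of the moment
  bound, the exponential term has bounded mean and only L^2 remains.\<close>

lemma square_le_exp:
  fixes u L :: real assumes "0 \<le> u" "0 \<le> L"
  shows "u\<^sup>2 \<le> 2 * L\<^sup>2 + 4 * exp (u - L)"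
proof (cases "u \<le> L")
  case True
  have "u\<^sup>2 \<le> L\<^sup>2" using assms True by (intro power_mono) auto
  moreover have "0 \<le> L\<^sup>2" "0 \<le> exp (u - L)" by simp_all
  ultimately show ?thesis by linarith
next
  case False
  define v where "v = u - L"
  have v: "v \<ge> 0" "u = L + v" using False by (auto simp: v_def)
  have "0 \<le> (L - v)\<^sup>2" by simp
  hence "u\<^sup>2 \<le> 2 * L\<^sup>2 + 2 * v\<^sup>2" unfolding v(2) by (simp add: power2_eq_square algebra_simps)
  moreover have "1 + v + v\<^sup>2 / 2 \<le> exp v" by (rule exp_lower_Taylor_quadratic[OF v(1)])
  ultimately show ?thesis using v(1) unfolding v_def[symmetric] by linarith
qed

lemma abs_le_one_plus_square: "\<bar>x\<bar> \<le> 1 + (x::real)\<^sup>2"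
proof -
  have "0 \<le> (1 - \<bar>x\<bar>)\<^sup>2" by simp
  hence "2 * \<bar>x\<bar> \<le> 1 + x\<^sup>2" by (simp add: power2_diff)
  thus ?thesis by linarith
qed

text \<open>\<open>fst\<close> is the main term and \<open>snd\<close> a residual known only through
  its second moment. The two may be dependent, so the cross term is handled by Young's inequality
  with weight \<eta> and not by orthogonality.\<close>

lemma pmf_square_perturb:
  fixes M :: "(real \<times> real) pmf"
  assumes f: "integrable M fst" "integrable M (\<lambda>w. (fst w)\<^sup>2)"
    and B: "(\<integral>\<^sup>+w. ennreal ((snd w)\<^sup>2) \<partial>M) \<le> ennreal B" "0 \<le> B"
  defines "E \<equiv> measure_pmf.expectation M"
  shows "\<And>\<eta>. 0 < \<eta> \<Longrightarrow> \<eta> \<le> 1 \<Longrightarrow> E (\<lambda>w. (fst w + snd w)\<^sup>2) \<le> (1 + \<eta>) * E (\<lambda>w. (fst w)\<^sup>2) + (1 + 1 / \<eta>) * B"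
    and "\<And>\<eta>. 0 < \<eta> \<Longrightarrow> \<eta> \<le> 1 \<Longrightarrow> (1 - \<eta>) * E (\<lambda>w. (fst w)\<^sup>2) - 1 / \<eta> * B \<le> E (\<lambda>w. (fst w + snd w)\<^sup>2)"
    and "(E (\<lambda>w. fst w + snd w))\<^sup>2 \<le> 2 * (E fst)\<^sup>2 + 2 * B"
proof -
  have r_sq: "integrable M (\<lambda>w. (snd w)\<^sup>2)"
    using B by (intro integrableI_nonneg) (auto simp: top_unique less_top[symmetric])
  have r: "integrable M snd"
    by (rule Bochner_Integration.integrable_bound[of _ "\<lambda>w. 1 + (snd w)\<^sup>2"])
      (use r_sq in \<open>auto intro!: AE_I2 abs_le_one_plus_square\<close>)
  have EB: "E (\<lambda>w. (snd w)\<^sup>2) \<le> B"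
  proof -
    have "ennreal (E (\<lambda>w. (snd w)\<^sup>2)) = (\<integral>\<^sup>+w. ennreal ((snd w)\<^sup>2) \<partial>M)"
      unfolding E_def using r_sq by (intro nn_integral_eq_integral[symmetric]) auto
    thus ?thesis using B by (metis ennreal_le_iff)
  qed
  have two_sq: "(x + y)\<^sup>2 \<le> 2 * x\<^sup>2 + 2 * y\<^sup>2" for x y :: real
    using zero_le_power2[of "x - y"] unfolding power2_sum power2_diff by linarith
  have i2: "integrable M (\<lambda>w. (fst w + snd w)\<^sup>2)"
  proof (rule Bochner_Integration.integrable_bound[of _ "\<lambda>w. 2 * (fst w)\<^sup>2 + 2 * (snd w)\<^sup>2"])
    show "AE w in M. norm ((fst w + snd w)\<^sup>2) \<le> norm (2 * (fst w)\<^sup>2 + 2 * (snd w)\<^sup>2)"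
      using two_sq by (intro AE_I2) simp
  qed (use f r_sq in auto)
  {
    fix \<eta> :: real assume \<eta>: "0 < \<eta>" "\<eta> \<le> 1"
    have cross: "\<bar>2 * x * y\<bar> \<le> \<eta> * x\<^sup>2 + 1 / \<eta> * y\<^sup>2" for x y :: real
    proof -
      have "0 \<le> (\<eta> * x + y)\<^sup>2 / \<eta>" "0 \<le> (\<eta> * x - y)\<^sup>2 / \<eta>" using \<eta> by auto
      moreover have "(\<eta> * x + y)\<^sup>2 / \<eta> = \<eta> * x\<^sup>2 + 1 / \<eta> * y\<^sup>2 + 2 * x * y"
        "(\<eta> * x - y)\<^sup>2 / \<eta> = \<eta> * x\<^sup>2 + 1 / \<eta> * y\<^sup>2 - 2 * x * y"
        using \<eta> by (simp_all add: field_simps power2_eq_square)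
      ultimately show ?thesis by linarith
    qed
    have "E (\<lambda>w. (fst w + snd w)\<^sup>2) \<le> E (\<lambda>w. (1 + \<eta>) * (fst w)\<^sup>2 + (1 + 1 / \<eta>) * (snd w)\<^sup>2)"
      unfolding E_def
    proof (rule integral_mono)
      fix w :: "real \<times> real"
      have "(fst w + snd w)\<^sup>2 = (fst w)\<^sup>2 + (snd w)\<^sup>2 + 2 * fst w * snd w" by (simp add: power2_sum)
      thus "(fst w + snd w)\<^sup>2 \<le> (1 + \<eta>) * (fst w)\<^sup>2 + (1 + 1 / \<eta>) * (snd w)\<^sup>2"
        using cross[of "fst w" "snd w"] unfolding distrib_right by linarith
    qed (use f r_sq i2 in auto)
    also have "\<dots> = (1 + \<eta>) * E (\<lambda>w. (fst w)\<^sup>2) + (1 + 1 / \<eta>) * E (\<lambda>w. (snd w)\<^sup>2)"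
      unfolding E_def using f r_sq by simp
    also have "\<dots> \<le> (1 + \<eta>) * E (\<lambda>w. (fst w)\<^sup>2) + (1 + 1 / \<eta>) * B"
      using EB \<eta> by (intro add_left_mono mult_left_mono) auto
    finally show "E (\<lambda>w. (fst w + snd w)\<^sup>2) \<le> (1 + \<eta>) * E (\<lambda>w. (fst w)\<^sup>2) + (1 + 1 / \<eta>) * B" .
    have "(1 - \<eta>) * E (\<lambda>w. (fst w)\<^sup>2) - 1 / \<eta> * B \<le> (1 - \<eta>) * E (\<lambda>w. (fst w)\<^sup>2) - 1 / \<eta> * E (\<lambda>w. (snd w)\<^sup>2)"
      using EB \<eta> by (intro diff_left_mono mult_left_mono) auto
    also have "\<dots> = E (\<lambda>w. (1 - \<eta>) * (fst w)\<^sup>2 - 1 / \<eta> * (snd w)\<^sup>2)"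
      unfolding E_def using f r_sq by simp
    also have "\<dots> \<le> E (\<lambda>w. (fst w + snd w)\<^sup>2)"
      unfolding E_def
    proof (rule integral_mono)
      fix w :: "real \<times> real"
      have "(fst w + snd w)\<^sup>2 = (fst w)\<^sup>2 + (snd w)\<^sup>2 + 2 * fst w * snd w" by (simp add: power2_sum)
      thus "(1 - \<eta>) * (fst w)\<^sup>2 - 1 / \<eta> * (snd w)\<^sup>2 \<le> (fst w + snd w)\<^sup>2"
        using cross[of "fst w" "snd w"] zero_le_power2[of "snd w"] unfolding left_diff_distrib by linarith
    qed (use f r_sq i2 in auto)
    finally show "(1 - \<eta>) * E (\<lambda>w. (fst w)\<^sup>2) - 1 / \<eta> * B \<le> E (\<lambda>w. (fst w + snd w)\<^sup>2)" .
  }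
  have "(E snd)\<^sup>2 \<le> E (\<lambda>w. (snd w)\<^sup>2)"
    using measure_pmf.variance_positive[of M snd] measure_pmf.variance_eq[OF r r_sq] by (simp add: E_def)
  hence "(E fst + E snd)\<^sup>2 \<le> 2 * (E fst)\<^sup>2 + 2 * B"
    using EB two_sq[of "E fst" "E snd"] by linarith
  moreover have "E (\<lambda>w. fst w + snd w) = E fst + E snd" unfolding E_def using f r by simp
  ultimately show "(E (\<lambda>w. fst w + snd w))\<^sup>2 \<le> 2 * (E fst)\<^sup>2 + 2 * B" by simp
qed

section \<open>Second moment of a depth, and expectations over one step\<close>

context split_tree begin

lemma second_moment_depth_pmf:
  obtains C where "C > 0"
    "\<And>n k. 1 \<le> k \<Longrightarrow> k \<le> n \<Longrightarrow> (\<integral>\<^sup>+d. ennreal ((real d)\<^sup>2) \<partial>depth_pmf n k) \<le> ennreal (C * (1 + ln (real n))\<^sup>2)"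
proof -
  \<comment> \<open>Any q strictly between 1 and 1 / \<open>rho\<close> would do; this is the
    midpoint.\<close>
  define q where "q = (1 + 1 / rho) / 2"
  have "1 < 1 / rho" using rho_pos rho_less_1 by simp
  hence q1: "q > 1" by (simp add: q_def)
  have qr: "q * rho < 1" using rho_pos rho_less_1 by (simp add: q_def field_simps)
  define A where "A = (q - 1) / (1 - q * rho)"
  have A: "A \<ge> 0" using q1 qr by (simp add: A_def)
  define lq where "lq = ln q"
  have lq: "lq > 0" using q1 by (simp add: lq_def)
  define C where "C = (2 * (2 + ln (1 + A))\<^sup>2 + 4) / lq\<^sup>2"
  have lA: "ln (1 + A) \<ge> 0" using A by simp
  have "C > 0" unfolding C_def using lq by (intro divide_pos_pos) (auto intro: add_nonneg_pos)
  moreover have "(\<integral>\<^sup>+d. ennreal ((real d)\<^sup>2) \<partial>depth_pmf n k) \<le> ennreal (C * (1 + ln (real n))\<^sup>2)" if k: "1 \<le> k" "k \<le> n" for n k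
  proof -
    have n: "real n \<ge> 1" using k by simp
    \<comment> \<open>M dominates the exponential moment n + A n(n - 1), and ln M is O(1 + ln
      n).\<close>
    define M where "M = (1 + A) * (real n)\<^sup>2"
    have M1: "M \<ge> 1"
    proof -
      have "1 * 1 \<le> (1 + A) * (real n)\<^sup>2" using A n by (intro mult_mono) auto
      thus ?thesis by (simp add: M_def)
    qed
    define LM where "LM = ln M"
    have LM: "LM \<ge> 0" "exp LM = M" using M1 by (auto simp: LM_def)
    have pw: "(real d)\<^sup>2 \<le> (2 * LM\<^sup>2) / lq\<^sup>2 + 4 / lq\<^sup>2 * (q ^ d / M)" for d
    proof -
      have "(real d * lq)\<^sup>2 \<le> 2 * LM\<^sup>2 + 4 * exp (real d * lq - LM)"
        using lq LM by (intro square_le_exp) auto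
      also have "exp (real d * lq - LM) = q ^ d / M"
        using q1 LM by (simp add: exp_diff lq_def exp_of_nat_mult)
      finally have "(real d)\<^sup>2 * lq\<^sup>2 \<le> 2 * LM\<^sup>2 + 4 * (q ^ d / M)" by (simp add: power_mult_distrib)
      hence "(real d)\<^sup>2 \<le> (2 * LM\<^sup>2 + 4 * (q ^ d / M)) / lq\<^sup>2" using lq by (simp add: pos_le_divide_eq)
      thus ?thesis by (simp add: add_divide_distrib mult.commute)
    qed
    have eq: "ennreal ((2 * LM\<^sup>2) / lq\<^sup>2 + 4 / lq\<^sup>2 * (q ^ d / M)) =
        ennreal ((2 * LM\<^sup>2) / lq\<^sup>2) + ennreal (4 / lq\<^sup>2 / M) * ennreal (q ^ d)" for d
      using q1 M1 by (simp add: ennreal_plus[symmetric] ennreal_mult[symmetric] del: ennreal_plus)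
    have "(\<integral>\<^sup>+d. ennreal ((real d)\<^sup>2) \<partial>depth_pmf n k) \<le> (\<integral>\<^sup>+d. ennreal ((2 * LM\<^sup>2) / lq\<^sup>2 + 4 / lq\<^sup>2 * (q ^ d / M)) \<partial>depth_pmf n k)"
      by (intro nn_integral_mono ennreal_leI pw)
    also have "\<dots> = ennreal ((2 * LM\<^sup>2) / lq\<^sup>2) + ennreal (4 / lq\<^sup>2 / M) * (\<integral>\<^sup>+d. ennreal (q ^ d) \<partial>depth_pmf n k)"
      unfolding eq by (simp add: nn_integral_add nn_integral_cmult measure_pmf.emeasure_space_1)
    also have "\<dots> \<le> ennreal ((2 * LM\<^sup>2) / lq\<^sup>2) + ennreal (4 / lq\<^sup>2 / M) * ennreal (real n + A * (real n * (real n - 1)))"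
      unfolding A_def using q1 qr k by (intro add_left_mono mult_left_mono exponential_moment_depth_pmf) auto
    also have "\<dots> \<le> ennreal ((2 * LM\<^sup>2) / lq\<^sup>2) + ennreal (4 / lq\<^sup>2 / M) * ennreal M"
    proof (intro add_left_mono mult_left_mono ennreal_leI)
      have "real n * 1 \<le> real n * real n" using n by (intro mult_left_mono) auto
      hence "real n \<le> (real n)\<^sup>2" by (simp only: power2_eq_square mult_1_right)
      moreover have "M = (real n)\<^sup>2 + A * (real n)\<^sup>2" by (simp add: M_def distrib_right)
      moreover have "A * (real n * (real n - 1)) \<le> A * (real n)\<^sup>2"
        using A n by (intro mult_left_mono) (auto simp: power2_eq_square)
      ultimately show "real n + A * (real n * (real n - 1)) \<le> M" by linarith
    qed simp
    also have "\<dots> = ennreal ((2 * LM\<^sup>2 + 4) / lq\<^sup>2)"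
      using M1 lq by (simp add: ennreal_mult[symmetric] ennreal_plus[symmetric] add_divide_distrib del: ennreal_plus)
    also have "\<dots> \<le> ennreal (C * (1 + ln (real n))\<^sup>2)"
    proof (rule ennreal_leI)
      define l where "l = ln (real n)"
      have l: "l \<ge> 0" using n by (simp add: l_def)
      have "LM = ln (1 + A) + 2 * l" using A n by (simp add: LM_def M_def l_def ln_mult ln_realpow)
      also have "\<dots> \<le> (2 + ln (1 + A)) * (1 + l)" using l lA by (simp add: algebra_simps)
      finally have "LM\<^sup>2 \<le> ((2 + ln (1 + A)) * (1 + l))\<^sup>2" using LM by (intro power_mono) auto
      moreover have "1 \<le> (1 + l)\<^sup>2" using l by simp
      ultimately have "2 * LM\<^sup>2 + 4 \<le> 2 * ((2 + ln (1 + A)) * (1 + l))\<^sup>2 + 4 * (1 + l)\<^sup>2" by linarith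
      also have "\<dots> = (2 * (2 + ln (1 + A))\<^sup>2 + 4) * (1 + l)\<^sup>2" unfolding power_mult_distrib by (simp only: distrib_right mult.assoc)
      finally show "(2 * LM\<^sup>2 + 4) / lq\<^sup>2 \<le> C * (1 + ln (real n))\<^sup>2"
        unfolding C_def l_def[symmetric] by (simp add: divide_right_mono)
    qed
    finally show ?thesis .
  qed
  ultimately show thesis by (rule that)
qed

lemma integrable_step: "integrable (step k n) (F :: _ \<Rightarrow> real)"
  by (rule integrable_measure_pmf_finite) (rule finite_set_step)

abbreviation step_exp :: "nat \<Rightarrow> nat \<Rightarrow> (nat \<times> nat \<Rightarrow> real) \<Rightarrow> real" where
  "step_exp k n F \<equiv> measure_pmf.expectation (step k n) F"

lemma step_exp_mono: "(\<And>z. z \<in> set_pmf (step k n) \<Longrightarrow> F z \<le> G z) \<Longrightarrow> step_exp k n F \<le> step_exp k n G"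
  by (rule integral_mono_AE[OF integrable_step integrable_step]) (simp add: AE_measure_pmf_iff)

lemma step_exp_add: "step_exp k n (\<lambda>z. F z + G z) = step_exp k n F + step_exp k n G"
  by (rule Bochner_Integration.integral_add[OF integrable_step integrable_step])

lemma step_exp_diff: "step_exp k n (\<lambda>z. F z - G z) = step_exp k n F - step_exp k n G"
  by (rule Bochner_Integration.integral_diff[OF integrable_step integrable_step])

lemma step_exp_cmult: "step_exp k n (\<lambda>z. c * F z) = c * step_exp k n F"
  by (rule integral_mult_right_zero)

lemma step_exp_const: "step_exp k n (\<lambda>z. c) = c"
  by simp

lemmas step_exp_simps = step_exp_add step_exp_diff step_exp_cmult step_exp_const

lemma step_exp_abs: "\<bar>step_exp k n F\<bar> \<le> step_exp k n (\<lambda>z. \<bar>F z\<bar>)"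
  by (rule integral_abs_bound)

lemma step_exp_bind:
  fixes h :: "'b \<Rightarrow> real"
  assumes "\<And>z. finite (set_pmf (f z))"
  shows "measure_pmf.expectation (bind_pmf (step k n) f) h = step_exp k n (\<lambda>z. measure_pmf.expectation (f z) h)"
proof -
  have "measure_pmf.expectation (bind_pmf (step k n) f) h =
     (\<Sum>z\<in>set_pmf (step k n). pmf (step k n) z *\<^sub>R measure_pmf.expectation (f z) h)"
    by (rule pmf_expectation_bind[OF finite_set_step assms]) auto
  also have "\<dots> = step_exp k n (\<lambda>z. measure_pmf.expectation (f z) h)"
    by (subst integral_measure_pmf[OF finite_set_step[of k n]]) auto
  finally show ?thesis .
qed

text \<open>The gap 1 - \<open>rho\<close> is cut in three: one third absorbs the additive constant
  1 + s1 above the threshold, one the shift \<open>margin * k\<close> in \<open>mean_below\<close>,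
  and one keeps \<open>contr\<close> below 1.\<close>

definition margin where "margin = (1 - rho) / 3"
definition contr where "contr = (2 + rho) / 3"

lemma margin_contr: "0 < margin" "margin < 1" "0 < contr" "contr < 1" "rho + 2 * margin = contr"
  using rho_pos rho_less_1 by (simp_all add: margin_def contr_def field_simps)

lemmas step_mean' = step_mean[unfolded case_prod_beta']
lemmas step_ratio' = step_ratio[unfolded case_prod_beta']
lemmas step_log_mean' = step_log_mean[unfolded case_prod_beta']
lemmas step_log_square' = step_log_square[unfolded case_prod_beta']

lemma set_step':
  assumes "s + 1 < k" "k \<le> n" "z \<in> set_pmf (step k n)"
  shows "1 \<le> fst z" "fst z \<le> k" "fst z \<le> snd z" "snd z \<le> n"
  using set_step[OF assms(1,2), of "fst z" "snd z"] assms(3) by auto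

definition pot_const where "pot_const = contr / ((1 - contr) * margin)"

lemma pot_const_pos: "pot_const > 0" using margin_contr by (simp add: pot_const_def)

context
  fixes H :: nat
  assumes H_s: "s + 1 \<le> H" and H_cc: "2 * num_fixed \<le> H" and H_th: "1 + real s1 \<le> margin * real H"
begin

lemma H_pos: "real H > 0" using H_s by simp

lemma above_H: "H < k \<Longrightarrow> s + 1 < k" "H < k \<Longrightarrow> 2 * num_fixed < k"
  using H_s H_cc by auto

text \<open>Along the chain \<open>pot\<close> decreases by at least \<open>1 / k\<close> in mean, so the one-step errors \<open>O(1 / k)\<close>
  above rank \<open>H\<close> add up to \<open>O(1 / H)\<close>.\<close>

definition pot :: "nat \<Rightarrow> real" where
  "pot k = contr / (1 - contr) * (1 / (margin * real H) - 1 / max (real k) (margin * real H))"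

lemma pot_nonneg: "0 \<le> pot k" and pot_le: "pot k \<le> pot_const / real H"
proof -
  have tH: "0 < margin * real H" using margin_contr H_pos by simp
  hence "1 / max (real k) (margin * real H) \<le> 1 / (margin * real H)" by (intro divide_left_mono) auto
  thus "0 \<le> pot k" using margin_contr by (simp add: pot_def)
  have "pot k \<le> contr / (1 - contr) * (1 / (margin * real H))"
    unfolding pot_def using margin_contr tH by (intro mult_left_mono) auto
  thus "pot k \<le> pot_const / real H" by (simp add: pot_const_def)
qed

lemma mean_below: "H < k \<Longrightarrow> k \<le> n \<Longrightarrow> step_exp k n (\<lambda>z. real (fst z) + margin * real k) \<le> contr * real k"
proof -
  assume k: "H < k" "k \<le> n"
  have "margin * real H \<le> margin * real k" using k margin_contr by simp
  moreover have "step_exp k n (\<lambda>z. real (fst z)) \<le> 1 + real s1 + rho * real k" using step_mean'[OF above_H(1)] k by simp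
  moreover have "contr * real k = rho * real k + margin * real k + margin * real k" unfolding margin_contr(5)[symmetric] by (simp add: algebra_simps)
  ultimately show ?thesis using H_th by (simp only: step_exp_simps)
qed

lemma mean_below': "H < k \<Longrightarrow> k \<le> n \<Longrightarrow> step_exp k n (\<lambda>z. real (fst z)) \<le> contr * real k"
  using mean_below[of k n] margin_contr by (simp only: step_exp_simps) (smt (verit) mult_nonneg_nonneg of_nat_0_le_iff)

text \<open>Convexity of the reciprocal. Since k > H, the maximum in \<open>pot\<close> is at most
  k' + \<open>margin * k\<close>, whose mean is at most \<open>contr * k\<close>; the tangent of 1 /
  y at that value z0 bounds the mean reciprocal below by 1 / z0. The prefactor contr / (1 - contr)
  normalises the drop 1 / z0 - 1 / k to exactly 1 / k.\<close>

lemma pot_step: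
  assumes k: "H < k" "k \<le> n"
  shows "step_exp k n (\<lambda>z. pot (fst z)) \<le> pot k - 1 / real k"
proof -
  have kp: "real k > 0" using k by simp
  have tk: "margin * real H \<le> margin * real k" using k margin_contr by simp
  have tH: "0 < margin * real H" using margin_contr H_pos by simp
  define z0 where "z0 = contr * real k"
  have z0: "z0 > 0" using margin_contr kp by (simp add: z0_def)
  have "2 / z0 - (real k' + margin * real k) / z0\<^sup>2 \<le> 1 / max (real k') (margin * real H)" for k'
  proof -
    define y where "y = real k' + margin * real k"
    have y: "y > 0" using margin_contr kp by (simp add: y_def add_nonneg_pos)
    have "0 \<le> (y - z0)\<^sup>2 / (y * z0\<^sup>2)" using y by simp
    also have "\<dots> = 1 / y - (2 / z0 - y / z0\<^sup>2)" using y z0 by (simp add: field_simps power2_eq_square)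
    finally have "2 / z0 - y / z0\<^sup>2 \<le> 1 / y" by simp
    also have "\<dots> \<le> 1 / max (real k') (margin * real H)"
    proof (rule divide_left_mono)
      have "0 \<le> margin * real k" using tH tk by linarith
      thus "max (real k') (margin * real H) \<le> y" using tk by (simp add: y_def)
      show "0 < y * max (real k') (margin * real H)" using y tH by (simp add: less_max_iff_disj)
    qed simp
    finally show ?thesis by (simp add: y_def)
  qed
  hence "step_exp k n (\<lambda>z. 2 / z0 - 1 / z0\<^sup>2 * (real (fst z) + margin * real k)) \<le> step_exp k n (\<lambda>z. 1 / max (real (fst z)) (margin * real H))"
    by (intro step_exp_mono) simp
  also have "step_exp k n (\<lambda>z. 2 / z0 - 1 / z0\<^sup>2 * (real (fst z) + margin * real k)) = 2 / z0 - 1 / z0\<^sup>2 * step_exp k n (\<lambda>z. real (fst z) + margin * real k)"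
    by (simp only: step_exp_diff step_exp_const step_exp_cmult)
  finally have 1: "2 / z0 - 1 / z0\<^sup>2 * step_exp k n (\<lambda>z. real (fst z) + margin * real k) \<le> step_exp k n (\<lambda>z. 1 / max (real (fst z)) (margin * real H))" .
  have "1 / z0\<^sup>2 * step_exp k n (\<lambda>z. real (fst z) + margin * real k) \<le> 1 / z0\<^sup>2 * z0"
    using mean_below[OF k] by (intro mult_left_mono) (auto simp: z0_def)
  also have "\<dots> = 1 / z0" using z0 by (simp add: power2_eq_square)
  finally have 2: "1 / z0 \<le> step_exp k n (\<lambda>z. 1 / max (real (fst z)) (margin * real H))" using 1 by simp
  have "margin * real H \<le> 1 * real H" using margin_contr by (intro mult_right_mono) auto
  hence mx: "max (real k) (margin * real H) = real k" using k by simp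
  have "step_exp k n (\<lambda>z. pot (fst z)) = contr / (1 - contr) * (1 / (margin * real H) - step_exp k n (\<lambda>z. 1 / max (real (fst z)) (margin * real H)))"
    unfolding pot_def by (simp only: step_exp_simps)
  also have "\<dots> \<le> contr / (1 - contr) * (1 / (margin * real H) - 1 / z0)"
    using 2 margin_contr by (intro mult_left_mono) auto
  also have "\<dots> = pot k - contr / (1 - contr) * (1 / z0 - 1 / real k)"
    unfolding pot_def mx by (simp only: algebra_simps)
  also have "contr / (1 - contr) * (1 / z0 - 1 / real k) = 1 / real k"
    unfolding z0_def using margin_contr kp by (simp add: field_simps)
  finally show ?thesis .
qed

section \<open>Expected number of steps above the threshold\<close>

primrec exp_steps :: "nat \<Rightarrow> nat \<Rightarrow> nat \<Rightarrow> real" where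
  "exp_steps 0 k n = 0"
| "exp_steps (Suc i) k n = (if k \<le> H then 0 else 1 + step_exp k n (\<lambda>z. exp_steps i (fst z) (snd z)))"

lemma exp_steps_nonneg: "0 \<le> exp_steps i k n"
  by (induction i arbitrary: k n) (auto intro!: add_nonneg_nonneg integral_nonneg_AE)

text \<open>Each step lowers ln k by \<open>mu\<close> up to \<open>log_const / k\<close>, and
  \<open>log_const * pot\<close> pays for that error. In the lower bound ln H is what may remain at
  stopping, and \<open>contr ^ i * k\<close> accounts for runs cut off by the cap, where ln k <= k
  and the mean rank has shrunk geometrically.\<close>

lemma exp_steps_bounds:
  assumes "1 \<le> k" "k \<le> n"
  shows "mu * exp_steps i k n \<le> ln (real k) + log_const * pot k"
    and "ln (real k) - ln (real H) - log_const * pot k - contr ^ i * real k \<le> mu * exp_steps i k n"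
  using assms
proof (induction i arbitrary: k n)
  case 0
  {
    case 1
    thus ?case using pot_nonneg[of k] log_const_nonneg by (simp add: add_nonneg_nonneg)
  next
    case 2
    have "ln (real k) \<le> real k - 1" using 2 by (intro ln_le_minus_one) simp
    moreover have "0 \<le> ln (real H)" using H_s by simp
    moreover have "0 \<le> log_const * pot k" using pot_nonneg[of k] log_const_nonneg by simp
    ultimately show ?case by simp
  }
next
  case (Suc i)
  have nn: "0 \<le> log_const * pot k" for k using pot_nonneg[of k] log_const_nonneg by simp
  have H1: "0 \<le> ln (real H)" using H_s by simp
  {
    case 1
    show ?case
    proof (cases "k \<le> H")
      case True
      thus ?thesis using 1 nn[of k] by (simp add: add_nonneg_nonneg)
    next
      case False
      hence k: "H < k" by simp
      note st = set_step'[OF above_H(1)[OF k] 1(2)]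
      have "step_exp k n (\<lambda>z. mu * exp_steps i (fst z) (snd z)) \<le> step_exp k n (\<lambda>z. ln (real (fst z)) + log_const * pot (fst z))"
        by (intro step_exp_mono Suc.IH(1) st)
      also have "\<dots> \<le> (ln (real k) - mu + log_const / real k) + log_const * (pot k - 1 / real k)"
        unfolding step_exp_simps using step_log_mean'[OF above_H(1,2)[OF k] 1(2)] log_const_nonneg
        by (intro add_mono mult_left_mono pot_step[OF k 1(2)]) (simp_all add: abs_le_iff)
      finally show ?thesis using False by (simp add: step_exp_cmult algebra_simps)
    qed
  next
    case 2
    show ?case
    proof (cases "k \<le> H")
      case True
      have "ln (real k) \<le> ln (real H)" using True 2 by simp
      moreover have "0 \<le> contr ^ Suc i * real k" using margin_contr by simp
      ultimately show ?thesis using True nn[of k] by simp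
    next
      case False
      hence k: "H < k" by simp
      note st = set_step'[OF above_H(1)[OF k] 2(2)]
      have "(ln (real k) - mu - log_const / real k) - ln (real H) - log_const * (pot k - 1 / real k) - contr ^ i * (contr * real k)
         \<le> step_exp k n (\<lambda>z. ln (real (fst z)) - ln (real H) - log_const * pot (fst z) - contr ^ i * real (fst z))"
        unfolding step_exp_simps using step_log_mean'[OF above_H(1,2)[OF k] 2(2)] log_const_nonneg margin_contr
        by (intro diff_mono mult_left_mono pot_step[OF k 2(2)] mean_below'[OF k 2(2)]) (simp_all add: abs_le_iff)
      also have "\<dots> \<le> step_exp k n (\<lambda>z. mu * exp_steps i (fst z) (snd z))"
        by (intro step_exp_mono Suc.IH(2) st)
      finally show ?thesis using False by (simp add: step_exp_cmult algebra_simps)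
    qed
  }
qed

abbreviation Z :: "nat \<Rightarrow> nat \<times> nat \<Rightarrow> real" where
  "Z k z \<equiv> mu + ln (real (fst z)) - ln (real k)"

text \<open>In the recursions \<open>exp_steps\<close>, \<open>mart\<close> and \<open>decomp\<close> the first argument caps the number of steps.\<close>

primrec mart :: "nat \<Rightarrow> nat \<Rightarrow> nat \<Rightarrow> real pmf" where
  "mart 0 k n = return_pmf 0"
| "mart (Suc i) k n = (if k \<le> H then return_pmf 0
     else bind_pmf (step k n) (\<lambda>z. map_pmf (\<lambda>g. g + Z k z) (mart i (fst z) (snd z))))"

lemma finite_mart: "finite (set_pmf (mart i k n))"
  by (induction i arbitrary: k n) (auto simp: finite_set_step)

lemma integrable_mart: "integrable (mart i k n) (f :: real \<Rightarrow> real)"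
  by (rule integrable_measure_pmf_finite) (rule finite_mart)

lemma mart_expectation_Suc:
  fixes f :: "real \<Rightarrow> real"
  assumes "H < k"
  shows "measure_pmf.expectation (mart (Suc i) k n) f =
     step_exp k n (\<lambda>z. measure_pmf.expectation (mart i (fst z) (snd z)) (\<lambda>g. f (g + Z k z)))"
  using assms by (simp add: step_exp_bind finite_mart)

text \<open>The increments \<open>Z\<close> have conditional means of size at most
  \<open>log_const / k\<close>; \<open>pot\<close> sums these along the chain.\<close>

lemma mart_mean:
  assumes "1 \<le> k" "k \<le> n"
  shows "\<bar>measure_pmf.expectation (mart i k n) (\<lambda>g. g)\<bar> \<le> log_const * pot k"
  using assms
proof (induction i arbitrary: k n)
  case 0
  thus ?case using pot_nonneg[of k] log_const_nonneg by simp
next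
  case (Suc i)
  show ?case
  proof (cases "k \<le> H")
    case True
    thus ?thesis using pot_nonneg[of k] log_const_nonneg by simp
  next
    case False
    hence k: "H < k" by simp
    let ?e = "\<lambda>z. measure_pmf.expectation (mart i (fst z) (snd z)) (\<lambda>g. g)"
    have "measure_pmf.expectation (mart (Suc i) k n) (\<lambda>g. g) = step_exp k n (\<lambda>z. ?e z + Z k z)"
      unfolding mart_expectation_Suc[OF k] by (simp add: integrable_mart)
    also have "\<dots> = step_exp k n ?e + (step_exp k n (\<lambda>z. ln (real (fst z))) - ln (real k) + mu)"
      by (simp only: step_exp_simps)
    finally have eq: "measure_pmf.expectation (mart (Suc i) k n) (\<lambda>g. g) = \<dots>" .
    have "\<bar>step_exp k n ?e\<bar> \<le> step_exp k n (\<lambda>z. \<bar>?e z\<bar>)" by (rule step_exp_abs)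
    also have "\<dots> \<le> step_exp k n (\<lambda>z. log_const * pot (fst z))"
      by (intro step_exp_mono Suc.IH set_step'[OF above_H(1)[OF k] Suc.prems(2)])
    also have "\<dots> \<le> log_const * (pot k - 1 / real k)"
      unfolding step_exp_cmult using log_const_nonneg by (intro mult_left_mono pot_step[OF k Suc.prems(2)])
    finally have "\<bar>step_exp k n ?e\<bar> \<le> log_const * pot k - log_const / real k" by (simp add: algebra_simps)
    moreover have "\<bar>step_exp k n (\<lambda>z. ln (real (fst z))) - ln (real k) + mu\<bar> \<le> log_const / real k"
      using step_log_mean'[OF above_H(1,2)[OF k] Suc.prems(2)] .
    ultimately show ?thesis unfolding eq by linarith
  qed
qed

lemma mart_mean': "1 \<le> k \<Longrightarrow> k \<le> n \<Longrightarrow> \<bar>measure_pmf.expectation (mart i k n) (\<lambda>g. g)\<bar> \<le> log_const * (pot_const / real H)"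
  using mart_mean[of k n i] mult_left_mono[OF pot_le[of k] log_const_nonneg] by linarith

text \<open>In the expansion of (g + Z)^2 the square of \<open>Z\<close> adds about
  \<open>sigma2\<close> per step. The cross term is \<open>Z\<close> times the mean of the rest,
  which is O(1 / H) by \<open>mart_mean'\<close>, and |Z| <= Z^2 + 1; this explains the form of the
  hypothesis on \<epsilon>.\<close>

lemma mart_second_moment:
  assumes eps: "\<And>k n. H < k \<Longrightarrow> k \<le> n \<Longrightarrow>
       \<bar>step_exp k n (\<lambda>z. (Z k z)\<^sup>2) - sigma2\<bar> + 2 * (log_const * (pot_const / real H)) * (step_exp k n (\<lambda>z. (Z k z)\<^sup>2) + 1) \<le> \<epsilon>"
    and "1 \<le> k" "k \<le> n"
  shows "\<bar>measure_pmf.expectation (mart i k n) (\<lambda>g. g\<^sup>2) - sigma2 * exp_steps i k n\<bar> \<le> \<epsilon> * exp_steps i k n"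
  using assms(2,3)
proof (induction i arbitrary: k n)
  case (Suc i)
  show ?case
  proof (cases "k \<le> H")
    case False
    hence k: "H < k" by simp
    note st = set_step'[OF above_H(1)[OF k] Suc.prems(2)]
    let ?e = "\<lambda>z. measure_pmf.expectation (mart i (fst z) (snd z)) (\<lambda>g. g)"
    let ?e2 = "\<lambda>z. measure_pmf.expectation (mart i (fst z) (snd z)) (\<lambda>g. g\<^sup>2)"
    let ?t = "\<lambda>z. exp_steps i (fst z) (snd z)"
    let ?c = "log_const * (pot_const / real H)"
    have "measure_pmf.expectation (mart (Suc i) k n) (\<lambda>g. g\<^sup>2) = step_exp k n (\<lambda>z. ?e2 z + 2 * (Z k z * ?e z) + (Z k z)\<^sup>2)"
      unfolding mart_expectation_Suc[OF k]
    proof (rule Bochner_Integration.integral_cong[OF refl])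
      fix z
      have "measure_pmf.expectation (mart i (fst z) (snd z)) (\<lambda>g. (g + c)\<^sup>2) = ?e2 z + 2 * (c * ?e z) + c\<^sup>2" for c
        by (simp add: power2_sum integrable_mart mult.commute[of _ c] mult.left_commute)
      thus "measure_pmf.expectation (mart i (fst z) (snd z)) (\<lambda>g. (g + Z k z)\<^sup>2) = ?e2 z + 2 * (Z k z * ?e z) + (Z k z)\<^sup>2" .
    qed
    also have "\<dots> = step_exp k n ?e2 + 2 * step_exp k n (\<lambda>z. Z k z * ?e z) + step_exp k n (\<lambda>z. (Z k z)\<^sup>2)"
      by (simp only: step_exp_add step_exp_cmult)
    finally have eq: "measure_pmf.expectation (mart (Suc i) k n) (\<lambda>g. g\<^sup>2) = \<dots>" .
    have "\<bar>step_exp k n (\<lambda>z. Z k z * ?e z)\<bar> \<le> step_exp k n (\<lambda>z. \<bar>Z k z * ?e z\<bar>)" by (rule step_exp_abs)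
    also have "\<dots> \<le> step_exp k n (\<lambda>z. ?c * ((Z k z)\<^sup>2 + 1))"
    proof (rule step_exp_mono)
      fix z assume z: "z \<in> set_pmf (step k n)"
      have "\<bar>w\<bar> \<le> w\<^sup>2 + 1" for w :: real
      proof -
        have "0 \<le> (\<bar>w\<bar> - 1)\<^sup>2" by simp
        hence "2 * \<bar>w\<bar> \<le> w\<^sup>2 + 1" by (simp only: power2_diff power2_abs) simp
        thus ?thesis using abs_ge_zero[of w] by linarith
      qed
      moreover have "\<bar>?e z\<bar> \<le> ?c" by (rule mart_mean'[OF st(1,3)[OF z]])
      ultimately have "\<bar>Z k z\<bar> * \<bar>?e z\<bar> \<le> ((Z k z)\<^sup>2 + 1) * ?c" by (intro mult_mono) auto
      thus "\<bar>Z k z * ?e z\<bar> \<le> ?c * ((Z k z)\<^sup>2 + 1)" by (simp only: abs_mult mult.commute)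
    qed
    also have "\<dots> = ?c * (step_exp k n (\<lambda>z. (Z k z)\<^sup>2) + 1)" by (simp only: step_exp_cmult step_exp_add step_exp_const)
    finally have cross: "\<bar>step_exp k n (\<lambda>z. Z k z * ?e z)\<bar> \<le> ?c * (step_exp k n (\<lambda>z. (Z k z)\<^sup>2) + 1)" .
    have "\<bar>step_exp k n ?e2 - sigma2 * step_exp k n ?t\<bar> = \<bar>step_exp k n (\<lambda>z. ?e2 z - sigma2 * ?t z)\<bar>" by (simp only: step_exp_diff step_exp_cmult)
    also have "\<dots> \<le> step_exp k n (\<lambda>z. \<bar>?e2 z - sigma2 * ?t z\<bar>)" by (rule step_exp_abs)
    also have "\<dots> \<le> step_exp k n (\<lambda>z. \<epsilon> * ?t z)" by (intro step_exp_mono Suc.IH st)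
    finally have IH: "\<bar>step_exp k n ?e2 - sigma2 * step_exp k n ?t\<bar> \<le> \<epsilon> * step_exp k n ?t" by (simp only: step_exp_cmult)
    have exp_steps: "exp_steps (Suc i) k n = 1 + step_exp k n ?t" using k by simp
    have "\<bar>(a + 2 * b' + c) - sigma2 * (1 + t)\<bar> \<le> \<epsilon> * (1 + t)"
      if "\<bar>b'\<bar> \<le> m" "\<bar>a - sigma2 * t\<bar> \<le> \<epsilon> * t" "\<bar>c - sigma2\<bar> + 2 * m \<le> \<epsilon>" for a b' c m t
      using that unfolding distrib_left mult_1_right by linarith
    from this[OF cross IH] eps[OF k Suc.prems(2)] show ?thesis
      unfolding eq exp_steps by (simp only: mult.assoc)
  qed simp
qed simp

text \<open>Joint law of the almost-martingale and of the residual left when the chain is stopped.\<close>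

primrec decomp :: "nat \<Rightarrow> nat \<Rightarrow> nat \<Rightarrow> (real \<times> real) pmf" where
  "decomp 0 k n = map_pmf (\<lambda>d. (0, mu * real d - ln (real k))) (depth_pmf n k)"
| "decomp (Suc i) k n = (if k \<le> H then map_pmf (\<lambda>d. (0, mu * real d - ln (real k))) (depth_pmf n k)
     else bind_pmf (step k n) (\<lambda>z. map_pmf (\<lambda>w. (fst w + Z k z, snd w)) (decomp i (fst z) (snd z))))"

lemma decomp_fst: "map_pmf fst (decomp i k n) = mart i k n"
proof (induction i arbitrary: k n)
  case (Suc i)
  show ?case
    by (simp add: map_bind_pmf pmf.map_comp o_def Suc[symmetric] map_pmf_const)
qed (simp add: pmf.map_comp o_def map_pmf_const)

text \<open>Telescoping: a step raises the depth by 1 and replaces ln k by ln k', which together is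
  exactly the increment \<open>Z\<close>.\<close>

lemma decomp_sum:
  assumes "1 \<le> k" "k \<le> n"
  shows "map_pmf (\<lambda>w. fst w + snd w) (decomp i k n) = map_pmf (\<lambda>d. mu * real d - ln (real k)) (depth_pmf n k)"
  using assms
proof (induction i arbitrary: k n)
  case (Suc i)
  show ?case
  proof (cases "k \<le> H")
    case False
    hence k: "H < k" by simp
    note st = set_step'[OF above_H(1)[OF k] Suc.prems(2)]
    have "map_pmf (\<lambda>w. fst w + snd w) (decomp (Suc i) k n) =
       bind_pmf (step k n) (\<lambda>z. map_pmf (\<lambda>y. y + Z k z) (map_pmf (\<lambda>w. fst w + snd w) (decomp i (fst z) (snd z))))"
      using k by (simp add: map_bind_pmf pmf.map_comp o_def algebra_simps)
    also have "\<dots> = bind_pmf (step k n) (\<lambda>z. map_pmf (\<lambda>y. y + Z k z) (map_pmf (\<lambda>d. mu * real d - ln (real (fst z))) (depth_pmf (snd z) (fst z))))"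
      by (intro bind_pmf_cong refl arg_cong[where f="map_pmf _"] Suc.IH st)
    also have "\<dots> = map_pmf (\<lambda>d. mu * real d - ln (real k)) (depth_pmf n k)"
      unfolding depth_pmf_step[OF above_H(1)[OF k] Suc.prems(2)]
      by (simp add: map_bind_pmf pmf.map_comp o_def case_prod_beta algebra_simps)
    finally show ?thesis .
  qed (simp add: pmf.map_comp o_def)
qed (simp add: pmf.map_comp o_def)

section \<open>The residual after stopping\<close>

context
  fixes C4 :: real
  assumes C4: "C4 > 0"
    "\<And>n k. 1 \<le> k \<Longrightarrow> k \<le> n \<Longrightarrow> (\<integral>\<^sup>+d. ennreal ((real d)\<^sup>2) \<partial>depth_pmf n k) \<le> ennreal (C4 * (1 + ln (real n))\<^sup>2)"
begin

definition resid_const where "resid_const = 2 * mu\<^sup>2 * C4 + 2"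

text \<open>The parameter \<open>l\<close> bounds ln n and stays fixed along the chain, where n
  never increases. The first two terms bound (1 + ln n)^2 at a rank at most H; the
  \<open>pot\<close> term pays in advance for the upward drift of n / k; the last one covers runs
  ended by the cap.\<close>

definition resid_bound :: "real \<Rightarrow> nat \<Rightarrow> nat \<Rightarrow> nat \<Rightarrow> real" where
  "resid_bound l i k n = 2 * (1 + ln (real n / real k))\<^sup>2 + 2 * (ln (real H))\<^sup>2 + 8 * real num_fixed * (1 + l) * pot k
     + 4 * contr ^ i * (real k * real n)"

lemma resid_const_pos: "resid_const > 0" using C4 by (simp add: resid_const_def add_nonneg_pos)

text \<open>Here the crude second moment of a depth, of order (ln n)^2, is affordable: at a rank k
  <= H one has ln n <= ln (n / k) + ln H, and at the cap a polynomial bound is enough, since the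
  chain damps k n by \<open>contr\<close> in every step.\<close>

lemma residual_base:
  assumes k: "1 \<le> k" "k \<le> n" and l: "0 \<le> l" and stop: "i = 0 \<or> k \<le> H"
  shows "(\<integral>\<^sup>+d. ennreal ((mu * real d - ln (real k))\<^sup>2) \<partial>depth_pmf n k) \<le> ennreal (resid_const * resid_bound l i k n)"
proof -
  have n: "real n \<ge> 1" "real k \<ge> 1" "real k \<le> real n" using k by simp_all
  have lk: "0 \<le> ln (real k)" "ln (real k) \<le> ln (real n)" using n by simp_all
  have "(mu * real d - ln (real k))\<^sup>2 \<le> 2 * mu\<^sup>2 * (real d)\<^sup>2 + 2 * (1 + ln (real n))\<^sup>2" for d
  proof -
    have "0 \<le> (mu * real d + ln (real k))\<^sup>2" by simp
    hence "(mu * real d - ln (real k))\<^sup>2 \<le> 2 * mu\<^sup>2 * (real d)\<^sup>2 + 2 * (ln (real k))\<^sup>2"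
      by (simp add: power2_eq_square algebra_simps)
    moreover have "(ln (real k))\<^sup>2 \<le> (1 + ln (real n))\<^sup>2" using lk by (intro power_mono) auto
    ultimately show ?thesis by linarith
  qed
  hence "(\<integral>\<^sup>+d. ennreal ((mu * real d - ln (real k))\<^sup>2) \<partial>depth_pmf n k) \<le>
     (\<integral>\<^sup>+d. ennreal (2 * mu\<^sup>2 * (real d)\<^sup>2 + 2 * (1 + ln (real n))\<^sup>2) \<partial>depth_pmf n k)"
    by (intro nn_integral_mono ennreal_leI)
  also have "\<dots> = ennreal (2 * mu\<^sup>2) * (\<integral>\<^sup>+d. ennreal ((real d)\<^sup>2) \<partial>depth_pmf n k) + ennreal (2 * (1 + ln (real n))\<^sup>2)"
    by (simp add: ennreal_plus ennreal_mult nn_integral_add nn_integral_cmult measure_pmf.emeasure_space_1)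
  also have "\<dots> \<le> ennreal (2 * mu\<^sup>2) * ennreal (C4 * (1 + ln (real n))\<^sup>2) + ennreal (2 * (1 + ln (real n))\<^sup>2)"
    using k by (intro add_right_mono mult_left_mono C4) auto
  also have "\<dots> = ennreal (resid_const * (1 + ln (real n))\<^sup>2)"
    using C4(1) by (simp add: resid_const_def ennreal_mult[symmetric] ennreal_plus[symmetric] algebra_simps del: ennreal_plus)
  also have "\<dots> \<le> ennreal (resid_const * resid_bound l i k n)"
  proof (intro ennreal_leI mult_left_mono)
    have nn: "0 \<le> 8 * real num_fixed * (1 + l) * pot k" "0 \<le> 2 * (1 + ln (real n / real k))\<^sup>2" "0 \<le> 2 * (ln (real H))\<^sup>2"
      "0 \<le> 4 * contr ^ i * (real k * real n)"
      using l pot_nonneg[of k] margin_contr by simp_all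
    show "(1 + ln (real n))\<^sup>2 \<le> resid_bound l i k n"
    proof (cases "k \<le> H")
      case True
      have "ln (real n) = ln (real n / real k) + ln (real k)" using n by (simp add: ln_div)
      also have "ln (real k) \<le> ln (real H)" using True n by simp
      finally have "(1 + ln (real n))\<^sup>2 \<le> ((1 + ln (real n / real k)) + ln (real H))\<^sup>2"
        using lk by (intro power_mono) auto
      also have "\<dots> \<le> 2 * (1 + ln (real n / real k))\<^sup>2 + 2 * (ln (real H))\<^sup>2"
      proof -
        have "(u + v)\<^sup>2 \<le> 2 * u\<^sup>2 + 2 * v\<^sup>2" for u v :: real
          using zero_le_power2[of "u - v"] unfolding power2_sum power2_diff by linarith
        thus ?thesis .
      qed
      finally show ?thesis using nn unfolding resid_bound_def by linarith
    next
      case False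
      hence i: "i = 0" using stop by simp
      \<comment> \<open>From ln (sqrt n) <= sqrt n - 1 the square is at most 4 n, which the last
        term of \<open>resid_bound\<close> dominates for cap 0 and k >= 1.\<close>
      have "ln (real n) / 2 = ln (sqrt (real n))" using n by (simp add: ln_sqrt)
      also have "\<dots> \<le> sqrt (real n) - 1" using n by (intro ln_le_minus_one) simp
      finally have "1 + ln (real n) \<le> 2 * sqrt (real n)" by simp
      hence "(1 + ln (real n))\<^sup>2 \<le> (2 * sqrt (real n))\<^sup>2" using lk by (intro power_mono) auto
      also have "\<dots> = 4 * (1 * real n)" by (simp add: power_mult_distrib)
      also have "\<dots> \<le> 4 * (real k * real n)" using n by (intro mult_left_mono mult_right_mono) auto
      finally show ?thesis using nn i unfolding resid_bound_def by (simp only: power_0 mult_1_right mult_1_left)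
    qed
  qed (use resid_const_pos in simp)
  finally show ?thesis .
qed

text \<open>Supermartingale property. By the tangent bound and \<open>step_ratio\<close> the squared
  logarithm gains at most 4 (1 + l) c / k in mean, with c = \<open>num_fixed\<close>; twice this
  gain is exactly what 8 c (1 + l) times the drop 1 / k of \<open>pot\<close> returns.\<close>

lemma resid_bound_step:
  assumes k: "H < k" "k \<le> n" and l: "ln (real n) \<le> l"
  shows "step_exp k n (\<lambda>z. resid_bound l i (fst z) (snd z)) \<le> resid_bound l (Suc i) k n"
proof -
  note st = set_step'[OF above_H(1)[OF k(1)] k(2)]
  have kp: "real k > 0" "real k \<ge> 1" "real n \<ge> 1" "real k \<le> real n" using k by auto
  define x0 where "x0 = real n / real k"
  have x0: "x0 \<ge> 1" using kp by (simp add: x0_def)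
  have lx0: "0 \<le> ln x0" "ln x0 \<le> ln (real n)" using kp x0 by (auto simp: x0_def ln_div)
  define c where "c = 2 * (1 + ln x0) / x0"
  have c: "c \<ge> 0" using lx0 x0 by (simp add: c_def)
  have "step_exp k n (\<lambda>z. (1 + ln (real (snd z) / real (fst z)))\<^sup>2) \<le> step_exp k n (\<lambda>z. ((1 + ln x0)\<^sup>2 - c * x0) + c * (real (snd z) / real (fst z)))"
  proof (rule step_exp_mono)
    fix z assume z: "z \<in> set_pmf (step k n)"
    have "real (snd z) / real (fst z) \<ge> 1" using st(1,3)[OF z] by simp
    from log_squared_tangent[OF this x0] show "(1 + ln (real (snd z) / real (fst z)))\<^sup>2 \<le>
       ((1 + ln x0)\<^sup>2 - c * x0) + c * (real (snd z) / real (fst z))"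
      unfolding c_def[symmetric] right_diff_distrib by linarith
  qed
  also have "\<dots> \<le> ((1 + ln x0)\<^sup>2 - c * x0) + c * (x0 * (1 + 2 * real num_fixed / real k))"
    unfolding step_exp_add step_exp_const step_exp_cmult using c step_ratio'[OF above_H(1,2)[OF k(1)] k(2)]
    by (intro add_left_mono mult_left_mono) (simp_all only: x0_def)
  also have "\<dots> = (1 + ln x0)\<^sup>2 + (c * x0) * (2 * real num_fixed / real k)" by (simp add: algebra_simps)
  also have "c * x0 = 2 * (1 + ln x0)" using x0 by (simp add: c_def)
  also have "2 * (1 + ln x0) * (2 * real num_fixed / real k) \<le> 2 * (1 + l) * (2 * real num_fixed / real k)"
    using lx0 l by (intro mult_right_mono) auto
  finally have E1: "step_exp k n (\<lambda>z. (1 + ln (real (snd z) / real (fst z)))\<^sup>2) \<le>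
      (1 + ln (real n / real k))\<^sup>2 + 2 * (1 + l) * (2 * real num_fixed / real k)" by (simp add: x0_def)
  have "step_exp k n (\<lambda>z. real (fst z) * real (snd z)) \<le> step_exp k n (\<lambda>z. real n * real (fst z))"
    by (rule step_exp_mono) (use st(4) in \<open>auto simp: mult.commute intro!: mult_left_mono\<close>)
  also have "\<dots> \<le> real n * (contr * real k)"
    unfolding step_exp_cmult by (intro mult_left_mono mean_below'[OF k]) simp
  finally have E2: "step_exp k n (\<lambda>z. real (fst z) * real (snd z)) \<le> contr * (real k * real n)" by (simp add: mult_ac)
  have l0: "0 \<le> 8 * real num_fixed * (1 + l)" using lx0 l by simp
  have "step_exp k n (\<lambda>z. resid_bound l i (fst z) (snd z)) = 2 * step_exp k n (\<lambda>z. (1 + ln (real (snd z) / real (fst z)))\<^sup>2) + 2 * (ln (real H))\<^sup>2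
    + 8 * real num_fixed * (1 + l) * step_exp k n (\<lambda>z. pot (fst z)) + 4 * contr ^ i * step_exp k n (\<lambda>z. real (fst z) * real (snd z))"
    unfolding resid_bound_def by (simp only: step_exp_add step_exp_const step_exp_cmult)
  also have "\<dots> \<le> 2 * ((1 + ln (real n / real k))\<^sup>2 + 2 * (1 + l) * (2 * real num_fixed / real k)) + 2 * (ln (real H))\<^sup>2
    + 8 * real num_fixed * (1 + l) * (pot k - 1 / real k) + 4 * contr ^ i * (contr * (real k * real n))"
    using E1 E2 l0 pot_step[OF k] margin_contr by (intro add_mono mult_left_mono) auto
  also have "\<dots> = resid_bound l (Suc i) k n" by (simp add: resid_bound_def add_divide_distrib algebra_simps)
  finally show ?thesis .
qed

lemma decomp_residual:
  assumes "1 \<le> k" "k \<le> n" "ln (real n) \<le> l"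
  shows "(\<integral>\<^sup>+w. ennreal ((snd w)\<^sup>2) \<partial>decomp i k n) \<le> ennreal (resid_const * resid_bound l i k n)"
  using assms
proof (induction i arbitrary: k n)
  case 0
  have "real n \<ge> 1" using 0 by simp
  hence "0 \<le> l" using 0 ln_ge_zero[of "real n"] by linarith
  thus ?case using residual_base[of k n l 0] 0 by simp
next
  case (Suc i)
  have "real n \<ge> 1" using Suc.prems by simp
  hence l: "0 \<le> l" using Suc.prems ln_ge_zero[of "real n"] by linarith
  show ?case
  proof (cases "k \<le> H")
    case True
    thus ?thesis using residual_base[of k n l "Suc i"] Suc.prems l by simp
  next
    case False
    hence k: "H < k" by simp
    note st = set_step'[OF above_H(1)[OF k] Suc.prems(2)]
    have Phi0: "0 \<le> resid_bound l i k' n'" if "1 \<le> k'" "k' \<le> n'" for k' n'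
      using l pot_nonneg[of k'] margin_contr by (simp add: resid_bound_def)
    have "(\<integral>\<^sup>+w. ennreal ((snd w)\<^sup>2) \<partial>decomp (Suc i) k n) = (\<integral>\<^sup>+z. \<integral>\<^sup>+w. ennreal ((snd w)\<^sup>2) \<partial>decomp i (fst z) (snd z) \<partial>step k n)"
      using k by simp
    also have "\<dots> \<le> (\<integral>\<^sup>+z. ennreal (resid_const * resid_bound l i (fst z) (snd z)) \<partial>step k n)"
    proof (rule nn_integral_mono_AE, unfold AE_measure_pmf_iff, rule ballI)
      fix z assume z: "z \<in> set_pmf (step k n)"
      have "ln (real (snd z)) \<le> ln (real n)" using st[OF z] by simp
      thus "(\<integral>\<^sup>+w. ennreal ((snd w)\<^sup>2) \<partial>decomp i (fst z) (snd z)) \<le> ennreal (resid_const * resid_bound l i (fst z) (snd z))"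
        using Suc.prems by (intro Suc.IH st z) simp
    qed
    also have "\<dots> = ennreal (step_exp k n (\<lambda>z. resid_const * resid_bound l i (fst z) (snd z)))"
      using resid_const_pos by (intro nn_integral_eq_integral integrable_step)
        (auto simp: AE_measure_pmf_iff intro!: mult_nonneg_nonneg Phi0 st)
    also have "\<dots> \<le> ennreal (resid_const * resid_bound l (Suc i) k n)"
      unfolding step_exp_cmult using resid_const_pos Suc.prems by (intro ennreal_leI mult_left_mono resid_bound_step k) auto
    finally show ?thesis .
  qed
qed

text \<open>The main term has second moment about \<open>sigma2\<close> times the expected number of
  steps, and the latter is ln k / \<open>mu\<close> up to \<open>D / mu\<close>; the residual enters
  as a perturbation of second moment at most \<open>B\<close>.\<close>

lemma moments_depth_pmf:
  fixes \<epsilon> \<eta> :: real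
  defines "B \<equiv> \<lambda>k n. resid_const * (2 * (1 + ln (real n / real k))\<^sup>2 + 2 * (ln (real H))\<^sup>2 + 8 * real num_fixed * (1 + ln (real n)) * (pot_const / real H) + 4)"
    and "D \<equiv> ln (real H) + log_const * (pot_const / real H) + 1"
    and "X \<equiv> \<lambda>k d. mu * real d - ln (real k)"
  assumes eps: "\<And>k n. H < k \<Longrightarrow> k \<le> n \<Longrightarrow>
       \<bar>step_exp k n (\<lambda>z. (Z k z)\<^sup>2) - sigma2\<bar> + 2 * (log_const * (pot_const / real H)) * (step_exp k n (\<lambda>z. (Z k z)\<^sup>2) + 1) \<le> \<epsilon>"
    and \<epsilon>: "0 \<le> \<epsilon>" and k: "1 \<le> k" "k \<le> n" and \<eta>: "0 < \<eta>" "\<eta> \<le> 1"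
  shows "measure_pmf.expectation (depth_pmf n k) (\<lambda>d. (X k d)\<^sup>2) \<le> (1 + \<eta>) * ((sigma2 + \<epsilon>) * (ln (real k) + D) / mu) + (1 + 1 / \<eta>) * B k n"
    and "(1 - \<eta>) * ((sigma2 * (ln (real k) - D) - \<epsilon> * (ln (real k) + D)) / mu) - 1 / \<eta> * B k n \<le> measure_pmf.expectation (depth_pmf n k) (\<lambda>d. (X k d)\<^sup>2)"
    and "(measure_pmf.expectation (depth_pmf n k) (X k))\<^sup>2 \<le> 2 * (log_const * (pot_const / real H))\<^sup>2 + 2 * B k n"
proof -
  have n1: "real k \<ge> 1" "real n \<ge> 1" "real k \<le> real n" using k by auto
  \<comment> \<open>The cap is taken so large, depending on n, that it survives in the conclusions
    only as the constants 4 in \<open>B\<close> and 1 in \<open>D\<close>.\<close>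
  have "(\<lambda>i. contr ^ i * (real n * real n)) \<longlonglongrightarrow> 0 * (real n * real n)"
    using margin_contr by (intro tendsto_mult LIMSEQ_realpow_zero tendsto_const) auto
  hence "\<forall>\<^sub>F i in sequentially. contr ^ i * (real n * real n) < 1" by (intro order_tendstoD) auto
  then obtain i where i: "contr ^ i * (real n * real n) < 1" by (auto simp: eventually_sequentially)
  have ik: "contr ^ i * (real k * real n) \<le> 1"
  proof -
    have "contr ^ i * (real k * real n) \<le> contr ^ i * (real n * real n)"
      using n1 margin_contr by (intro mult_left_mono mult_right_mono) auto
    thus ?thesis using i by linarith
  qed
  have ik': "contr ^ i * real k \<le> 1"
  proof -
    have "contr ^ i * (real k * 1) \<le> contr ^ i * (real k * real n)"
      using n1 margin_contr by (intro mult_left_mono) auto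
    thus ?thesis using ik by simp
  qed
  have resid_bound: "resid_const * resid_bound (ln (real n)) i k n \<le> B k n"
    unfolding resid_bound_def B_def using resid_const_pos ik pot_le[of k] n1 by (intro mult_left_mono add_mono) auto
  have res: "(\<integral>\<^sup>+w. ennreal ((snd w)\<^sup>2) \<partial>decomp i k n) \<le> ennreal (B k n)"
    using decomp_residual[OF k order_refl, of i] resid_bound by (meson ennreal_leI order_trans)
  have B0: "0 \<le> B k n"
    unfolding B_def using resid_const_pos n1 pot_const_pos by (intro mult_nonneg_nonneg add_nonneg_nonneg) auto
  have intf: "integrable (decomp i k n) (\<lambda>w. f (fst w))" for f :: "real \<Rightarrow> real"
    using integrable_mart[of i k n f] unfolding decomp_fst[symmetric] by (simp add: integrable_map_pmf_eq)
  have Ef: "measure_pmf.expectation (decomp i k n) (\<lambda>w. f (fst w)) = measure_pmf.expectation (mart i k n) f" for f :: "real \<Rightarrow> real"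
    unfolding decomp_fst[symmetric] by simp
  have ES: "measure_pmf.expectation (depth_pmf n k) (\<lambda>d. f (X k d)) = measure_pmf.expectation (decomp i k n) (\<lambda>w. f (fst w + snd w))" for f :: "real \<Rightarrow> real"
  proof -
    have "measure_pmf.expectation (map_pmf (\<lambda>w. fst w + snd w) (decomp i k n)) f = measure_pmf.expectation (map_pmf (X k) (depth_pmf n k)) f"
      unfolding decomp_sum[OF k] X_def ..
    thus ?thesis by simp
  qed
  note pert = pmf_square_perturb[OF intf[of "\<lambda>x. x"] intf[of "\<lambda>x. x\<^sup>2"] res B0, unfolded Ef[of power2]]
  define t where "t = exp_steps i k n"
  have t: "0 \<le> t" by (simp add: t_def exp_steps_nonneg)
  have hC: "log_const * pot k \<le> log_const * (pot_const / real H)" using pot_le log_const_nonneg by (rule mult_left_mono)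
  have "mu * t \<le> ln (real k) + log_const * pot k" using exp_steps_bounds(1)[OF k, of i] by (simp add: t_def)
  moreover have "0 \<le> ln (real H)" using H_s by simp
  ultimately have tu: "t \<le> (ln (real k) + D) / mu" using mu_pos hC by (simp add: D_def pos_le_divide_eq mult.commute)
  have "ln (real k) - ln (real H) - log_const * pot k - contr ^ i * real k \<le> mu * t" using exp_steps_bounds(2)[OF k, of i] by (simp add: t_def)
  hence tl: "(ln (real k) - D) / mu \<le> t" using mu_pos hC ik' by (simp add: D_def pos_divide_le_eq mult.commute)
  have G: "\<bar>measure_pmf.expectation (mart i k n) power2 - sigma2 * t\<bar> \<le> \<epsilon> * t"
    using mart_second_moment[OF eps k, of i] by (simp add: t_def)
  have "measure_pmf.expectation (mart i k n) power2 \<le> (sigma2 + \<epsilon>) * t" using G by (simp add: distrib_right)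
  also have "\<dots> \<le> (sigma2 + \<epsilon>) * ((ln (real k) + D) / mu)" using tu \<epsilon> sigma2_nonneg by (intro mult_left_mono) auto
  finally have Gu: "measure_pmf.expectation (mart i k n) power2 \<le> (sigma2 + \<epsilon>) * (ln (real k) + D) / mu" by simp
  have "sigma2 * ((ln (real k) - D) / mu) - \<epsilon> * ((ln (real k) + D) / mu) \<le> sigma2 * t - \<epsilon> * t"
    using tl tu \<epsilon> sigma2_nonneg by (intro diff_mono mult_left_mono) auto
  also have "\<dots> \<le> measure_pmf.expectation (mart i k n) power2" using G by linarith
  finally have Gl: "(sigma2 * (ln (real k) - D) - \<epsilon> * (ln (real k) + D)) / mu \<le> measure_pmf.expectation (mart i k n) power2"
    by (simp only: diff_divide_distrib[symmetric] times_divide_eq_right)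
  have \<eta>01: "0 \<le> 1 + \<eta>" "0 \<le> 1 - \<eta>" using \<eta> by auto
  show "measure_pmf.expectation (depth_pmf n k) (\<lambda>d. (X k d)\<^sup>2) \<le> (1 + \<eta>) * ((sigma2 + \<epsilon>) * (ln (real k) + D) / mu) + (1 + 1 / \<eta>) * B k n"
    unfolding ES[of power2] using pert(1)[OF \<eta>] mult_left_mono[OF Gu \<eta>01(1)] by linarith
  show "(1 - \<eta>) * ((sigma2 * (ln (real k) - D) - \<epsilon> * (ln (real k) + D)) / mu) - 1 / \<eta> * B k n \<le> measure_pmf.expectation (depth_pmf n k) (\<lambda>d. (X k d)\<^sup>2)"
    unfolding ES[of power2] using pert(2)[OF \<eta>] mult_left_mono[OF Gl \<eta>01(2)] by linarith
  have "(measure_pmf.expectation (mart i k n) (\<lambda>g. g))\<^sup>2 \<le> (log_const * (pot_const / real H))\<^sup>2"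
    using mart_mean'[OF k, of i] log_const_nonneg pot_const_pos by (intro abs_le_square_iff[THEN iffD1]) simp
  thus "(measure_pmf.expectation (depth_pmf n k) (X k))\<^sup>2 \<le> 2 * (log_const * (pot_const / real H))\<^sup>2 + 2 * B k n"
    using pert(3) Ef[of "\<lambda>x. x"] ES[of "\<lambda>x. x"] by simp
qed

end

end


section \<open>Limits\<close>

lemma step_log_square_limit:
  assumes \<eta>: "0 < \<eta>"
  defines "e \<equiv> \<lambda>k n. step_exp k n (\<lambda>z. (mu + ln (real (fst z)) - ln (real k))\<^sup>2)"
  shows "\<forall>\<^sub>F H in sequentially. \<forall>k n. H < k \<longrightarrow> k \<le> n \<longrightarrow>
     \<bar>e k n - sigma2\<bar> + 2 * (log_const * (pot_const / real H)) * (e k n + 1) \<le> \<eta>"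
proof -
  \<comment> \<open>\<zeta> is the Young weight. As H grows, all errors carrying 1 / H vanish and
    \<zeta> times \<open>sigma2\<close> remains, so \<zeta> is chosen to make that less than \<eta>.
    Below, \<open>F\<close> collects the whole bound as a polynomial in p = 1 / H.\<close>
  define \<zeta> where "\<zeta> = min 1 (\<eta> / (2 * (sigma2 + 1)))"
  have \<zeta>: "0 < \<zeta>" "\<zeta> \<le> 1" using \<eta> sigma2_nonneg by (auto simp: \<zeta>_def)
  have "\<zeta> * (sigma2 + 1) \<le> \<eta> / (2 * (sigma2 + 1)) * (sigma2 + 1)"
    using sigma2_nonneg by (intro mult_right_mono) (auto simp: \<zeta>_def)
  also have "\<dots> = \<eta> / 2" using sigma2_nonneg by (simp add: field_simps)
  finally have \<zeta>s: "\<zeta> * sigma2 < \<eta>" using \<zeta> \<eta> by (simp add: distrib_left)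
  define g where "g = (\<lambda>p. \<zeta> * sigma2 + (1 + 1 / \<zeta>) * (log_const * p))"
  define F where "F = (\<lambda>p. g p + 2 * (log_const * (pot_const * p)) * ((sigma2 + g p) + 1))"
  have "(\<lambda>H. F (1 / real H)) \<longlonglongrightarrow> F 0"
    unfolding F_def g_def by (intro tendsto_intros lim_1_over_n)
  moreover have "F 0 < \<eta>" using \<zeta>s by (simp add: F_def g_def)
  ultimately have "\<forall>\<^sub>F H in sequentially. F (1 / real H) < \<eta>" by (rule order_tendstoD)
  moreover have "\<forall>\<^sub>F H in sequentially. s + 1 + 2 * num_fixed \<le> H" by (rule eventually_ge_at_top)
  ultimately show ?thesis
  proof eventually_elim
    case (elim H)
    show ?case
    proof (intro allI impI)
      fix k n assume k: "H < k" "k \<le> n"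
      have k': "s + 1 < k" "2 * num_fixed < k" using k elim by auto
      note sq = step_log_square'[OF k' k(2) \<zeta>]
      have "log_const / real k \<le> log_const / real H"
        using k elim log_const_nonneg by (intro divide_left_mono) auto
      hence d: "0 \<le> delta k" "delta k \<le> log_const * (1 / real H)" using delta_le[OF k'] by auto
      have "(1 + 1 / \<zeta>) * delta k \<le> (1 + 1 / \<zeta>) * (log_const * (1 / real H))"
        using d \<zeta> by (intro mult_left_mono) auto
      hence e: "\<bar>e k n - sigma2\<bar> \<le> g (1 / real H)"
        using sq d(1) unfolding g_def e_def distrib_right left_diff_distrib by linarith
      hence "2 * (log_const * (pot_const * (1 / real H))) * (e k n + 1) \<le> 2 * (log_const * (pot_const * (1 / real H))) * ((sigma2 + g (1 / real H)) + 1)"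
        using log_const_nonneg pot_const_pos by (intro mult_left_mono) auto
      with e elim(1) show "\<bar>e k n - sigma2\<bar> + 2 * (log_const * (pot_const / real H)) * (e k n + 1) \<le> \<eta>"
        unfolding F_def by simp
    qed
  qed
qed

lemma window_ln:
  assumes "real n / ln (real n) \<le> real k" "k \<le> n" "1 < ln (real n)"
  shows "1 \<le> k" "ln (real n) - ln (ln (real n)) \<le> ln (real k)" "ln (real k) \<le> ln (real n)"
    "ln (real n / real k) \<le> ln (ln (real n))"
proof -
  have n: "0 < real n" using assms(3) by (cases n) auto
  have "0 < real n / ln (real n)" using n assms(3) by (intro divide_pos_pos) linarith+
  hence k: "0 < real k" using assms(1) by linarith
  thus "1 \<le> k" by simp
  show "ln (real k) \<le> ln (real n)" using assms k n by simp
  have "ln (real n / ln (real n)) \<le> ln (real k)" using assms \<open>0 < real n / ln (real n)\<close> k by simp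
  thus "ln (real n) - ln (ln (real n)) \<le> ln (real k)"
    using n assms(3) ln_divide_pos[of "real n" "ln (real n)"] by linarith
  thus "ln (real n / real k) \<le> ln (ln (real n))" using n k by (simp add: ln_div)
qed

abbreviation depth_exp :: "nat \<Rightarrow> nat \<Rightarrow> (nat \<Rightarrow> real) \<Rightarrow> real" where
  "depth_exp n k f \<equiv> measure_pmf.expectation (depth_pmf n k) f"

text \<open>Order of choices: \<eta>, then H, then n. The residual bound contains a multiple of (ln
  n) / H from the drift of n / k, which for fixed H is not small against ln n and is multiplied by 1
  / \<eta>; taking 1 / H < \<eta>^2 leaves a multiple of \<eta> ln n. The other residual terms are
  o(ln n), since ln (n / k) <= ln ln n in the window.\<close>

lemma uniform_moments:
  fixes \<epsilon> :: real
  assumes \<epsilon>: "0 < \<epsilon>"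
  shows "\<forall>\<^sub>F n in sequentially. \<forall>k. real n / ln (real n) \<le> real k \<longrightarrow> k \<le> n \<longrightarrow>
      \<bar>depth_exp n k (\<lambda>d. (mu * real d - ln (real k))\<^sup>2) - sigma2 / mu * ln (real n)\<bar> \<le> \<epsilon> * ln (real n) \<and>
      (depth_exp n k (\<lambda>d. mu * real d - ln (real k)))\<^sup>2 \<le> \<epsilon> * ln (real n)"
proof -
  obtain C4 where C4: "C4 > 0"
    "\<And>n k. 1 \<le> k \<Longrightarrow> k \<le> n \<Longrightarrow> (\<integral>\<^sup>+d. ennreal ((real d)\<^sup>2) \<partial>depth_pmf n k) \<le> ennreal (C4 * (1 + ln (real n))\<^sup>2)"
    using second_moment_depth_pmf by blast
  define C where "C = resid_const C4"
  \<comment> \<open>Coefficient of (1 + ln n) / H in the residual bound. The three conditions on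
    \<eta> that follow are the limits in n of the final bounds, divided by ln n and with 1 / H
    replaced by \<eta>^2.\<close>
  define K where "K = C * (8 * real num_fixed * pot_const)"
  have "((\<lambda>\<eta>. (1 + \<eta>) * ((sigma2 + \<eta>) / mu) + K * (\<eta>\<^sup>2 + \<eta>)) \<longlongrightarrow> (1 + 0) * ((sigma2 + 0) / mu) + K * (0\<^sup>2 + 0)) (at_right 0)"
    using mu_pos by (intro tendsto_intros) auto
  hence "\<forall>\<^sub>F \<eta> in at_right 0. (1 + \<eta>) * ((sigma2 + \<eta>) / mu) + K * (\<eta>\<^sup>2 + \<eta>) < sigma2 / mu + \<epsilon>"
    using \<epsilon> by (intro order_tendstoD(2)) auto
  moreover have "((\<lambda>\<eta>. (1 - \<eta>) * ((sigma2 - \<eta>) / mu) - K * \<eta>) \<longlongrightarrow> (1 - 0) * ((sigma2 - 0) / mu) - K * 0) (at_right 0)"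
    using mu_pos by (intro tendsto_intros) auto
  hence "\<forall>\<^sub>F \<eta> in at_right 0. sigma2 / mu - \<epsilon> < (1 - \<eta>) * ((sigma2 - \<eta>) / mu) - K * \<eta>"
    using \<epsilon> by (intro order_tendstoD(1)) auto
  moreover have "((\<lambda>\<eta>. 2 * (K * \<eta>\<^sup>2)) \<longlongrightarrow> 2 * (K * 0\<^sup>2)) (at_right 0)"
    by (intro tendsto_intros)
  hence "\<forall>\<^sub>F \<eta> in at_right 0. 2 * (K * \<eta>\<^sup>2) < \<epsilon>"
    using \<epsilon> by (intro order_tendstoD(2)) auto
  moreover have "\<forall>\<^sub>F \<eta> in at_right 0. \<eta> \<in> {0<..<1::real}" by (rule eventually_at_right_real) simp
  ultimately have "\<forall>\<^sub>F \<eta> in at_right 0. (1 + \<eta>) * ((sigma2 + \<eta>) / mu) + K * (\<eta>\<^sup>2 + \<eta>) < sigma2 / mu + \<epsilon> \<and>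
     sigma2 / mu - \<epsilon> < (1 - \<eta>) * ((sigma2 - \<eta>) / mu) - K * \<eta> \<and> 2 * (K * \<eta>\<^sup>2) < \<epsilon> \<and> \<eta> \<in> {0<..<1}"
    by eventually_elim simp
  then obtain \<eta> where \<eta>u: "(1 + \<eta>) * ((sigma2 + \<eta>) / mu) + K * (\<eta>\<^sup>2 + \<eta>) < sigma2 / mu + \<epsilon>"
    and \<eta>l: "sigma2 / mu - \<epsilon> < (1 - \<eta>) * ((sigma2 - \<eta>) / mu) - K * \<eta>" and \<eta>s: "2 * (K * \<eta>\<^sup>2) < \<epsilon>"
    and \<eta>: "0 < \<eta>" "\<eta> < 1"
    using eventually_happens[of _ "at_right (0::real)"] by (force simp: trivial_limit_at_right_real)
  have "(\<lambda>H. 1 / real H) \<longlonglongrightarrow> 0" by (rule lim_1_over_n)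
  hence "\<forall>\<^sub>F H in sequentially. 1 / real H < \<eta>\<^sup>2" using \<eta> by (intro order_tendstoD(2)) auto
  moreover have "\<forall>\<^sub>F H in sequentially. s + 1 + 2 * num_fixed + nat \<lceil>(1 + real s1) / margin\<rceil> \<le> H" by (rule eventually_ge_at_top)
  moreover note step_log_square_limit[OF \<eta>(1)]
  ultimately have "\<forall>\<^sub>F H in sequentially. 1 / real H < \<eta>\<^sup>2 \<and> s + 1 + 2 * num_fixed + nat \<lceil>(1 + real s1) / margin\<rceil> \<le> H \<and>
     (\<forall>k n. H < k \<longrightarrow> k \<le> n \<longrightarrow>
     \<bar>step_exp k n (\<lambda>z. (mu + ln (real (fst z)) - ln (real k))\<^sup>2) - sigma2\<bar> +
     2 * (log_const * (pot_const / real H)) * (step_exp k n (\<lambda>z. (mu + ln (real (fst z)) - ln (real k))\<^sup>2) + 1) \<le> \<eta>)"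
    by eventually_elim blast
  then obtain H where H: "1 / real H < \<eta>\<^sup>2" "s + 1 + 2 * num_fixed + nat \<lceil>(1 + real s1) / margin\<rceil> \<le> H"
    and eps: "\<And>k n. H < k \<Longrightarrow> k \<le> n \<Longrightarrow>
     \<bar>step_exp k n (\<lambda>z. (mu + ln (real (fst z)) - ln (real k))\<^sup>2) - sigma2\<bar> +
     2 * (log_const * (pot_const / real H)) * (step_exp k n (\<lambda>z. (mu + ln (real (fst z)) - ln (real k))\<^sup>2) + 1) \<le> \<eta>"
    by (auto simp: eventually_sequentially)
  have "(1 + real s1) / margin \<le> real H" using H(2) by linarith
  hence Hth: "1 + real s1 \<le> margin * real H" using margin_contr(1) by (simp add: pos_divide_le_eq mult.commute)
  have Hs: "s + 1 \<le> H" and Hcc: "2 * num_fixed \<le> H" using H(2) by auto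
  have C: "C > 0" unfolding C_def by (rule resid_const_pos[OF Hs Hcc Hth C4])
  define D where "D = ln (real H) + log_const * (pot_const / real H) + 1"
  have D: "D \<ge> 0" using Hs log_const_nonneg pot_const_pos by (auto simp: D_def intro!: add_nonneg_nonneg)
  define Bf where "Bf = (\<lambda>k n. C * (2 * (1 + ln (real n / real k))\<^sup>2 + 2 * (ln (real H))\<^sup>2 + 8 * real num_fixed * (1 + ln (real n)) * (pot_const / real H) + 4))"
  note mom = moments_depth_pmf[OF Hs Hcc Hth C4 eps less_imp_le[OF \<eta>(1)] _ _ \<eta>(1) less_imp_le[OF \<eta>(2)],
      folded D_def, folded C_def]
  define c where "c = 2 * (ln (real H))\<^sup>2 + 4"
  define p where "p = (\<lambda>n::nat. 1 / ln (real n))"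
  define q where "q = (\<lambda>n::nat. (1 + ln (ln (real n)))\<^sup>2 / ln (real n))"
  define r where "r = (\<lambda>n::nat. ln (ln (real n)) / ln (real n))"
  have p: "p \<longlonglongrightarrow> 0" and q: "q \<longlonglongrightarrow> 0" and r: "r \<longlonglongrightarrow> 0"
    unfolding p_def q_def r_def by real_asymp+
  define BB where "BB = (\<lambda>n. C * (2 * q n + c * p n) + K * \<eta>\<^sup>2 * (p n + 1))"
  define m where "m = log_const * (pot_const / real H)"
  have BB: "BB \<longlonglongrightarrow> C * (2 * 0 + c * 0) + K * \<eta>\<^sup>2 * (0 + 1)"
    unfolding BB_def by (intro tendsto_intros p q)
  have "(\<lambda>n. (1 + \<eta>) * ((sigma2 + \<eta>) * (1 + D * p n) / mu) + (1 + 1 / \<eta>) * BB n) \<longlonglongrightarrow>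
     (1 + \<eta>) * ((sigma2 + \<eta>) * (1 + D * 0) / mu) + (1 + 1 / \<eta>) * (C * (2 * 0 + c * 0) + K * \<eta>\<^sup>2 * (0 + 1))"
    using mu_pos by (intro tendsto_intros p BB) auto
  moreover have "(1 + 1 / \<eta>) * (K * \<eta>\<^sup>2) = K * (\<eta>\<^sup>2 + \<eta>)" "1 / \<eta> * (K * \<eta>\<^sup>2) = K * \<eta>"
    using \<eta> by (simp_all add: field_simps power2_eq_square)
  ultimately have eu: "\<forall>\<^sub>F n in sequentially. (1 + \<eta>) * ((sigma2 + \<eta>) * (1 + D * p n) / mu) + (1 + 1 / \<eta>) * BB n < sigma2 / mu + \<epsilon>"
    using \<eta>u by (intro order_tendstoD(2)) auto
  have "(\<lambda>n. (1 - \<eta>) * ((sigma2 * (1 - r n - D * p n) - \<eta> * (1 + D * p n)) / mu) - 1 / \<eta> * BB n) \<longlonglongrightarrow>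
     (1 - \<eta>) * ((sigma2 * (1 - 0 - D * 0) - \<eta> * (1 + D * 0)) / mu) - 1 / \<eta> * (C * (2 * 0 + c * 0) + K * \<eta>\<^sup>2 * (0 + 1))"
    using mu_pos by (intro tendsto_intros p r BB) auto
  hence el: "\<forall>\<^sub>F n in sequentially. sigma2 / mu - \<epsilon> < (1 - \<eta>) * ((sigma2 * (1 - r n - D * p n) - \<eta> * (1 + D * p n)) / mu) - 1 / \<eta> * BB n"
    using \<eta>l \<open>1 / \<eta> * (K * \<eta>\<^sup>2) = K * \<eta>\<close> by (intro order_tendstoD(1)) auto
  have "(\<lambda>n. 2 * m\<^sup>2 * p n + 2 * BB n) \<longlonglongrightarrow> 2 * m\<^sup>2 * 0 + 2 * (C * (2 * 0 + c * 0) + K * \<eta>\<^sup>2 * (0 + 1))"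
    by (intro tendsto_intros p BB)
  hence es: "\<forall>\<^sub>F n in sequentially. 2 * m\<^sup>2 * p n + 2 * BB n < \<epsilon>"
    using \<eta>s by (intro order_tendstoD(2)) auto
  have "filterlim (\<lambda>n::nat. ln (real n)) at_top sequentially" by real_asymp
  hence "\<forall>\<^sub>F n in sequentially. 1 < ln (real n)" by (simp add: filterlim_at_top_dense)
  with eu el es show ?thesis
  proof eventually_elim
    case (elim n)
    define W where "W = ln (real n)"
    have W: "W > 1" using elim by (simp add: W_def)
    have Wp: "W * p n = 1" "W * q n = (1 + ln W)\<^sup>2" "W * r n = ln W"
      using W by (simp_all add: p_def q_def r_def W_def)
    have lW: "0 \<le> ln W" using W by simp
    show ?case
    proof (intro allI impI)
      fix k assume k: "real n / ln (real n) \<le> real k" "k \<le> n"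
      note w = window_ln[OF k elim(4), folded W_def]
      have B: "Bf k n \<le> W * BB n"
      proof -
        have "0 \<le> ln (real n / real k)" using k w(1) by simp
        hence "(1 + ln (real n / real k))\<^sup>2 \<le> (1 + ln W)\<^sup>2" using w(4) by (intro power_mono) auto
        moreover have "8 * real num_fixed * (1 + W) * (pot_const / real H) \<le> 8 * real num_fixed * pot_const * \<eta>\<^sup>2 * (1 + W)"
        proof -
          have "(8 * real num_fixed * pot_const * (1 + W)) * (1 / real H) \<le> (8 * real num_fixed * pot_const * (1 + W)) * \<eta>\<^sup>2"
            using H(1) pot_const_pos W by (intro mult_left_mono) auto
          thus ?thesis by (simp add: mult_ac)
        qed
        ultimately have "Bf k n \<le> C * ((2 * (1 + ln W)\<^sup>2 + c) + 8 * real num_fixed * pot_const * \<eta>\<^sup>2 * (1 + W))"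
          unfolding Bf_def c_def W_def[symmetric] using C by (intro mult_left_mono) auto
        also have "\<dots> = C * (2 * (W * q n) + c * (W * p n)) + K * \<eta>\<^sup>2 * (W * p n + W)"
          unfolding Wp by (simp add: K_def algebra_simps)
        also have "\<dots> = W * BB n" by (simp add: BB_def algebra_simps)
        finally show ?thesis .
      qed
      let ?X = "\<lambda>d. mu * real d - ln (real k)"
      have "depth_exp n k (\<lambda>d. (?X d)\<^sup>2) \<le> (1 + \<eta>) * ((sigma2 + \<eta>) * (ln (real k) + D) / mu) + (1 + 1 / \<eta>) * Bf k n"
        unfolding Bf_def by (rule mom(1)[OF _ _ _ _ w(1) k(2)])
      also have "\<dots> \<le> (1 + \<eta>) * ((sigma2 + \<eta>) * (W + D * (W * p n)) / mu) + (1 + 1 / \<eta>) * (W * BB n)"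
        using w B \<eta> sigma2_nonneg mu_pos unfolding Wp by (intro add_mono mult_left_mono divide_right_mono) auto
      also have "\<dots> = W * ((1 + \<eta>) * ((sigma2 + \<eta>) * (1 + D * p n) / mu) + (1 + 1 / \<eta>) * BB n)"
        using mu_pos \<eta> by (simp add: field_simps)
      also have "\<dots> \<le> W * (sigma2 / mu + \<epsilon>)" using elim W by (intro mult_left_mono) auto
      finally have up: "depth_exp n k (\<lambda>d. (?X d)\<^sup>2) \<le> sigma2 / mu * W + \<epsilon> * W" by (simp add: algebra_simps)
      have "W * (sigma2 / mu - \<epsilon>) \<le> W * ((1 - \<eta>) * ((sigma2 * (1 - r n - D * p n) - \<eta> * (1 + D * p n)) / mu) - 1 / \<eta> * BB n)"
        using elim W by (intro mult_left_mono) auto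
      also have "\<dots> = (1 - \<eta>) * ((sigma2 * (W - W * r n - D * (W * p n)) - \<eta> * (W + D * (W * p n))) / mu) - 1 / \<eta> * (W * BB n)"
        using mu_pos \<eta> by (simp add: field_simps)
      also have "\<dots> \<le> (1 - \<eta>) * ((sigma2 * (ln (real k) - D) - \<eta> * (ln (real k) + D)) / mu) - 1 / \<eta> * Bf k n"
        using w B \<eta> sigma2_nonneg mu_pos unfolding Wp by (intro diff_mono mult_left_mono divide_right_mono) auto
      also have "\<dots> \<le> depth_exp n k (\<lambda>d. (?X d)\<^sup>2)" unfolding Bf_def by (rule mom(2)[OF _ _ _ _ w(1) k(2)])
      finally have low: "sigma2 / mu * W - \<epsilon> * W \<le> depth_exp n k (\<lambda>d. (?X d)\<^sup>2)" by (simp add: algebra_simps)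
      have "(depth_exp n k ?X)\<^sup>2 \<le> 2 * m\<^sup>2 + 2 * Bf k n" unfolding m_def Bf_def by (rule mom(3)[OF _ _ _ _ w(1) k(2)])
      also have "\<dots> \<le> 2 * m\<^sup>2 * (W * p n) + 2 * (W * BB n)" using B unfolding Wp by simp
      also have "\<dots> = W * (2 * m\<^sup>2 * p n + 2 * BB n)" by (simp add: algebra_simps)
      also have "\<dots> \<le> W * \<epsilon>" using elim W by (intro mult_left_mono) auto
      finally have "(depth_exp n k ?X)\<^sup>2 \<le> \<epsilon> * W" by (simp add: mult.commute)
      with up low show "\<bar>depth_exp n k (\<lambda>d. (?X d)\<^sup>2) - sigma2 / mu * ln (real n)\<bar> \<le> \<epsilon> * ln (real n) \<and>
        (depth_exp n k ?X)\<^sup>2 \<le> \<epsilon> * ln (real n)" unfolding W_def[symmetric] by (simp add: abs_le_iff)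
    qed
  qed
qed


text \<open>Valid for every rank, not only in the window: it supplies integrability and controls the
  early balls in the average.\<close>

lemma mean_bound_depth_pmf:
  "\<exists>A>0. \<forall>n k. 1 \<le> k \<longrightarrow> k \<le> n \<longrightarrow> integrable (depth_pmf n k) real \<and> integrable (depth_pmf n k) (\<lambda>d. (real d)\<^sup>2) \<and>
      depth_exp n k real \<le> A * (1 + ln (real n))"
proof -
  obtain C where C: "C > 0"
    "\<And>n k. 1 \<le> k \<Longrightarrow> k \<le> n \<Longrightarrow> (\<integral>\<^sup>+d. ennreal ((real d)\<^sup>2) \<partial>depth_pmf n k) \<le> ennreal (C * (1 + ln (real n))\<^sup>2)"
    using second_moment_depth_pmf by blast
  have "integrable (depth_pmf n k) real \<and> integrable (depth_pmf n k) (\<lambda>d. (real d)\<^sup>2) \<and> depth_exp n k real \<le> (1 + C) * (1 + ln (real n))"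
    if k: "1 \<le> k" "k \<le> n" for n k
  proof -
    have ln0: "0 \<le> ln (real n)" using k by simp
    have i2: "integrable (depth_pmf n k) (\<lambda>d. (real d)\<^sup>2)"
      using C(2)[OF k] by (intro integrableI_nonneg) (auto simp: top_unique less_top[symmetric])
    have "real d \<le> 1 + (real d)\<^sup>2" for d using abs_le_one_plus_square[of "real d"] by simp
    hence i1: "integrable (depth_pmf n k) real"
      by (intro Bochner_Integration.integrable_bound[of _ "\<lambda>d. 1 + (real d)\<^sup>2" real]) (use i2 in auto)
    have "ennreal (depth_exp n k (\<lambda>d. (real d)\<^sup>2)) = (\<integral>\<^sup>+d. ennreal ((real d)\<^sup>2) \<partial>depth_pmf n k)"
      using i2 by (intro nn_integral_eq_integral[symmetric]) auto
    hence "depth_exp n k (\<lambda>d. (real d)\<^sup>2) \<le> C * (1 + ln (real n))\<^sup>2"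
      using C(2)[OF k] C(1) ennreal_le_iff[of "C * (1 + ln (real n))\<^sup>2" "depth_exp n k (\<lambda>d. (real d)\<^sup>2)"] by simp
    also have "\<dots> \<le> (1 + C)\<^sup>2 * (1 + ln (real n))\<^sup>2"
    proof (rule mult_right_mono)
      show "C \<le> (1 + C)\<^sup>2" using C(1) by (simp add: power2_eq_square algebra_simps)
    qed simp
    also have "(depth_exp n k real)\<^sup>2 \<le> depth_exp n k (\<lambda>d. (real d)\<^sup>2)"
      using measure_pmf.variance_positive[of "depth_pmf n k" real] measure_pmf.variance_eq[OF i1 i2] by simp
    finally have "(depth_exp n k real)\<^sup>2 \<le> ((1 + C) * (1 + ln (real n)))\<^sup>2" by (simp add: power_mult_distrib)
    hence "depth_exp n k real \<le> (1 + C) * (1 + ln (real n))"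
      by (rule power2_le_imp_le) (use C(1) ln0 in simp)
    with i1 i2 show ?thesis by simp
  qed
  thus ?thesis using C(1) by (intro exI[of _ "1 + C"]) auto
qed

lemma integral_L:
  fixes f :: "real \<Rightarrow> real"
  shows "f \<in> borel_measurable borel \<Longrightarrow> (\<integral>x. f x \<partial>L) = (\<integral>x. f (x 0) \<partial>Vlaw)"
  unfolding L_def using measurable_V by (rule integral_distr)

lemma mu_eq: "mu = real b * (\<integral>x. - (x 0 * ln (x 0)) \<partial>Vlaw)"
  by (simp add: mu_def integral_L)

lemma sigma2_eq_Vlaw: "sigma2 = real b * (\<integral>x. x 0 * (ln (x 0))\<^sup>2 \<partial>Vlaw) - mu\<^sup>2"
  by (simp add: sigma2_eq integral_L)

lemma eventually_ln_large: "\<forall>\<^sub>F n::nat in sequentially. c < ln (real n)"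
proof -
  have "filterlim (\<lambda>n::nat. ln (real n)) at_top sequentially" by real_asymp
  thus ?thesis by (simp add: filterlim_at_top_dense)
qed

text \<open>The squared mean of \<open>mu\<close> D - ln k is o(ln n), so the mean is o(sqrt (ln
  n)); replacing ln k by ln n costs at most ln ln n, which is also o(sqrt (ln n)).\<close>

lemma uniform_mean:
  assumes \<epsilon>: "0 < \<epsilon>"
  shows "\<forall>\<^sub>F n in sequentially. \<forall>k. real n / ln (real n) \<le> real k \<longrightarrow> k \<le> n \<longrightarrow>
      \<bar>depth_exp n k real - ln (real n) / mu\<bar> \<le> \<epsilon> * sqrt (ln (real n))"
proof -
  define e where "e = \<epsilon> * mu / 2"
  have e: "e > 0" using \<epsilon> mu_pos by (simp add: e_def)
  obtain A where A: "0 < A" "\<forall>n k. 1 \<le> k \<longrightarrow> k \<le> n \<longrightarrow> integrable (depth_pmf n k) real \<and> integrable (depth_pmf n k) (\<lambda>d. (real d)\<^sup>2) \<and>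
      depth_exp n k real \<le> A * (1 + ln (real n))" using mean_bound_depth_pmf by blast
  have "(\<lambda>n. ln (ln (real n)) / sqrt (ln (real n))) \<longlonglongrightarrow> 0" by real_asymp
  hence "\<forall>\<^sub>F n in sequentially. ln (ln (real n)) / sqrt (ln (real n)) < e" using e by (rule order_tendstoD)
  with uniform_moments[OF zero_less_power[OF e, of 2]] eventually_ln_large[of 1] show ?thesis
  proof (eventually_elim, intro allI impI)
    case a: (elim n)
    fix k
    assume k: "real n / ln (real n) \<le> real k" "k \<le> n"
    define W where "W = ln (real n)"
    note w = window_ln[OF k a(2), folded W_def]
    have W: "W > 1" using a(2) by (simp add: W_def)
    let ?X = "depth_exp n k (\<lambda>d. mu * real d - ln (real k))"
    have X: "?X = mu * depth_exp n k real - ln (real k)" using A(2)[rule_format, OF w(1) k(2)] by simp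
    have "?X\<^sup>2 \<le> (e * sqrt W)\<^sup>2" using a(1)[rule_format, OF k] W by (simp add: W_def power_mult_distrib)
    hence "\<bar>?X\<bar> \<le> e * sqrt W" using e W by (simp add: abs_le_square_iff[symmetric])
    moreover have "ln W \<le> e * sqrt W" using a(3) W unfolding W_def[symmetric] by (simp add: pos_divide_less_eq)
    ultimately have "\<bar>mu * depth_exp n k real - W\<bar> \<le> 2 * e * sqrt W" using w unfolding X by linarith
    hence "\<bar>mu * depth_exp n k real - W\<bar> / mu \<le> 2 * e * sqrt W / mu" using mu_pos by (intro divide_right_mono) auto
    also have "\<bar>mu * depth_exp n k real - W\<bar> / mu = \<bar>(mu * depth_exp n k real - W) / mu\<bar>" using mu_pos by (simp add: abs_divide)
    also have "(mu * depth_exp n k real - W) / mu = depth_exp n k real - W / mu" using mu_pos by (simp add: field_simps)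
    finally show "\<bar>depth_exp n k real - ln (real n) / mu\<bar> \<le> \<epsilon> * sqrt (ln (real n))" using mu_pos by (simp add: e_def W_def)
  qed
qed

text \<open>Scaling by \<open>mu\<close> and shifting by ln k changes the variance by the factor
  \<open>mu\<close> squared only, and the squared mean of \<open>mu\<close> D - ln k is o(ln
  n).\<close>

lemma uniform_variance:
  assumes \<epsilon>: "0 < \<epsilon>"
  shows "\<forall>\<^sub>F n in sequentially. \<forall>k. real n / ln (real n) \<le> real k \<longrightarrow> k \<le> n \<longrightarrow>
      \<bar>depth_exp n k (\<lambda>d. (real d - depth_exp n k real)\<^sup>2) - sigma2 / mu ^ 3 * ln (real n)\<bar> \<le> \<epsilon> * ln (real n)"
proof -
  define e where "e = \<epsilon> * mu\<^sup>2 / 2"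
  have e: "e > 0" using \<epsilon> mu_pos by (simp add: e_def)
  obtain A where A: "0 < A" "\<forall>n k. 1 \<le> k \<longrightarrow> k \<le> n \<longrightarrow> integrable (depth_pmf n k) real \<and> integrable (depth_pmf n k) (\<lambda>d. (real d)\<^sup>2) \<and>
      depth_exp n k real \<le> A * (1 + ln (real n))" using mean_bound_depth_pmf by blast
  from uniform_moments[OF e] eventually_ln_large[of 1] show ?thesis
  proof eventually_elim
    case (elim n)
    define W where "W = ln (real n)"
    show ?case
    proof (intro allI impI)
      fix k assume k: "real n / ln (real n) \<le> real k" "k \<le> n"
      have i: "integrable (depth_pmf n k) real" "integrable (depth_pmf n k) (\<lambda>d. (real d)\<^sup>2)"
        using A(2)[rule_format, OF window_ln(1)[OF k elim(2)] k(2)] by auto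
      define m where "m = depth_exp n k real"
      define v where "v = depth_exp n k (\<lambda>d. (real d - m)\<^sup>2)"
      have X: "depth_exp n k (\<lambda>d. mu * real d - ln (real k)) = mu * m - ln (real k)" using i by (simp add: m_def)
      have v1: "v = depth_exp n k (\<lambda>d. (real d)\<^sup>2) - m\<^sup>2"
        unfolding v_def m_def using measure_pmf.variance_eq[OF i] by simp
      have "depth_exp n k (\<lambda>d. (mu * real d - ln (real k))\<^sup>2) =
        depth_exp n k (\<lambda>d. mu\<^sup>2 * (real d)\<^sup>2 - 2 * mu * ln (real k) * real d + (ln (real k))\<^sup>2)"
        by (intro Bochner_Integration.integral_cong refl) (simp add: power2_eq_square algebra_simps)
      also have "\<dots> = mu\<^sup>2 * depth_exp n k (\<lambda>d. (real d)\<^sup>2) - 2 * mu * ln (real k) * m + (ln (real k))\<^sup>2"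
        using i by (simp add: m_def)
      finally have v: "mu\<^sup>2 * v = depth_exp n k (\<lambda>d. (mu * real d - ln (real k))\<^sup>2) - (depth_exp n k (\<lambda>d. mu * real d - ln (real k)))\<^sup>2"
        unfolding X v1 by (simp add: power2_diff power_mult_distrib algebra_simps)
      have "\<bar>x - y - z\<bar> \<le> 2 * c" if "\<bar>x - z\<bar> \<le> c \<and> y \<le> c" "0 \<le> y" for x y z c :: real
        using that by linarith
      from this[OF elim(1)[rule_format, OF k] zero_le_power2]
      have "\<bar>mu\<^sup>2 * v - sigma2 / mu * W\<bar> \<le> 2 * e * W" unfolding v W_def by (simp only: mult.assoc)
      hence "\<bar>mu\<^sup>2 * v - sigma2 / mu * W\<bar> / mu\<^sup>2 \<le> 2 * e * W / mu\<^sup>2" by (intro divide_right_mono) auto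
      also have "\<bar>mu\<^sup>2 * v - sigma2 / mu * W\<bar> / mu\<^sup>2 = \<bar>(mu\<^sup>2 * v - sigma2 / mu * W) / mu\<^sup>2\<bar>" by (simp add: abs_divide)
      also have "(mu\<^sup>2 * v - sigma2 / mu * W) / mu\<^sup>2 = v - sigma2 / mu ^ 3 * W"
        using mu_pos by (simp add: field_simps power2_eq_square power3_eq_cube)
      finally show "\<bar>depth_exp n k (\<lambda>d. (real d - depth_exp n k real)\<^sup>2) - sigma2 / mu ^ 3 * ln (real n)\<bar> \<le> \<epsilon> * ln (real n)"
        using mu_pos by (simp add: e_def W_def v_def m_def)
    qed
  qed
qed

text \<open>Ranks k < n / ln n make up a fraction of at most 1 / ln n of the balls and have means
  O(ln n), so they change the average by O(1).\<close>

lemma uniform_average: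
  assumes \<epsilon>: "0 < \<epsilon>"
  shows "\<forall>\<^sub>F n in sequentially. \<bar>1 / real n * (\<Sum>k=1..n. depth_exp n k real) - ln (real n) / mu\<bar> \<le> \<epsilon> * sqrt (ln (real n))"
proof -
  obtain A where A: "0 < A" "\<forall>n k. 1 \<le> k \<longrightarrow> k \<le> n \<longrightarrow> integrable (depth_pmf n k) real \<and> integrable (depth_pmf n k) (\<lambda>d. (real d)\<^sup>2) \<and>
      depth_exp n k real \<le> A * (1 + ln (real n))" using mean_bound_depth_pmf by blast
  define A' where "A' = A + 1 / mu"
  have A': "A' > 0" using A(1) mu_pos by (simp add: A'_def add_pos_pos)
  have "0 < \<epsilon> / 2" using \<epsilon> by simp
  from uniform_mean[OF this] eventually_ln_large[of 1] eventually_ln_large[of "(4 * A' / \<epsilon>)\<^sup>2"]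
  show ?thesis
  proof eventually_elim
    case (elim n)
    define W where "W = ln (real n)"
    have W: "W > 1" using elim(2) by (simp add: W_def)
    have n: "real n > 0" using elim(2) by (cases n) auto
    have "4 * A' / \<epsilon> \<le> sqrt W" using elim(3) by (intro real_le_rsqrt) (simp add: W_def)
    hence small: "2 * A' \<le> \<epsilon> / 2 * sqrt W" using \<epsilon> by (simp add: pos_divide_le_eq mult.commute)
    define S where "S = {k \<in> {1..n}. real k < real n / W}"
    have summand: "\<bar>depth_exp n k real - W / mu\<bar> \<le> \<epsilon> / 2 * sqrt W + (if k \<in> S then A' * (1 + W) else 0)" if k: "k \<in> {1..n}" for k
    proof (cases "k \<in> S")
      case False
      hence "real n / ln (real n) \<le> real k" using k by (auto simp: S_def W_def)
      thus ?thesis using elim(1) k False by (simp add: W_def)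
    next
      case True
      have "0 \<le> depth_exp n k real" by simp
      moreover have "depth_exp n k real \<le> A * (1 + W)" using A(2)[rule_format, of k n] k by (simp add: W_def)
      moreover have "0 \<le> W / mu" "W / mu \<le> 1 / mu * (1 + W)" using W mu_pos by (simp_all add: field_simps)
      moreover have "0 \<le> A * (1 + W)" using A(1) W by simp
      moreover have "0 \<le> \<epsilon> / 2 * sqrt W" using \<epsilon> W by simp
      ultimately have "\<bar>depth_exp n k real - W / mu\<bar> \<le> \<epsilon> / 2 * sqrt W + (A * (1 + W) + 1 / mu * (1 + W))"
        unfolding abs_le_iff by (intro conjI) linarith+
      thus ?thesis using True by (simp only: A'_def distrib_right if_True)
    qed
    have "S \<subseteq> {1..nat \<lfloor>real n / W\<rfloor>}" unfolding S_def by (auto simp: le_nat_floor)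
    hence "card S \<le> nat \<lfloor>real n / W\<rfloor>" using card_mono[of "{1..nat \<lfloor>real n / W\<rfloor>}" S] by simp
    moreover have "0 \<le> real n / W" using n W by simp
    ultimately have cS: "real (card S) \<le> real n / W" by linarith
    have "\<bar>(\<Sum>k=1..n. depth_exp n k real) - real n * (W / mu)\<bar> = \<bar>\<Sum>k=1..n. depth_exp n k real - W / mu\<bar>"
      by (simp add: sum_subtractf)
    also have "\<dots> \<le> (\<Sum>k=1..n. \<epsilon> / 2 * sqrt W + (if k \<in> S then A' * (1 + W) else 0))"
      by (rule order_trans[OF sum_abs]) (intro sum_mono summand)
    also have "\<dots> = real n * (\<epsilon> / 2 * sqrt W) + real (card S) * (A' * (1 + W))"
    proof -
      have "{1..n} \<inter> S = S" by (auto simp: S_def)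
      thus ?thesis by (simp add: sum.distrib sum.If_cases)
    qed
    also have "\<dots> \<le> real n * (\<epsilon> / 2 * sqrt W) + real n / W * (A' * (2 * W))"
      using cS A' W by (intro add_left_mono mult_mono) auto
    also have "real n / W * (A' * (2 * W)) = real n * (2 * A')" using W by simp
    also have "real n * (\<epsilon> / 2 * sqrt W) + real n * (2 * A') \<le> real n * (\<epsilon> / 2 * sqrt W) + real n * (\<epsilon> / 2 * sqrt W)"
      using small n by (intro add_left_mono mult_left_mono) auto
    also have "\<dots> = real n * (\<epsilon> * sqrt W)" by simp
    finally have "\<bar>(\<Sum>k=1..n. depth_exp n k real) - real n * (W / mu)\<bar> / real n \<le> \<epsilon> * sqrt W"
      using n by (simp add: pos_divide_le_eq mult.commute)
    also have "\<bar>(\<Sum>k=1..n. depth_exp n k real) - real n * (W / mu)\<bar> / real n = \<bar>((\<Sum>k=1..n. depth_exp n k real) - real n * (W / mu)) / real n\<bar>"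
      by (simp add: abs_divide)
    also have "((\<Sum>k=1..n. depth_exp n k real) - real n * (W / mu)) / real n = 1 / real n * (\<Sum>k=1..n. depth_exp n k real) - W / mu"
      using n by (simp add: diff_divide_distrib)
    finally show ?case by (simp add: W_def)
  qed
qed

end

lemma tendsto_divide_zero_if_small:
  fixes f g :: "nat \<Rightarrow> real"
  assumes "\<And>\<epsilon>. 0 < \<epsilon> \<Longrightarrow> \<forall>\<^sub>F n in sequentially. \<bar>f n\<bar> \<le> \<epsilon> * g n" and g: "\<forall>\<^sub>F n in sequentially. 0 < g n"
  shows "(\<lambda>n. f n / g n) \<longlonglongrightarrow> 0"
  unfolding tendsto_iff
proof (intro allI impI)
  fix e :: real assume e: "0 < e"
  hence "0 < e / 2" by simp
  from assms(1)[OF this] g show "\<forall>\<^sub>F n in sequentially. dist (f n / g n) 0 < e"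
  proof eventually_elim
    case (elim n)
    have "\<bar>f n\<bar> / g n \<le> e / 2" using elim by (simp only: pos_divide_le_eq)
    hence "\<bar>f n\<bar> / g n < e" using e by linarith
    thus ?case using elim(2) by (simp add: abs_divide)
  qed
qed

theorem theorem3:
  fixes b s s0 s1 :: nat and Vlaw :: "(nat \<Rightarrow> real) measure" and \<mu> \<sigma>2 :: real
  assumes b: "b \<ge> 2" and s: "s \<ge> 1" and s0: "s0 \<le> s" and s1: "b * s1 \<le> s + 1 - s0"
    and P: "prob_space Vlaw"
    and sets_V: "sets Vlaw = sets (PiM UNIV (\<lambda>_::nat. borel))"
    and simplex: "AE x in Vlaw. (\<forall>i<b. 0 \<le> x i) \<and> (\<Sum>i<b. x i) = 1"
    and ident: "\<forall>i<b. distr Vlaw borel (\<lambda>x. x i) = distr Vlaw borel (\<lambda>x. x 0)"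
    and A1_0: "measure Vlaw {x \<in> space Vlaw. x 0 = 0} = 0"
    and A1_1: "measure Vlaw {x \<in> space Vlaw. x 0 = 1} = 0"
    and A1_nl: "non_lattice Vlaw (\<lambda>x. - ln (x 0))"
    and mu_def: "\<mu> = real b * (\<integral>x. - (x 0 * ln (x 0)) \<partial>Vlaw)"
    and sigma_def: "\<sigma>2 = real b * (\<integral>x. x 0 * (ln (x 0))\<^sup>2 \<partial>Vlaw) - \<mu>\<^sup>2"
  shows "((\<lambda>n. (ED b s s0 s1 Vlaw n n - ln (real n) / \<mu>) / sqrt (ln (real n)))
           \<longlonglongrightarrow> 0)
       \<and> ((\<lambda>n. ((1 / real n) * (\<Sum>k=1..n. ED b s s0 s1 Vlaw n k) - ln (real n) / \<mu>)
              / sqrt (ln (real n))) \<longlonglongrightarrow> 0)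
       \<and> (\<forall>kn :: nat \<Rightarrow> nat.
           (\<forall>\<^sub>F n in sequentially. real n / ln (real n) \<le> real (kn n) \<and> kn n \<le> n) \<longrightarrow>
           (\<lambda>n. VarD b s s0 s1 Vlaw n (kn n) / ln (real n)) \<longlonglongrightarrow> \<sigma>2 / \<mu> ^ 3)"
proof -
  note params = mu_def sigma_def
  interpret split_tree b s s0 s1 Vlaw
    by (intro split_tree.intro split_params.intro split_tree_axioms.intro b s s0 s1 P sets_V simplex ident A1_0 A1_1)
  have \<mu>: "\<mu> = mu" unfolding params(1) by (rule mu_eq[symmetric])
  have \<sigma>: "\<sigma>2 = sigma2" unfolding params(2) \<mu> by (rule sigma2_eq_Vlaw[symmetric])
  have pos: "\<forall>\<^sub>F n::nat in sequentially. 0 < sqrt (ln (real n))" using eventually_ln_large[of 0] by simp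
  have "(\<lambda>n. (ED b s s0 s1 Vlaw n n - ln (real n) / mu) / sqrt (ln (real n))) \<longlonglongrightarrow> 0"
  proof (rule tendsto_divide_zero_if_small[OF _ pos])
    fix \<epsilon> :: real assume "0 < \<epsilon>"
    from uniform_mean[OF this] eventually_ln_large[of 1]
    show "\<forall>\<^sub>F n in sequentially. \<bar>ED b s s0 s1 Vlaw n n - ln (real n) / mu\<bar> \<le> \<epsilon> * sqrt (ln (real n))"
    proof eventually_elim
      case (elim n)
      \<comment> \<open>The last ball lies in the window n / ln n <= k <= n as soon as ln n >=
        1.\<close>
      have "real n * 1 \<le> real n * ln (real n)" using elim(2) by (intro mult_left_mono) auto
      hence "real n / ln (real n) \<le> real n" using elim(2) by (simp add: pos_divide_le_eq)
      thus ?case using elim(1) unfolding ED_eq by simp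
    qed
  qed
  moreover have "(\<lambda>n. ((1 / real n) * (\<Sum>k=1..n. ED b s s0 s1 Vlaw n k) - ln (real n) / mu) / sqrt (ln (real n))) \<longlonglongrightarrow> 0"
    unfolding ED_eq by (rule tendsto_divide_zero_if_small[OF uniform_average pos])
  moreover have "(\<lambda>n. VarD b s s0 s1 Vlaw n (kn n) / ln (real n)) \<longlonglongrightarrow> sigma2 / mu ^ 3"
    if kn: "\<forall>\<^sub>F n in sequentially. real n / ln (real n) \<le> real (kn n) \<and> kn n \<le> n" for kn
  proof -
    have "(\<lambda>n. (VarD b s s0 s1 Vlaw n (kn n) - sigma2 / mu ^ 3 * ln (real n)) / ln (real n)) \<longlonglongrightarrow> 0"
    proof (rule tendsto_divide_zero_if_small[OF _ eventually_ln_large])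
      fix \<epsilon> :: real assume "0 < \<epsilon>"
      from uniform_variance[OF this] kn
      show "\<forall>\<^sub>F n in sequentially. \<bar>VarD b s s0 s1 Vlaw n (kn n) - sigma2 / mu ^ 3 * ln (real n)\<bar> \<le> \<epsilon> * ln (real n)"
        unfolding VarD_eq by eventually_elim blast
    qed
    hence "(\<lambda>n. (VarD b s s0 s1 Vlaw n (kn n) - sigma2 / mu ^ 3 * ln (real n)) / ln (real n) + sigma2 / mu ^ 3) \<longlonglongrightarrow> 0 + sigma2 / mu ^ 3"
      by (intro tendsto_intros)
    moreover have "\<forall>\<^sub>F n in sequentially. (VarD b s s0 s1 Vlaw n (kn n) - sigma2 / mu ^ 3 * ln (real n)) / ln (real n) + sigma2 / mu ^ 3 =
        VarD b s s0 s1 Vlaw n (kn n) / ln (real n)"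
      using eventually_ln_large[of 0] by eventually_elim (simp add: diff_divide_distrib)
    ultimately show ?thesis by (simp add: tendsto_cong)
  qed
  ultimately show ?thesis unfolding \<mu> \<sigma> by blast
qed

end
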